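(* Let $N$ and $P$ be $C^1$-manifolds, let $V\subset N$ be a closed subset, let $\Sigma$ be a prestratification of $V$, and let $f:N\to P$ be a stratified map for $\Sigma$. Then the following are equivalent: (1) $\Sigma$ is $(a_f)$-regular; (2) for every $C^1$-manifold $M$, the set $\{g\in C^1(M,N) : g\pitchfork\mathfrak{F}^f_\Sigma\}$ is open in $C^1(M,N)$ with the strong topology; (3) the set $\{g\in C^1(N,N) : g\pitchfork\mathfrak{F}^f_\Sigma\}$ is open in $C^1(N,N)$ with the strong topology.
   Context: Prestratification: let $V$ be a closed subset of a $C^1$-manifold $N$. A prestratification $\Sigma$ of $V$ is a collection of pairwise disjoint subsets $\{S_\alpha\}_{\alpha\in\Lambda}$ of $V$ (the strata) such that $\bigcup_\alpha S_\alpha=V$, each $S_\alpha$ is an embedded connected ($C^1$) submanifold of $N$, and every point of $V$ has a neighbourhood in $N$ meeting only finitely many strata. (No frontier condition is assumed.) Stratified map: a $C^1$-map $f:N\to P$ such that the restriction $f|_S$ has constant rank on every stratum $S$ of $\Sigma$. Induced foliation: if $f$ has constant rank on a submanifold $S$ of $N$, then $\mathfrak{F}^f_S$ denotes the foliation of $S$ induced by $f$, whose leaves are the connected components of the fibres of $f|_S$; for $x\in S$, $T_x(\mathfrak{F}^f_S)=\ker d_x(f|_S)$ is the tangent space at $x$ of the leaf through $x$. $(a_f)$-regularity: let $X,Y$ be submanifolds of $N$ on each of which $f$ has constant rank. $X$ is $(a_f)$-regular over $Y$ at $y\in Y\cap\overline{X}$ if for every sequence $\{x_i\}$ in $X$ converging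 to $y$ such that $T_{x_i}(\mathfrak{F}^f_X)$ converges (in the Grassmann bundle of $TN$) to some $\tau$, one has $T_y(\mathfrak{F}^f_Y)\subset\tau$. A pair of strata $(X,Y)$ is $(a_f)$-regular if $X$ is $(a_f)$-regular over $Y$ at every point of $Y\cap\overline{X}$ and $Y$ is $(a_f)$-regular over $X$ at every point of $X\cap\overline{Y}$. $\Sigma$ is $(a_f)$-regular if every pair of strata of $\Sigma$ is $(a_f)$-regular. Transversality: for a $C^1$-map $g:M\to N$, $g\pitchfork\mathfrak{F}^f_\Sigma$ means that $g$ is transverse at every point of $M$ to every leaf of $\mathfrak{F}^f_S$ for every stratum $S$ of $\Sigma$; that is, for every $w\in M$ and every stratum $S$ with $g(w)\in S$, $Dg_w(T_wM)+T_{g(w)}(\mathfrak{F}^f_S)=T_{g(w)}N$. $C^1(M,N)$ is the set of all $C^1$-maps from $M$ to $N$; the strong topology is the $C^1$ Whitney (fine) topology. *)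

theory Defs
  imports "HOL-Analysis.Analysis" "HOL-Library.Function_Algebras"
begin

text \<open>
  The dimension of a manifold has to be a term (one of the conditions of the theorem quantifies
  over manifolds of all dimensions), so all the spaces \<open>R\<^sup>n\<close> are realised inside one normed
  space, the space of bounded real sequences.  The norm induced on \<open>Rn n\<close> is the maximum norm,
  which is equivalent to the Euclidean one.
\<close>

type_synonym rseq = "nat \<Rightarrow>\<^sub>C real"

definition Rn :: "nat \<Rightarrow> rseq set" where
  "Rn n = {x. \<forall>i\<ge>n. apply_bcontfun x i = 0}"

text \<open>
  The Frechet derivative at a point of a map defined near that point in \<open>Rn n\<close>.  It is uniquely
  determined on \<open>Rn n\<close> only; all uses below are restricted to vectors of \<open>Rn n\<close>.
\<close>

definition fderiv :: "nat \<Rightarrow> (rseq \<Rightarrow> rseq) \<Rightarrow> rseq \<Rightarrow> rseq \<Rightarrow> rseq" where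
  "fderiv n F x = frechet_derivative F (at x within Rn n)"

text \<open>
  Here \<open>U\<close> is meant to be relatively open in \<open>Rn n\<close>.  As \<open>Rn n\<close> is finite-dimensional, continuity
  of \<open>x \<mapsto> DF(x) v\<close> for each \<open>v\<close> is continuity of \<open>DF\<close> in the operator norm.
\<close>

definition C1_on :: "nat \<Rightarrow> rseq set \<Rightarrow> (rseq \<Rightarrow> rseq) \<Rightarrow> bool" where
  "C1_on n U F \<longleftrightarrow>
     (\<forall>x\<in>U. F differentiable (at x within Rn n)) \<and>
     (\<forall>v\<in>Rn n. continuous_on U (\<lambda>x. fderiv n F x v))"

type_synonym 'a chart = "'a set \<times> ('a \<Rightarrow> rseq)"

record 'a c1mfd =
  mtop :: "'a topology"
  mdim :: nat
  matlas :: "'a chart set"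

definition is_chart :: "'a topology \<Rightarrow> nat \<Rightarrow> 'a chart \<Rightarrow> bool" where
  "is_chart X n c \<longleftrightarrow>
     openin X (fst c) \<and>
     openin (top_of_set (Rn n)) (snd c ` fst c) \<and>
     homeomorphic_map (subtopology X (fst c)) (top_of_set (snd c ` fst c)) (snd c)"

definition cinv :: "'a chart \<Rightarrow> rseq \<Rightarrow> 'a" where
  "cinv c = inv_into (fst c) (snd c)"

definition compatible :: "nat \<Rightarrow> 'a chart \<Rightarrow> 'a chart \<Rightarrow> bool" where
  "compatible n c d \<longleftrightarrow>
     C1_on n (snd c ` (fst c \<inter> fst d)) (snd d \<circ> cinv c) \<and>
     C1_on n (snd d ` (fst c \<inter> fst d)) (snd c \<circ> cinv d)"

definition c1_manifold :: "'a c1mfd \<Rightarrow> bool" where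
  "c1_manifold N \<longleftrightarrow>
     Hausdorff_space (mtop N) \<and> second_countable (mtop N) \<and>
     (\<forall>c\<in>matlas N. is_chart (mtop N) (mdim N) c) \<and>
     (\<Union>c\<in>matlas N. fst c) = topspace (mtop N) \<and>
     (\<forall>c\<in>matlas N. \<forall>d\<in>matlas N. compatible (mdim N) c d)"

text \<open>The charts of \<open>N\<close> are those of the maximal atlas.\<close>

definition charts :: "'a c1mfd \<Rightarrow> 'a chart set" where
  "charts N = {c. is_chart (mtop N) (mdim N) c \<and> (\<forall>d\<in>matlas N. compatible (mdim N) c d)}"

definition charts_at :: "'a c1mfd \<Rightarrow> 'a \<Rightarrow> 'a chart set" where
  "charts_at N p = {c \<in> charts N. p \<in> fst c}"

definition local_rep :: "'m chart \<Rightarrow> 'a chart \<Rightarrow> ('m \<Rightarrow> 'a) \<Rightarrow> rseq \<Rightarrow> rseq" where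
  "local_rep c d g = snd d \<circ> g \<circ> cinv c"

text \<open>
  A map between carriers is made into a single HOL function by the value \<open>undefined\<close> outside the
  domain, so that \<open>C1_maps M N\<close> is in bijection with the set of C1 maps from \<open>M\<close> to \<open>N\<close>.
\<close>

definition C1_maps :: "'m c1mfd \<Rightarrow> 'a c1mfd \<Rightarrow> ('m \<Rightarrow> 'a) set" where
  "C1_maps M N =
     {g \<in> extensional (topspace (mtop M)).
        continuous_map (mtop M) (mtop N) g \<and>
        (\<forall>c\<in>charts M. \<forall>d\<in>charts N.
           C1_on (mdim M) (snd c ` {p \<in> fst c. g p \<in> fst d}) (local_rep c d g))}"

text \<open>Functions into a real vector space form a real vector space pointwise.\<close>

instantiation "fun" :: (type, real_vector) real_vector
begin

definition scaleR_fun :: "real \<Rightarrow> ('a \<Rightarrow> 'b) \<Rightarrow> 'a \<Rightarrow> 'b" where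
  "scaleR_fun r f = (\<lambda>x. r *\<^sub>R f x)"

instance
  by standard (auto simp: scaleR_fun_def fun_eq_iff algebra_simps)

end

text \<open>
  A tangent vector at \<open>p\<close> assigns to each chart at \<open>p\<close> a coordinate vector such that the coordinate
  vectors transform by the derivatives of the changes of charts; it is 0 on other arguments.  Thus
  the tangent space at \<open>p\<close> is a linear subspace of the space of functions from charts to sequences,
  and \<open>v \<mapsto> v c\<close> is an isomorphism from it to \<open>Rn (mdim N)\<close> for every chart \<open>c\<close> at \<open>p\<close>.
\<close>

type_synonym 'a tvec = "'a chart \<Rightarrow> rseq"

definition tangent_space :: "'a c1mfd \<Rightarrow> 'a \<Rightarrow> 'a tvec set" where
  "tangent_space N p =
     {v. (\<forall>c. c \<notin> charts_at N p \<longrightarrow> v c = 0) \<and>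
         (\<forall>c\<in>charts_at N p. v c \<in> Rn (mdim N)) \<and>
         (\<forall>c\<in>charts_at N p. \<forall>d\<in>charts_at N p.
            v d = fderiv (mdim N) (snd d \<circ> cinv c) (snd c p) (v c))}"

text \<open>By the chain rule the choice of the chart \<open>c\<close> in the source does not matter.\<close>

definition differential :: "'m c1mfd \<Rightarrow> 'a c1mfd \<Rightarrow> ('m \<Rightarrow> 'a) \<Rightarrow> 'm \<Rightarrow> 'm tvec \<Rightarrow> 'a tvec" where
  "differential M N g w v =
     (let c = (SOME c. c \<in> charts_at M w) in
      (\<lambda>d. if d \<in> charts_at N (g w)
           then fderiv (mdim M) (local_rep c d g) (snd c w) (v c) else 0))"

text \<open>A chart in which \<open>S\<close> is the subset where the coordinates of index at least \<open>k\<close> vanish.\<close>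

definition slice_chart :: "'a c1mfd \<Rightarrow> 'a set \<Rightarrow> nat \<Rightarrow> 'a chart \<Rightarrow> bool" where
  "slice_chart N S k c \<longleftrightarrow>
     c \<in> charts N \<and> k \<le> mdim N \<and> snd c ` (fst c \<inter> S) = snd c ` fst c \<inter> Rn k"

definition embedded_submanifold :: "'a c1mfd \<Rightarrow> 'a set \<Rightarrow> bool" where
  "embedded_submanifold N S \<longleftrightarrow>
     S \<subseteq> topspace (mtop N) \<and> (\<exists>k. \<forall>p\<in>S. \<exists>c. p \<in> fst c \<and> slice_chart N S k c)"

definition sub_tangent_space :: "'a c1mfd \<Rightarrow> 'a set \<Rightarrow> 'a \<Rightarrow> 'a tvec set" where
  "sub_tangent_space N S p =
     {v \<in> tangent_space N p. \<exists>k c. p \<in> fst c \<and> slice_chart N S k c \<and> v c \<in> Rn k}"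

definition prestratification :: "'a c1mfd \<Rightarrow> 'a set \<Rightarrow> 'a set set \<Rightarrow> bool" where
  "prestratification N V \<Sigma> \<longleftrightarrow>
     disjoint \<Sigma> \<and> \<Union>\<Sigma> = V \<and>
     (\<forall>S\<in>\<Sigma>. embedded_submanifold N S \<and> connectedin (mtop N) S) \<and>
     (\<forall>p\<in>V. \<exists>U. openin (mtop N) U \<and> p \<in> U \<and> finite {S \<in> \<Sigma>. S \<inter> U \<noteq> {}})"

definition constant_rank_on :: "'a c1mfd \<Rightarrow> 'b c1mfd \<Rightarrow> ('a \<Rightarrow> 'b) \<Rightarrow> 'a set \<Rightarrow> bool" where
  "constant_rank_on N P f S \<longleftrightarrow>
     (\<exists>r. \<forall>x\<in>S. dim (differential N P f x ` sub_tangent_space N S x) = r)"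

definition stratified_map ::
    "'a c1mfd \<Rightarrow> 'b c1mfd \<Rightarrow> 'a set set \<Rightarrow> ('a \<Rightarrow> 'b) \<Rightarrow> bool" where
  "stratified_map N P \<Sigma> f \<longleftrightarrow> f \<in> C1_maps N P \<and> (\<forall>S\<in>\<Sigma>. constant_rank_on N P f S)"

text \<open>
  If \<open>f\<close> has constant rank on \<open>S\<close>, the kernel of the differential of the restriction of \<open>f\<close> to \<open>S\<close> is
  the tangent space at \<open>x\<close> of the leaf through \<open>x\<close>, i.e. of the connected component of the fibre.
\<close>

definition leaf_tangent ::
    "'a c1mfd \<Rightarrow> 'b c1mfd \<Rightarrow> ('a \<Rightarrow> 'b) \<Rightarrow> 'a set \<Rightarrow> 'a \<Rightarrow> 'a tvec set" where
  "leaf_tangent N P f S x = {v \<in> sub_tangent_space N S x. differential N P f x v = 0}"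

text \<open>
  On the linear subspaces of \<open>Rn n\<close> of a fixed dimension, the maximum of \<open>gap A B\<close> and \<open>gap B A\<close>
  induces the topology of the Grassmannian.
\<close>

definition gap :: "rseq set \<Rightarrow> rseq set \<Rightarrow> real" where
  "gap A B = (SUP v\<in>A \<inter> cball 0 1. infdist v B)"

definition grassmann_tendsto :: "(nat \<Rightarrow> rseq set) \<Rightarrow> rseq set \<Rightarrow> bool" where
  "grassmann_tendsto W A \<longleftrightarrow>
     (\<forall>\<^sub>F i in sequentially. dim (W i) = dim A) \<and>
     (\<lambda>i. max (gap (W i) A) (gap A (W i))) \<longlonglongrightarrow> 0"

text \<open>
  For subspaces \<open>T i\<close> of the tangent spaces at \<open>x i\<close>: convergence of the pairs \<open>(x i, T i)\<close> to
  \<open>(y, \<tau>)\<close>, expressed in the local trivialisation given by a chart at \<open>y\<close>.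
\<close>

definition grassmann_bundle_tendsto ::
    "'a c1mfd \<Rightarrow> (nat \<Rightarrow> 'a) \<Rightarrow> (nat \<Rightarrow> 'a tvec set) \<Rightarrow> 'a \<Rightarrow> 'a tvec set \<Rightarrow> bool" where
  "grassmann_bundle_tendsto N x T y \<tau> \<longleftrightarrow>
     limitin (mtop N) x y sequentially \<and> subspace \<tau> \<and> \<tau> \<subseteq> tangent_space N y \<and>
     (\<exists>c\<in>charts_at N y. grassmann_tendsto (\<lambda>i. (\<lambda>v. v c) ` T i) ((\<lambda>v. v c) ` \<tau>))"

definition af_regular_at ::
    "'a c1mfd \<Rightarrow> 'b c1mfd \<Rightarrow> ('a \<Rightarrow> 'b) \<Rightarrow> 'a set \<Rightarrow> 'a set \<Rightarrow> 'a \<Rightarrow> bool" where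
  "af_regular_at N P f X Y y \<longleftrightarrow>
     (\<forall>x \<tau>. (\<forall>i. x i \<in> X) \<and> grassmann_bundle_tendsto N x (\<lambda>i. leaf_tangent N P f X (x i)) y \<tau>
        \<longrightarrow> leaf_tangent N P f Y y \<subseteq> \<tau>)"

definition af_regular_pair ::
    "'a c1mfd \<Rightarrow> 'b c1mfd \<Rightarrow> ('a \<Rightarrow> 'b) \<Rightarrow> 'a set \<Rightarrow> 'a set \<Rightarrow> bool" where
  "af_regular_pair N P f X Y \<longleftrightarrow>
     (\<forall>y \<in> Y \<inter> (mtop N closure_of X). af_regular_at N P f X Y y) \<and>
     (\<forall>x \<in> X \<inter> (mtop N closure_of Y). af_regular_at N P f Y X x)"

definition af_regular :: "'a c1mfd \<Rightarrow> 'b c1mfd \<Rightarrow> ('a \<Rightarrow> 'b) \<Rightarrow> 'a set set \<Rightarrow> bool" where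
  "af_regular N P f \<Sigma> \<longleftrightarrow> (\<forall>X\<in>\<Sigma>. \<forall>Y\<in>\<Sigma>. af_regular_pair N P f X Y)"

text \<open>The sum on the left is the elementwise sum of two sets of tangent vectors.\<close>

definition transverse ::
    "'m c1mfd \<Rightarrow> 'a c1mfd \<Rightarrow> 'b c1mfd \<Rightarrow> ('a \<Rightarrow> 'b) \<Rightarrow> 'a set set \<Rightarrow> ('m \<Rightarrow> 'a) \<Rightarrow> bool" where
  "transverse M N P f \<Sigma> g \<longleftrightarrow>
     (\<forall>w\<in>topspace (mtop M). \<forall>S\<in>\<Sigma>. g w \<in> S \<longrightarrow>
        differential M N g w ` tangent_space M w + leaf_tangent N P f S (g w)
          = tangent_space N (g w))"

text \<open>
  Data \<open>c, K, d, \<epsilon>\<close> for a basic neighbourhood of \<open>g\<close>: charts \<open>c i\<close> of \<open>M\<close> with locally finite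
  domains, compact sets \<open>K i\<close> in them, and charts \<open>d i\<close> of \<open>N\<close> whose domains contain the images
  of the \<open>K i\<close>.  Index sets of natural numbers suffice, since a locally finite family of nonempty
  subsets of a second countable space is countable.
\<close>

definition strong_data ::
    "'m c1mfd \<Rightarrow> 'a c1mfd \<Rightarrow> ('m \<Rightarrow> 'a) \<Rightarrow> nat set \<Rightarrow> (nat \<Rightarrow> 'm chart) \<Rightarrow> (nat \<Rightarrow> 'm set) \<Rightarrow>
     (nat \<Rightarrow> 'a chart) \<Rightarrow> (nat \<Rightarrow> real) \<Rightarrow> bool" where
  "strong_data M N g I c K d \<epsilon> \<longleftrightarrow>
     g \<in> C1_maps M N \<and>
     (\<forall>i\<in>I. c i \<in> charts M \<and> compactin (mtop M) (K i) \<and> K i \<subseteq> fst (c i) \<and>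
            d i \<in> charts N \<and> g ` K i \<subseteq> fst (d i) \<and> 0 < \<epsilon> i) \<and>
     (\<forall>p\<in>topspace (mtop M). \<exists>W. openin (mtop M) W \<and> p \<in> W \<and>
            finite {i\<in>I. fst (c i) \<inter> W \<noteq> {}})"

definition strong_nhd ::
    "'m c1mfd \<Rightarrow> 'a c1mfd \<Rightarrow> ('m \<Rightarrow> 'a) \<Rightarrow> nat set \<Rightarrow> (nat \<Rightarrow> 'm chart) \<Rightarrow> (nat \<Rightarrow> 'm set) \<Rightarrow>
     (nat \<Rightarrow> 'a chart) \<Rightarrow> (nat \<Rightarrow> real) \<Rightarrow> ('m \<Rightarrow> 'a) set" where
  "strong_nhd M N g I c K d \<epsilon> =
     {h \<in> C1_maps M N. \<forall>i\<in>I. h ` K i \<subseteq> fst (d i) \<and>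
        (\<forall>x \<in> snd (c i) ` K i.
           norm (local_rep (c i) (d i) h x - local_rep (c i) (d i) g x) < \<epsilon> i \<and>
           (\<forall>v \<in> Rn (mdim M) \<inter> cball 0 1.
              norm (fderiv (mdim M) (local_rep (c i) (d i) h) x v -
                    fderiv (mdim M) (local_rep (c i) (d i) g) x v) < \<epsilon> i))}"

definition strong_topology :: "'m c1mfd \<Rightarrow> 'a c1mfd \<Rightarrow> ('m \<Rightarrow> 'a) topology" where
  "strong_topology M N =
     topology_generated_by {strong_nhd M N g I c K d \<epsilon> | g I c K d \<epsilon>. strong_data M N g I c K d \<epsilon>}"

text \<open>
  Quantification over all C1 manifolds is quantification over those whose points are taken from a
  fixed type \<open>'m\<close>.  A second countable Hausdorff space has at most continuum many points, so every
  manifold has an isomorphic copy with points in \<open>'m\<close> provided that \<open>'m\<close> is large enough in the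
  following sense.
\<close>

definition contains_continuum :: "'m itself \<Rightarrow> bool" where
  "contains_continuum (_ :: 'm itself) \<longleftrightarrow> (UNIV :: real set) \<lesssim> (UNIV :: 'm set)"

end

theory Submission
  imports Defs
begin

text \<open>
  Regularity implies openness.  If openness fails near a transverse map \<open>g\<close>, then there are maps \<open>h i\<close> that tend to \<open>g\<close>
  in the C1 sense on a compact set, and points \<open>w i \<longlonglongrightarrow> w\<close> in that set where \<open>h i\<close> is not transverse to the leaf of some stratum
  through \<open>h i (w i)\<close>.  The limit \<open>y = g w\<close> of the points \<open>h i (w i)\<close> lies in the closed set \<open>V\<close>, hence in a stratum \<open>Y\<close>, and by
  local finiteness the stratum of \<open>h i (w i)\<close> may be taken to be a fixed \<open>X\<close>.  The leaves of \<open>X\<close> have the same dimension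
  everywhere, and the Grassmannian is compact (\<open>grassmann_compact\<close>); so their tangent spaces at \<open>h i (w i)\<close> may be
  assumed to converge to some \<open>\<tau>\<close>.  By regularity \<open>\<tau>\<close> contains the tangent space of the leaf of \<open>Y\<close> at \<open>y\<close>, so that the
  image of the differential of \<open>g\<close> at \<open>w\<close> together with \<open>\<tau>\<close> spans the tangent space of \<open>N\<close>.  This is an open condition
  (\<open>transversality_stable\<close>), which contradicts the choice of \<open>w i\<close>.  Thus each compact subset of a chart domain has a
  bound for the C1 distance that enforces transversality on it (\<open>transverse_near_compact\<close>), and a locally finite
  family of such sets that covers the source gives a neighbourhood in the strong topology (\<open>af_regular_imp_open\<close>).

  Openness implies regularity.  Let \<open>x i \<longlonglongrightarrow> y\<close> be points of a stratum \<open>X\<close> such that the tangent spaces \<open>T i\<close> of the leaves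
  converge to \<open>\<tau>\<close>, and suppose that some vector \<open>v\<close> tangent at \<open>y\<close> to the leaf of the stratum \<open>Y\<close> of \<open>y\<close> is not in \<open>\<tau>\<close>.  Choose a
  linear functional \<open>lam\<close> that vanishes on \<open>\<tau>\<close> with \<open>lam v = 1\<close>.  In a chart at \<open>y\<close> there is an explicit map \<open>g\<close>, equal to the
  identity off a ball, which is a submersion except at \<open>y\<close>, fixes \<open>y\<close>, and has as derivative at \<open>y\<close> the projection
  to the kernel of \<open>lam\<close> along \<open>v\<close> (locale \<open>pinch_map\<close>).  It is transverse to all leaves: the only direction missing from the
  image of its differential is \<open>v\<close>, which is tangent to the leaf.  Now perturb \<open>g\<close> within the ball to maps
  \<open>g i\<close> that take \<open>y\<close> to \<open>x i\<close> and have at \<open>y\<close> as image of the differential a hyperplane near the kernel of \<open>lam\<close> that contains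
  \<open>T i\<close> (\<open>frame_perturbation\<close>).  These maps are not transverse to the leaf of \<open>X\<close> at \<open>x i\<close>, but they converge to \<open>g\<close> in the
  strong topology because they differ from \<open>g\<close> on a fixed compact set only (\<open>glue_tendsto\<close>).  So the set of transverse
  maps is not a neighbourhood of \<open>g\<close>.

  The second argument uses maps from \<open>N\<close> to itself.  To apply it when the sources have points in the type \<open>'m\<close>, it is
  carried out for maps from a manifold diffeomorphic to \<open>N\<close>, and \<open>N\<close> is shown to have a copy with points in \<open>'m\<close>
  (\<open>manifold_copy\<close>).
\<close>

section \<open>Linear algebra in the coordinate spaces\<close>

definition basis_vec :: "nat \<Rightarrow> rseq" where
  "basis_vec i = Bcontfun (\<lambda>j. if j = i then 1 else 0)"

lemma basis_vec_apply: "apply_bcontfun (basis_vec i) j = (if j = i then 1 else 0)"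
proof -
  have "(\<lambda>j::nat. if j = i then 1 else (0::real)) \<in> bcontfun"
    by (auto simp: bcontfun_def bounded_iff intro!: exI[of _ 1])
  then show ?thesis unfolding basis_vec_def by (simp add: Bcontfun_inverse)
qed

lemma bounded_linear_coord: "bounded_linear (\<lambda>x::rseq. apply_bcontfun x i)"
  using norm_bounded[of "_ :: rseq" i]
  by (intro bounded_linear_intro[where K=1]) (auto simp: plus_bcontfun.rep_eq scaleR_bcontfun.rep_eq)

lemmas coord_sum = linear_sum[OF bounded_linear.linear[OF bounded_linear_coord]]

lemma coord_simps [simp]:
  "apply_bcontfun (x + y) i = apply_bcontfun x i + apply_bcontfun y i"
  "apply_bcontfun (x - y) i = apply_bcontfun x i - apply_bcontfun y i"
  "apply_bcontfun (c *\<^sub>R x) i = c * apply_bcontfun x i"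
  "apply_bcontfun (0::rseq) i = 0"
  for x y :: rseq
  by (auto simp: plus_bcontfun.rep_eq scaleR_bcontfun.rep_eq minus_bcontfun.rep_eq zero_bcontfun.rep_eq)

lemma subspace_Rn: "subspace (Rn n)"
  by (auto simp: subspace_def Rn_def)

lemmas Rn_add = subspace_add[OF subspace_Rn]
lemmas Rn_scale = subspace_scale[OF subspace_Rn]
lemmas Rn_diff = subspace_diff[OF subspace_Rn]
lemmas Rn_0 = subspace_0[OF subspace_Rn]
lemmas Rn_sum = subspace_sum[OF subspace_Rn]
lemmas Rn_rules = Rn_add Rn_scale Rn_diff Rn_0 Rn_sum

lemma Rn_mono: "k \<le> n \<Longrightarrow> Rn k \<subseteq> Rn n"
  by (auto simp: Rn_def)

lemma closed_Rn: "closed (Rn n)"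
proof -
  have "Rn n = (\<Inter>i\<in>{n..}. {x. apply_bcontfun x i = 0})" by (auto simp: Rn_def)
  moreover have "closed {x::rseq. apply_bcontfun x i = 0}" for i
    by (intro closed_Collect_eq continuous_intros linear_continuous_on bounded_linear_coord)
  ultimately show ?thesis by auto
qed

lemma basis_vec_Rn: "i < n \<Longrightarrow> basis_vec i \<in> Rn n"
  by (auto simp: Rn_def basis_vec_apply)

lemma Rn_expand: "x \<in> Rn n \<Longrightarrow> (\<Sum>i<n. apply_bcontfun x i *\<^sub>R basis_vec i) = x"
  by (rule bcontfun_eqI) (auto simp: coord_sum basis_vec_apply Rn_def if_distrib cong: if_cong)

lemma Rn_eq_span: "Rn n = span (basis_vec ` {..<n})"
proof
  show "span (basis_vec ` {..<n}) \<subseteq> Rn n"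
    by (rule span_minimal) (auto simp: subspace_Rn basis_vec_Rn)
  show "Rn n \<subseteq> span (basis_vec ` {..<n})"
  proof
    fix x assume "x \<in> Rn n"
    then have "x = (\<Sum>i<n. apply_bcontfun x i *\<^sub>R basis_vec i)" by (simp add: Rn_expand)
    also have "\<dots> \<in> span (basis_vec ` {..<n})" by (intro span_sum span_scale span_base) auto
    finally show "x \<in> span (basis_vec ` {..<n})" .
  qed
qed

lemma norm_coord: "\<bar>apply_bcontfun x i\<bar> \<le> norm x" for x :: rseq
  using norm_bounded[of x i] by simp

lemma norm_basis_vec: "norm (basis_vec i) \<le> 1"
  by (rule norm_bound) (auto simp: basis_vec_apply)

definition proj :: "nat \<Rightarrow> rseq \<Rightarrow> rseq" where
  "proj n x = (\<Sum>i<n. apply_bcontfun x i *\<^sub>R basis_vec i)"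

lemma proj_id: "x \<in> Rn n \<Longrightarrow> proj n x = x"
  by (simp add: proj_def Rn_expand)

text \<open>Finite-dimensionality of the coordinate spaces, in the form in which it is used: a linear map is
  bounded once it is precomposed with the projection to \<open>Rn n\<close>.\<close>

lemma bounded_linear_proj_comp:
  fixes f :: "rseq \<Rightarrow> 'b::real_normed_vector"
  assumes "linear f"
  shows "bounded_linear (\<lambda>x. f (proj n x))"
proof -
  have "f (proj n x) = (\<Sum>i<n. apply_bcontfun x i *\<^sub>R f (basis_vec i))" for x
    by (simp add: proj_def linear_sum[OF assms] linear_cmul[OF assms])
  then show ?thesis
    by (simp add: bounded_linear_sum bounded_linear_scaleR_const bounded_linear_coord)
qed

lemma continuous_on_Rn_linear:
  fixes f :: "rseq \<Rightarrow> 'b::real_normed_vector"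
  assumes "linear f"
  shows "continuous_on (Rn n) f"
proof -
  have "continuous_on (Rn n) (\<lambda>x. f (proj n x))"
    by (intro linear_continuous_on bounded_linear_proj_comp assms)
  then show ?thesis by (rule continuous_on_cong[THEN iffD1, rotated 2]) (auto simp: proj_id)
qed

lemma compact_Rn_cball: "compact (Rn n \<inter> cball a r)"
proof -
  have *: "compact (Rn n \<inter> cball 0 s)" for s
  proof (induction n)
    case 0
    have "Rn 0 = {0}" by (auto simp: Rn_def intro!: bcontfun_eqI)
    then show ?case by (cases "s \<ge> 0") auto
  next
    case (Suc n)
    let ?f = "\<lambda>(x, t). x + t *\<^sub>R basis_vec n"
    let ?K = "(Rn n \<inter> cball 0 (2 * s)) \<times> {-s..s}"
    have "compact (Rn n \<inter> cball 0 (2 * s))"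
    proof -
      have "compact ((\<lambda>x. 2 *\<^sub>R x) ` (Rn n \<inter> cball 0 s))" by (rule compact_scaling[OF Suc])
      moreover have "(\<lambda>x. 2 *\<^sub>R x) ` (Rn n \<inter> cball 0 s) = Rn n \<inter> cball 0 (2 * s)" (is "?l = ?r")
      proof
        show "?r \<subseteq> ?l"
        proof
          fix x assume "x \<in> ?r"
          then have "x = 2 *\<^sub>R ((1/2) *\<^sub>R x)" "(1/2) *\<^sub>R x \<in> Rn n \<inter> cball 0 s"
            by (auto intro: Rn_rules)
          then show "x \<in> ?l" by blast
        qed
      qed (auto intro: Rn_rules)
      ultimately show ?thesis by simp
    qed
    then have "compact ?K" by (intro compact_Times) auto
    moreover have "continuous_on ?K ?f"
      by (auto simp: case_prod_unfold intro!: continuous_intros)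
    ultimately have "compact (?f ` ?K)" by (rule compact_continuous_image[rotated])
    moreover have "Rn (Suc n) \<inter> cball 0 s \<subseteq> ?f ` ?K"
    proof
      fix x assume x: "x \<in> Rn (Suc n) \<inter> cball 0 s"
      let ?t = "apply_bcontfun x n"
      have t: "\<bar>?t\<bar> \<le> s" using x norm_coord[of x n] by auto
      have "norm (x - ?t *\<^sub>R basis_vec n) \<le> norm x + norm (?t *\<^sub>R basis_vec n)" by (rule norm_triangle_ineq4)
      also have "norm (?t *\<^sub>R basis_vec n) \<le> \<bar>?t\<bar> * 1" unfolding norm_scaleR
        by (intro mult_left_mono norm_basis_vec) auto
      finally have "norm (x - ?t *\<^sub>R basis_vec n) \<le> 2 * s" using x t by auto
      moreover have "x - ?t *\<^sub>R basis_vec n \<in> Rn n"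
        using x by (auto simp: Rn_def basis_vec_apply)
      ultimately have "(x - ?t *\<^sub>R basis_vec n, ?t) \<in> ?K" using t by auto
      moreover have "x = ?f (x - ?t *\<^sub>R basis_vec n, ?t)" by simp
      ultimately show "x \<in> ?f ` ?K" by blast
    qed
    moreover have "closed (Rn (Suc n) \<inter> cball 0 s)" by (intro closed_Int closed_Rn closed_cball)
    ultimately show ?case using compact_Int_closed[of "?f ` ?K" "Rn (Suc n) \<inter> cball 0 s"]
      by (simp add: inf.absorb2)
  qed
  have "Rn n \<inter> cball a r \<subseteq> Rn n \<inter> cball 0 (norm a + r)"
    by (auto simp: dist_norm) (metis add.commute add_le_cancel_left diff_add_cancel dist_norm dist_triangle_le norm_conv_dist norm_minus_commute norm_triangle_sub order_trans)
  moreover have "closed (Rn n \<inter> cball a r)" by (intro closed_Int closed_Rn closed_cball)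
  ultimately show ?thesis
    using compact_Int_closed[OF *[of "norm a + r"], of "Rn n \<inter> cball a r"] by (simp add: inf.absorb2)
qed

text \<open>The contraction principle, in a ball that contains all iterates, solves \<open>x + L x = y\<close>.\<close>

lemma near_identity_onto:
  assumes L: "linear L" "\<And>x. x \<in> Rn n \<Longrightarrow> L x \<in> Rn n" "\<And>x. x \<in> Rn n \<Longrightarrow> norm (L x) \<le> norm x / 2"
    and y: "y \<in> Rn n"
  shows "\<exists>x\<in>Rn n. x + L x = y"
proof -
  let ?K = "Rn n \<inter> cball 0 (2 * norm y)"
  have "\<exists>!x\<in>?K. y - L x = x"
  proof (rule Banach_fix[OF compact_imp_complete[OF compact_Rn_cball], where c="1/2"])
    show "?K \<noteq> {}" using Rn_0[of n] norm_ge_zero[of y] by (auto intro!: exI[of _ 0])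
    show "(\<lambda>x. y - L x) ` ?K \<subseteq> ?K"
    proof (rule image_subsetI)
      fix x assume x: "x \<in> ?K"
      then have "norm (y - L x) \<le> norm y + norm x / 2"
        using L(3)[of x] norm_triangle_ineq4[of y "L x"] by auto
      then show "y - L x \<in> ?K" using x L y by (auto intro: Rn_rules)
    qed
    show "dist (y - L x) (y - L z) \<le> 1 / 2 * dist x z" if "x \<in> ?K" "z \<in> ?K" for x z
      using L(3)[of "x - z"] that
      by (simp add: dist_norm linear_diff[OF L(1)] Rn_diff norm_minus_commute)
  qed auto
  then obtain x where "x \<in> Rn n" "y - L x = x" by blast
  then show ?thesis by (metis diff_add_cancel)
qed

lemma subspace_basis:
  assumes "subspace T" "T \<subseteq> Rn n"
  obtains B where "finite B" "independent B" "B \<subseteq> T" "span B = T" "card B = dim T"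
proof -
  obtain B where B: "B \<subseteq> T" "independent B" "T \<subseteq> span B" "card B = dim T"
    by (rule real_vector.basis_exists)
  have "finite B"
    using independent_span_bound[of "basis_vec ` {..<n}" B] B assms Rn_eq_span by auto
  then show ?thesis using that B span_minimal[OF B(1) assms(1)] by auto
qed

lemma span_full_card:
  assumes T: "subspace T" "T \<subseteq> Rn n" and B: "B \<subseteq> T" "independent B" "card B = dim T"
  shows "span B = T"
proof -
  obtain C where C: "finite C" "independent C" "C \<subseteq> T" "span C = T" "card C = dim T"
    using subspace_basis[OF T] .
  have "finite B" using independent_span_bound[OF C(1) B(2)] C B by auto
  have "T \<subseteq> span B"
  proof
    fix x assume x: "x \<in> T"
    show "x \<in> span B"
    proof (rule ccontr)
      assume n: "x \<notin> span B"
      then have "independent (insert x B)" "x \<notin> B"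
        using B(2) independent_insertI span_base by blast+
      then have "card (insert x B) \<le> card C"
        using independent_span_bound[OF C(1), of "insert x B"] C x B by auto
      then show False using \<open>x \<notin> B\<close> \<open>finite B\<close> B C by simp
    qed
  qed
  then show ?thesis using span_minimal[OF B(1) T(1)] by auto
qed

text \<open>A subspace is the fixed point set of a linear retraction onto it, which is continuous on \<open>Rn n\<close>.\<close>

lemma closed_subspace_Rn:
  assumes "subspace T" "T \<subseteq> Rn n"
  shows "closed T"
proof -
  obtain g where g: "range g \<subseteq> T" "linear g" "\<And>v. v \<in> T \<Longrightarrow> g v = v"
    using linear_exists_left_inverse_on[OF linear_id assms(1)] by auto
  have "T = {x\<in>Rn n. g x - x = 0}" using g assms by auto (metis rangeI subsetD)
  moreover have "closed {x\<in>Rn n. g x - x = 0}"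
    by (intro continuous_closed_preimage_constant continuous_intros continuous_on_Rn_linear g closed_Rn)
  ultimately show ?thesis by simp
qed

text \<open>Rank and nullity.  The map is linear on \<open>T\<close> alone, because the differential of a map at a point is
  linear on the tangent space only.\<close>

lemma dim_image_kernel:
  fixes f :: "'v::real_vector \<Rightarrow> 'w::real_vector"
  assumes T: "subspace T" and fin: "finite C" "T \<subseteq> span C"
    and lf: "\<And>x y. x \<in> T \<Longrightarrow> y \<in> T \<Longrightarrow> f (x + y) = f x + f y" "\<And>c x. x \<in> T \<Longrightarrow> f (c *\<^sub>R x) = c *\<^sub>R f x"
  shows "dim T = dim (f ` T) + dim {x\<in>T. f x = 0}"
proof -
  let ?K = "{x\<in>T. f x = 0}"
  have f0: "f 0 = 0" using lf(2)[of 0 0] subspace_0[OF T] by simp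
  have K: "subspace ?K" using T lf f0 by (auto simp: subspace_def)
  obtain B where B: "B \<subseteq> ?K" "independent B" "?K \<subseteq> span B" "card B = dim ?K"
    by (rule real_vector.basis_exists)
  obtain B' where B': "B \<subseteq> B'" "B' \<subseteq> T" "independent B'" "T \<subseteq> span B'"
    using real_vector.maximal_independent_subset_extend[of B T] B by auto
  have finB': "finite B'" using independent_span_bound[OF fin(1) B'(3)] B' fin by auto
  have spB': "span B' = T" using B'(4) span_minimal[OF B'(2) T] by auto
  have cB': "card B' = dim T" using dim_eq_card[of B' T] B' spB' span_span by metis
  \<comment> \<open>\<open>g\<close> is linear on the whole space, so that the facts on independent sets apply to it\<close>
  obtain g where g: "linear g" "\<And>x. x \<in> B' \<Longrightarrow> g x = f x"
    using linear_independent_extend[OF B'(3), of f] by auto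
  have gf: "g x = f x" if "x \<in> T" for x
  proof -
    have "x \<in> span B'" using that spB' by simp
    moreover have "span B' \<subseteq> {x\<in>T. g x = f x}"
    proof (rule span_minimal)
      show "subspace {x\<in>T. g x = f x}"
        using T lf f0 by (auto simp: subspace_def linear_0[OF g(1)] linear_add[OF g(1)] linear_cmul[OF g(1)])
    qed (use B' g in auto)
    ultimately show ?thesis by auto
  qed
  let ?D = "B' - B"
  have inj: "inj_on g (span ?D)"
  proof (subst linear_injective_on_subspace_0[OF g(1) subspace_span], intro ballI impI)
    fix x assume x: "x \<in> span ?D" "g x = 0"
    have "x \<in> T" using x spB' span_mono[of ?D B'] by auto
    then have "x \<in> ?K" using gf x by auto
    then have "x \<in> span B" using B by auto
    obtain h :: "'v \<Rightarrow> 'v" where h: "linear h" "\<And>b. b \<in> B' \<Longrightarrow> h b = (if b \<in> B then b else 0)"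
      using linear_independent_extend[OF B'(3), of "\<lambda>b. if b \<in> B then b else 0"] by auto
    have "h x = id x"
      by (rule linear_eq_on[OF h(1) linear_id \<open>x \<in> span B\<close>]) (use h(2) B'(1) in auto)
    moreover have "h x = 0" using linear_eq_on[OF h(1) module_hom_zero x(1)] h(2) by auto
    ultimately show "x = 0" by simp
  qed
  have "independent (g ` ?D)"
    by (rule linear_independent_injective_image[OF g(1) _ inj])
       (use B' independent_mono in blast)
  moreover have "span (g ` ?D) = span (f ` T)"
  proof
    show "span (g ` ?D) \<subseteq> span (f ` T)" using B' gf by (intro span_mono) auto
    show "span (f ` T) \<subseteq> span (g ` ?D)"
    proof (rule span_minimal[OF _ subspace_span], rule image_subsetI)
      fix x assume "x \<in> T"
      then have "x \<in> span B'" using spB' by simp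
      then have "g x \<in> span (g ` B')" using linear_span_image[OF g(1)] by blast
      also have "\<dots> \<subseteq> span (g ` ?D)"
      proof (rule span_minimal[OF _ subspace_span], rule image_subsetI)
        fix b assume "b \<in> B'"
        then show "g b \<in> span (g ` ?D)"
          using B(1) B'(2) gf[of b] span_0[of "g ` ?D"] span_base[of "g b" "g ` ?D"] by (cases "b \<in> B") auto
      qed
      finally show "f x \<in> span (g ` ?D)" using gf \<open>x \<in> T\<close> by simp
    qed
  qed
  ultimately have "dim (f ` T) = card (g ` ?D)" by (intro dim_eq_card) auto
  also have "\<dots> = card ?D" by (rule card_image) (use inj inj_on_subset span_superset in blast)
  finally show ?thesis
    using cB' B(4) card_Diff_subset[of B B'] B'(1) finB' finite_subset[OF B'(1) finB'] card_mono[OF finB' B'(1)] by simp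
qed

section \<open>The Grassmannian\<close>

text \<open>By Riesz's lemma each further basis vector can be taken at distance at least \<open>1/2\<close> from the span of
  the preceding ones.  The coefficients of a vector are then bounded by its norm, with a constant that
  depends on the dimension alone.  The bound passes to limits of bases; it does here what
  orthonormality does in a Euclidean space.\<close>

lemma uniform_basis_exists:
  assumes "subspace T" "T \<subseteq> Rn n" "dim T = k"
  shows "\<exists>b. (\<forall>j<k. b j \<in> T \<and> norm (b j) = 1) \<and>
    (\<forall>x\<in>T. \<exists>a. x = (\<Sum>j<k. a j *\<^sub>R b j)) \<and>
    (\<forall>a. \<forall>j<k. \<bar>a j\<bar> \<le> 3 ^ k * norm (\<Sum>j<k. a j *\<^sub>R b j))"
  using assms
proof (induction k arbitrary: T)
  case 0
  obtain B where B: "finite B" "span B = T" "card B = dim T"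
    using subspace_basis[OF 0(1,2)] .
  then have "T = {0}" using 0 by auto
  then show ?case by auto
next
  case (Suc k)
  obtain B where B: "finite B" "independent B" "B \<subseteq> T" "span B = T" "card B = dim T"
    using subspace_basis[OF Suc.prems(1,2)] .
  then obtain u where u: "u \<in> B" using Suc.prems by force
  define T' where "T' = span (B - {u})"
  have T': "subspace T'" "T' \<subseteq> Rn n" "T' \<subseteq> T"
    using B span_mono[of "B - {u}" B] Suc.prems by (auto simp: T'_def)
  have "dim T' = card (B - {u})" unfolding T'_def
    by (intro dim_span_eq_card_independent independent_mono[OF B(2)]) auto
  then have "dim T' = k" using B u Suc.prems by simp
  then obtain b where b: "\<And>j. j < k \<Longrightarrow> b j \<in> T' \<and> norm (b j) = 1"
    "\<And>x. x \<in> T' \<Longrightarrow> \<exists>a. x = (\<Sum>j<k. a j *\<^sub>R b j)"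
    "\<And>a j. j < k \<Longrightarrow> \<bar>a j\<bar> \<le> 3 ^ k * norm (\<Sum>j<k. a j *\<^sub>R b j)"
    using Suc.IH[OF T'(1,2)] by blast
  have "u \<notin> T'" using B(2) u unfolding T'_def dependent_def by auto
  moreover have "T' \<noteq> {}" using subspace_0[OF T'(1)] by auto
  ultimately have pos: "0 < infdist u T'"
    using closed_subspace_Rn[OF T'(1,2)] in_closed_iff_infdist_zero[of T' u] infdist_nonneg[of u T']
    by (metis less_eq_real_def)
  have "(INF t\<in>T'. dist u t) < 2 * infdist u T'"
    using pos \<open>T' \<noteq> {}\<close> by (simp add: infdist_def)
  then obtain t where t: "t \<in> T'" "dist u t < 2 * infdist u T'"
    using \<open>T' \<noteq> {}\<close> by (auto simp: cInf_less_iff)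
  define r where "r = norm (u - t)"
  have r: "r > 0" using \<open>u \<notin> T'\<close> t by (auto simp: r_def)
  define w where "w = (1/r) *\<^sub>R (u - t)"
  have w: "norm w = 1" "w \<in> T" "u = t + r *\<^sub>R w"
    using r t T' u B Suc.prems(1) span_base[of u B]
    by (auto simp: w_def r_def intro!: subspace_scale subspace_diff)
  \<comment> \<open>Riesz: \<open>t\<close> is almost a nearest point to \<open>u\<close>, up to a factor 2.\<close>
  have far: "norm (w - x) \<ge> 1/2" if x: "x \<in> T'" for x
  proof -
    have "infdist u T' \<le> dist u (t + r *\<^sub>R x)"
      by (intro infdist_le subspace_add subspace_scale T' t x)
    also have "\<dots> = norm (r *\<^sub>R (w - x))"
      using w by (simp add: dist_norm algebra_simps)
    also have "\<dots> = r * norm (w - x)" using r by simp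
    finally have "r * (1/2) \<le> r * norm (w - x)" using t by (simp add: dist_norm r_def)
    then show ?thesis using r by (rule mult_left_le_imp_le)
  qed
  let ?b = "b(k := w)"
  have eq: "(\<Sum>j<Suc k. a j *\<^sub>R ?b j) = (\<Sum>j<k. a j *\<^sub>R b j) + a k *\<^sub>R w" for a
    by simp
  show ?case
  proof (intro exI[of _ ?b] conjI allI impI ballI)
    show "?b j \<in> T" "norm (?b j) = 1" if "j < Suc k" for j
      using that b(1)[of j] w T' by (auto simp: less_Suc_eq)
  next
    fix x assume "x \<in> T"
    then have "x \<in> span (insert u (B - {u}))" using B u by (simp add: insert_absorb)
    then obtain c where "x - c *\<^sub>R u \<in> T'" unfolding T'_def by (metis span_breakdown_eq)
    then have "x - c *\<^sub>R u + c *\<^sub>R t \<in> T'" using t T' by (auto intro: subspace_add subspace_scale)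
    then obtain a where a: "x - c *\<^sub>R u + c *\<^sub>R t = (\<Sum>j<k. a j *\<^sub>R b j)" using b(2) by blast
    have "x = (x - c *\<^sub>R u + c *\<^sub>R t) + (c * r) *\<^sub>R w" unfolding w(3) by (simp add: algebra_simps)
    then have "x = (\<Sum>j<Suc k. (a(k := c * r)) j *\<^sub>R ?b j)"
      unfolding eq a by simp
    then show "\<exists>a. x = (\<Sum>j<Suc k. a j *\<^sub>R ?b j)" by blast
  next
    fix a j assume j: "j < Suc k"
    let ?S = "\<Sum>j<k. a j *\<^sub>R b j" and ?N = "norm (\<Sum>j<Suc k. a j *\<^sub>R ?b j)"
    have S: "?S \<in> T'" using b(1) T' by (auto intro!: subspace_sum subspace_scale)
    have ak: "\<bar>a k\<bar> \<le> 2 * ?N"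
    proof (cases "a k = 0")
      case False
      have "1/2 \<le> norm (w - (- 1 / a k) *\<^sub>R ?S)" by (rule far) (intro subspace_scale T' S)
      then have "\<bar>a k\<bar> * (1/2) \<le> \<bar>a k\<bar> * norm (w - (- 1 / a k) *\<^sub>R ?S)" by (rule mult_left_mono) simp
      also have "\<dots> = norm (a k *\<^sub>R (w - (- 1 / a k) *\<^sub>R ?S))" by simp
      also have "\<dots> = ?N" unfolding eq using False by (simp add: algebra_simps)
      finally show ?thesis by simp
    qed auto
    have "norm ?S \<le> ?N + \<bar>a k\<bar>"
      using norm_triangle_ineq4[of "?S + a k *\<^sub>R w" "a k *\<^sub>R w"] w(1) unfolding eq by simp
    then have S3: "norm ?S \<le> 3 * ?N" using ak by simp
    show "\<bar>a j\<bar> \<le> 3 ^ Suc k * ?N"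
    proof (cases "j = k")
      case True
      have "(1::real) \<le> 3 ^ k" by simp
      then have "(2::real) \<le> 3 ^ Suc k" unfolding power_Suc by linarith
      then have "2 * ?N \<le> 3 ^ Suc k * ?N" by (rule mult_right_mono) simp
      then show ?thesis using ak True by simp
    next
      case False
      then have "\<bar>a j\<bar> \<le> 3 ^ k * norm ?S" using b(3) j by simp
      also have "\<dots> \<le> 3 ^ k * (3 * ?N)" by (intro mult_left_mono S3) simp
      finally show ?thesis by (simp only: power_Suc mult.assoc mult.left_commute)
    qed
  qed
qed

definition combinations :: "nat \<Rightarrow> (nat \<Rightarrow> 'v) \<Rightarrow> 'v::real_vector set" where
  "combinations k l = range (\<lambda>a. \<Sum>j<k. a j *\<^sub>R l j)"

lemma combinationsI: "(\<Sum>j<k. a j *\<^sub>R l j) \<in> combinations k l"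
  by (auto simp: combinations_def)

lemma combinationsE:
  assumes "x \<in> combinations k l" obtains a where "x = (\<Sum>j<k. a j *\<^sub>R l j)"
  using assms by (auto simp: combinations_def)

lemma combinations_eq_span: "combinations k l = span (l ` {..<k})"
proof
  show "combinations k l \<subseteq> span (l ` {..<k})"
    unfolding combinations_def by (rule image_subsetI) (intro span_sum span_scale span_base imageI)
  show "span (l ` {..<k}) \<subseteq> combinations k l"
  proof (rule span_minimal)
    show "l ` {..<k} \<subseteq> combinations k l"
    proof (rule image_subsetI)
      fix j assume "j \<in> {..<k}"
      then have "(\<Sum>m<k. (if m = j then 1::real else 0) *\<^sub>R l m) = l j"
        by (simp add: if_distrib[of "\<lambda>c. c *\<^sub>R _"] cong: if_cong)
      then show "l j \<in> combinations k l" using combinationsI[of "\<lambda>m. if m = j then 1 else 0" l k] by simp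
    qed
    have "(\<Sum>j<k. a j *\<^sub>R l j) + (\<Sum>j<k. b j *\<^sub>R l j) \<in> combinations k l" for a b
      using combinationsI[of "\<lambda>j. a j + b j" l k] by (simp add: sum.distrib scaleR_add_left)
    moreover have "c *\<^sub>R (\<Sum>j<k. a j *\<^sub>R l j) \<in> combinations k l" for c a
      using combinationsI[of "\<lambda>j. c * a j" l k] by (simp add: scaleR_sum_right)
    moreover have "0 \<in> combinations k l" using combinationsI[of "\<lambda>j. 0" l k] by simp
    ultimately show "subspace (combinations k l)"
      unfolding subspace_def by (auto elim!: combinationsE)
  qed
qed

lemma subspace_combinations: "subspace (combinations k l)"
  by (simp add: combinations_eq_span)

text \<open>A linear relation is a combination of norm 0, so that the bound makes all its coefficients vanish.\<close>

lemma dim_combinations: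
  fixes l :: "nat \<Rightarrow> 'v::real_normed_vector"
  assumes l: "\<And>a j. j < k \<Longrightarrow> \<bar>a j\<bar> \<le> C * norm (\<Sum>j<k. a j *\<^sub>R l j)"
  shows "dim (combinations k l) = k"
proof -
  let ?B = "l ` {..<k}"
  have inj: "inj_on l {..<k}"
  proof (rule inj_onI, rule ccontr)
    fix i j assume ij: "i \<in> {..<k}" "j \<in> {..<k}" "l i = l j" "i \<noteq> j"
    let ?a = "(\<lambda>_. 0)(i := 1, j := - 1)"
    have "(\<Sum>m<k. ?a m *\<^sub>R l m) = (\<Sum>m\<in>{i,j}. ?a m *\<^sub>R l m)"
      using ij by (intro sum.mono_neutral_right) auto
    also have "\<dots> = 0" using ij by simp
    finally show False using l[of i ?a] ij by simp
  qed
  have "independent ?B"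
  proof (rule independent_if_scalars_zero)
    fix f x assume s: "(\<Sum>x\<in>?B. f x *\<^sub>R x) = 0" and "x \<in> ?B"
    then obtain j where "j < k" "x = l j" by auto
    then show "f x = 0" using l[of j "\<lambda>j. f (l j)"] s by (simp add: sum.reindex[OF inj])
  qed auto
  then have "dim (combinations k l) = card ?B"
    unfolding combinations_eq_span by (rule dim_span_eq_card_independent)
  then show ?thesis by (simp add: card_image[OF inj])
qed

lemma convergent_subsequences:
  fixes b :: "nat \<Rightarrow> nat \<Rightarrow> 'v::metric_space"
  assumes K: "compact K" "\<And>i j. j < k \<Longrightarrow> b i j \<in> K"
  shows "\<exists>r l. strict_mono r \<and> (\<forall>j<k. l j \<in> K \<and> (\<lambda>i. b (r i) j) \<longlonglongrightarrow> l j)"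
  using K(2)
proof (induction k)
  case 0 then show ?case by (auto intro!: exI[of _ id] simp: strict_mono_id)
next
  case (Suc k)
  then obtain r l where r: "strict_mono r" "\<And>j. j < k \<Longrightarrow> l j \<in> K \<and> (\<lambda>i. b (r i) j) \<longlonglongrightarrow> l j"
    by fastforce
  have "seq_compact K" using K(1) by (simp add: compact_eq_seq_compact_metric)
  then obtain x s where s: "x \<in> K" "strict_mono s" "((\<lambda>i. b (r i) k) \<circ> s) \<longlonglongrightarrow> x"
    by (rule seq_compactE[where f="\<lambda>i. b (r i) k"]) (use Suc.prems in auto)
  have "(\<lambda>i. b ((r \<circ> s) i) j) \<longlonglongrightarrow> (l(k := x)) j \<and> (l(k := x)) j \<in> K" if "j < Suc k" for j
  proof (cases "j = k")
    case True then show ?thesis using s by (simp add: o_def)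
  next
    case False
    then show ?thesis using r(2)[of j] that LIMSEQ_subseq_LIMSEQ[OF _ s(2), of "\<lambda>i. b (r i) j"]
      by (simp add: o_def)
  qed
  then show ?case using strict_mono_o[OF r(1) s(2)] by blast
qed

lemma bdd_above_infdist:
  assumes "subspace B"
  shows "bdd_above ((\<lambda>v. infdist v B) ` (A \<inter> cball 0 1))"
proof (rule bdd_aboveI2[where M=1])
  fix v assume "v \<in> A \<inter> cball 0 1"
  then show "infdist v B \<le> 1" using infdist_le[OF subspace_0[OF assms], of v] by (simp add: dist_commute)
qed

lemma gap_nonneg: "subspace A \<Longrightarrow> subspace B \<Longrightarrow> 0 \<le> gap A B"
  unfolding gap_def
  by (rule cSUP_upper2[OF bdd_above_infdist, of _ 0]) (auto simp: subspace_0 infdist_nonneg)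

lemma infdist_le_gap:
  assumes A: "subspace A" "v \<in> A" and B: "subspace B"
  shows "infdist v B \<le> norm v * gap A B"
proof (cases "v = 0")
  case True then show ?thesis using infdist_le[OF subspace_0[OF B], of v] by simp
next
  case False
  let ?u = "(1 / norm v) *\<^sub>R v"
  have "?u \<in> A \<inter> cball 0 1" using A False by (auto intro: subspace_scale)
  then have "infdist ?u B \<le> gap A B" unfolding gap_def by (rule cSUP_upper[OF _ bdd_above_infdist[OF B]])
  moreover have "infdist v B / norm v \<le> infdist ?u B"
  proof -
    have "B \<noteq> {}" using subspace_0[OF B] by auto
    moreover have "infdist v B / norm v \<le> dist ?u b" if "b \<in> B" for b
    proof -
      have "infdist v B \<le> dist v (norm v *\<^sub>R b)" by (intro infdist_le subspace_scale B that)
      also have "\<dots> = norm (norm v *\<^sub>R (?u - b))" using False by (simp add: dist_norm algebra_simps)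
      also have "\<dots> = dist ?u b * norm v" by (simp add: dist_norm)
      finally show ?thesis using False by (simp add: field_simps)
    qed
    ultimately show ?thesis by (simp add: infdist_def[of ?u] cINF_greatest)
  qed
  ultimately have "infdist v B / norm v \<le> gap A B" by simp
  then show ?thesis using False by (simp add: field_simps)
qed

text \<open>Points of \<open>W i\<close> that are nearly closest to \<open>v\<close> converge to \<open>v\<close>, by the bound of the distance in terms of the gap.\<close>

lemma grassmann_tendsto_approx:
  assumes W: "grassmann_tendsto W A" "\<And>i. subspace (W i)" and A: "subspace A" "v \<in> A"
  shows "\<exists>w. (\<forall>i. w i \<in> W i) \<and> w \<longlonglongrightarrow> v"
proof -
  have "\<exists>w\<in>W i. dist v w < infdist v (W i) + 1 / Suc i" for i
  proof -
    have "W i \<noteq> {}" using subspace_0[OF W(2)[of i]] by auto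
    moreover from this have "(INF w\<in>W i. dist v w) < infdist v (W i) + 1 / Suc i"
      by (simp add: infdist_def)
    ultimately show ?thesis by (auto simp: cInf_less_iff)
  qed
  then obtain w where w: "\<And>i. w i \<in> W i" "\<And>i. dist v (w i) < infdist v (W i) + 1 / Suc i"
    by metis
  define e where "e i = norm v * max (gap (W i) A) (gap A (W i)) + 1 / Suc i" for i
  have "norm (w i - v) \<le> e i" for i
  proof -
    have "infdist v (W i) \<le> norm v * gap A (W i)" by (rule infdist_le_gap[OF A W(2)])
    also have "\<dots> \<le> norm v * max (gap (W i) A) (gap A (W i))" by (intro mult_left_mono) auto
    finally show ?thesis using w(2)[of i] by (simp add: dist_norm norm_minus_commute e_def)
  qed
  moreover have "e \<longlonglongrightarrow> norm v * 0 + 0"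
    using W(1) unfolding grassmann_tendsto_def e_def
    by (intro tendsto_intros LIMSEQ_inverse_real_of_nat[unfolded inverse_eq_divide]) auto
  ultimately have "(\<lambda>i. w i - v) \<longlonglongrightarrow> 0"
    by (intro Lim_null_comparison[of "\<lambda>i. w i - v" e]) (simp_all add: always_eventually)
  then have "w \<longlonglongrightarrow> v" by (rule LIM_zero_cancel)
  then show ?thesis using w by blast
qed

lemma gap_combinations_le:
  fixes l m :: "nat \<Rightarrow> rseq"
  assumes "\<And>a j. j < k \<Longrightarrow> \<bar>a j\<bar> \<le> C * norm (\<Sum>j<k. a j *\<^sub>R l j)" and "C \<ge> 0"
  shows "gap (combinations k l) (combinations k m) \<le> C * (\<Sum>j<k. norm (l j - m j))"
  unfolding gap_def
proof (rule cSUP_least)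
  show "combinations k l \<inter> cball 0 1 \<noteq> {}"
    using subspace_0[OF subspace_combinations, of k l] by (auto intro!: exI[of _ 0])
next
  fix v assume "v \<in> combinations k l \<inter> cball 0 1"
  then obtain a where a: "v = (\<Sum>j<k. a j *\<^sub>R l j)" "norm v \<le> 1"
    by (auto elim: combinationsE)
  have "infdist v (combinations k m) \<le> dist v (\<Sum>j<k. a j *\<^sub>R m j)"
    by (rule infdist_le[OF combinationsI])
  also have "\<dots> = norm (\<Sum>j<k. a j *\<^sub>R (l j - m j))"
    by (simp add: dist_norm a sum_subtractf scaleR_diff_right)
  also have "\<dots> \<le> (\<Sum>j<k. \<bar>a j\<bar> * norm (l j - m j))"
    by (rule norm_sum[THEN order_trans]) simp
  also have "\<dots> \<le> (\<Sum>j<k. C * norm (l j - m j))"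
  proof (intro sum_mono mult_right_mono)
    fix j assume "j \<in> {..<k}"
    then have "\<bar>a j\<bar> \<le> C * norm v" using assms(1) a by auto
    also have "\<dots> \<le> C * 1" using a assms(2) by (intro mult_left_mono) auto
    finally show "\<bar>a j\<bar> \<le> C" by simp
  qed auto
  also have "\<dots> = C * (\<Sum>j<k. norm (l j - m j))" by (simp add: sum_distrib_left)
  finally show "infdist v (combinations k m) \<le> C * (\<Sum>j<k. norm (l j - m j))" .
qed

text \<open>A subsequence of uniform bases converges.  The bound for the coefficients persists in the limit, so the
  limit vectors are independent, and both gaps are at most a constant times the sum of the distances
  between corresponding basis vectors.\<close>

lemma grassmann_compact:
  assumes T: "\<And>i. subspace (T i)" "\<And>i. T i \<subseteq> Rn n" "\<And>i. dim (T i) = k"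
  shows "\<exists>r A. strict_mono (r :: nat \<Rightarrow> nat) \<and> subspace A \<and> A \<subseteq> Rn n \<and> grassmann_tendsto (\<lambda>i. T (r i)) A"
proof -
  have "\<forall>i. \<exists>b. (\<forall>j<k. b j \<in> T i \<and> norm (b j) = 1) \<and>
    (\<forall>x\<in>T i. \<exists>a. x = (\<Sum>j<k. a j *\<^sub>R b j)) \<and>
    (\<forall>a. \<forall>j<k. \<bar>a j\<bar> \<le> 3 ^ k * norm (\<Sum>j<k. a j *\<^sub>R b j))"
    using uniform_basis_exists[OF T] by blast
  then obtain b where "\<forall>i. (\<forall>j<k. b i j \<in> T i \<and> norm (b i j) = 1) \<and>
    (\<forall>x\<in>T i. \<exists>a. x = (\<Sum>j<k. a j *\<^sub>R b i j)) \<and>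
    (\<forall>a. \<forall>j<k. \<bar>a j\<bar> \<le> 3 ^ k * norm (\<Sum>j<k. a j *\<^sub>R b i j))"
    by (rule choice[THEN exE])
  then have b: "\<And>i j. j < k \<Longrightarrow> b i j \<in> T i \<and> norm (b i j) = 1"
    "\<And>i x. x \<in> T i \<Longrightarrow> \<exists>a. x = (\<Sum>j<k. a j *\<^sub>R b i j)"
    "\<And>i a j. j < k \<Longrightarrow> \<bar>a j\<bar> \<le> 3 ^ k * norm (\<Sum>j<k. a j *\<^sub>R b i j)"
    by blast+
  have Teq: "T i = combinations k (b i)" for i
  proof
    show "T i \<subseteq> combinations k (b i)" using b(2) combinationsI by fastforce
    show "combinations k (b i) \<subseteq> T i"
      using b(1) T(1) by (auto simp: combinations_def intro!: subspace_sum subspace_scale)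
  qed
  have bK: "b i j \<in> Rn n \<inter> cball 0 1" if "j < k" for i j using b(1)[OF that, of i] T(2) by auto
  obtain r l where r: "strict_mono r" "\<And>j. j < k \<Longrightarrow> l j \<in> Rn n \<inter> cball 0 1 \<and> (\<lambda>i. b (r i) j) \<longlonglongrightarrow> l j"
    using convergent_subsequences[of "Rn n \<inter> cball 0 1" k b, OF compact_Rn_cball bK] by blast
  have l: "\<bar>a j\<bar> \<le> 3 ^ k * norm (\<Sum>j<k. a j *\<^sub>R l j)" if "j < k" for a j
  proof (rule LIMSEQ_le_const)
    show "(\<lambda>i. 3 ^ k * norm (\<Sum>j<k. a j *\<^sub>R b (r i) j)) \<longlonglongrightarrow> 3 ^ k * norm (\<Sum>j<k. a j *\<^sub>R l j)"
      using r(2) by (intro tendsto_intros) auto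
    show "\<exists>N. \<forall>i\<ge>N. \<bar>a j\<bar> \<le> 3 ^ k * norm (\<Sum>j<k. a j *\<^sub>R b (r i) j)" using b(3)[OF that] by blast
  qed
  let ?A = "combinations k l"
  have lim0: "(\<lambda>i. 3 ^ k * (\<Sum>j<k. norm (b (r i) j - l j))) \<longlonglongrightarrow> 0"
  proof -
    have "(\<lambda>i. 3 ^ k * (\<Sum>j<k. norm (b (r i) j - l j))) \<longlonglongrightarrow> 3 ^ k * (\<Sum>j<k. norm (l j - l j))"
      using r(2) by (intro tendsto_intros) auto
    then show ?thesis by simp
  qed
  have "grassmann_tendsto (\<lambda>i. T (r i)) ?A"
    unfolding grassmann_tendsto_def
  proof
    show "\<forall>\<^sub>F i in sequentially. dim (T (r i)) = dim ?A"
      using T(3) dim_combinations[of k "3 ^ k" l] l by simp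
    show "(\<lambda>i. max (gap (T (r i)) ?A) (gap ?A (T (r i)))) \<longlonglongrightarrow> 0"
    proof (rule tendsto_sandwich[OF _ _ tendsto_const lim0])
      show "\<forall>\<^sub>F i in sequentially. 0 \<le> max (gap (T (r i)) ?A) (gap ?A (T (r i)))"
        using gap_nonneg[OF T(1) subspace_combinations] by (simp add: le_max_iff_disj)
      have "gap (T (r i)) ?A \<le> 3 ^ k * (\<Sum>j<k. norm (b (r i) j - l j))" for i
        unfolding Teq by (rule gap_combinations_le) (use b(3) in auto)
      moreover have "gap ?A (T (r i)) \<le> 3 ^ k * (\<Sum>j<k. norm (b (r i) j - l j))" for i
        unfolding Teq norm_minus_commute[of "b _ _"] by (rule gap_combinations_le) (use l in auto)
      ultimately show "\<forall>\<^sub>F i in sequentially. max (gap (T (r i)) ?A) (gap ?A (T (r i)))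
          \<le> 3 ^ k * (\<Sum>j<k. norm (b (r i) j - l j))"
        by (intro always_eventually) simp
    qed
  qed
  moreover have "?A \<subseteq> Rn n" using r(2) by (auto simp: combinations_def intro!: Rn_sum Rn_scale)
  ultimately show ?thesis using r(1) subspace_combinations by blast
qed

text \<open>Each standard basis vector is \<open>D u + t\<close> with \<open>t\<close> in \<open>A\<close>, hence the limit of vectors \<open>Di i u + w i\<close> of the
  approximating sums.  The linear map that takes the standard basis to these vectors is near the identity,
  hence onto.\<close>

lemma transversality_stable:
  fixes D :: "rseq \<Rightarrow> rseq"
  assumes tr: "Rn n \<subseteq> D ` Rn m + A"
    and D: "\<And>u. u \<in> Rn m \<Longrightarrow> (\<lambda>i. Di i u) \<longlonglongrightarrow> D u"
    and lin: "\<And>i. linear (Di i)"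
    and ran: "\<And>i u. u \<in> Rn m \<Longrightarrow> Di i u \<in> Rn n"
    and W: "\<And>i. subspace (W i)" "\<And>i. W i \<subseteq> Rn n"
    and A: "\<And>t. t \<in> A \<Longrightarrow> \<exists>w. (\<forall>i. w i \<in> W i) \<and> w \<longlonglongrightarrow> t"
  shows "\<forall>\<^sub>F i in sequentially. Di i ` Rn m + W i = Rn n"
proof -
  have "\<exists>u w. u \<in> Rn m \<and> (\<forall>i. w i \<in> W i) \<and> (\<lambda>i. Di i u + w i) \<longlonglongrightarrow> basis_vec l" if l: "l < n" for l
  proof -
    obtain u t where ut: "u \<in> Rn m" "t \<in> A" "basis_vec l = D u + t"
      using subsetD[OF tr basis_vec_Rn[OF l]] by (auto simp: set_plus_def)
    obtain w where "\<forall>i. w i \<in> W i" "w \<longlonglongrightarrow> t" using A[OF ut(2)] by auto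
    then show ?thesis using tendsto_add[OF D[OF ut(1)], of w t] ut by (intro exI[of _ u] exI[of _ w]) auto
  qed
  then have "\<forall>l. \<exists>u w. l < n \<longrightarrow> u \<in> Rn m \<and> (\<forall>i. w i \<in> W i) \<and> (\<lambda>i. Di i (u) + w i) \<longlonglongrightarrow> basis_vec l" by blast
  then obtain u where "\<forall>l. \<exists>w. l < n \<longrightarrow> u l \<in> Rn m \<and> (\<forall>i. w i \<in> W i) \<and> (\<lambda>i. Di i (u l) + w i) \<longlonglongrightarrow> basis_vec l"
    by (rule choice[THEN exE])
  then obtain w where "\<forall>l. l < n \<longrightarrow> u l \<in> Rn m \<and> (\<forall>i. w l i \<in> W i) \<and> (\<lambda>i. Di i (u l) + w l i) \<longlonglongrightarrow> basis_vec l"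
    by (rule choice[THEN exE])
  then have uw: "\<And>l. l < n \<Longrightarrow> u l \<in> Rn m" "\<And>l i. l < n \<Longrightarrow> w l i \<in> W i"
    "\<And>l. l < n \<Longrightarrow> (\<lambda>i. Di i (u l) + w l i) \<longlonglongrightarrow> basis_vec l"
    by blast+
  let ?x = "\<lambda>l i. Di i (u l) + w l i"
  have "(\<lambda>i. \<Sum>l<n. norm (?x l i - basis_vec l)) \<longlonglongrightarrow> (\<Sum>l<n. norm (basis_vec l - basis_vec l))"
    using uw(3) by (intro tendsto_intros) auto
  then have "\<forall>\<^sub>F i in sequentially. (\<Sum>l<n. norm (?x l i - basis_vec l)) < 1/2"
    by (intro order_tendstoD) auto
  then show ?thesis
  proof eventually_elim
    case (elim i)
    let ?L = "\<lambda>x. \<Sum>l<n. apply_bcontfun x l *\<^sub>R (?x l i - basis_vec l)"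
    have x: "?x l i \<in> Rn n" if "l < n" for l
      by (rule Rn_add[OF ran[OF uw(1)[OF that]] subsetD[OF W(2) uw(2)[OF that]]])
    show ?case
    proof
      show "Di i ` Rn m + W i \<subseteq> Rn n" 
        using ran W(2)[of i] by (auto simp: set_plus_def intro!: Rn_add)
      show "Rn n \<subseteq> Di i ` Rn m + W i"
      proof
        fix y assume y: "y \<in> Rn n"
        have "\<exists>x\<in>Rn n. x + ?L x = y"
        proof (rule near_identity_onto[OF _ _ _ y])
          show "linear ?L"
            by (rule bounded_linear.linear, rule bounded_linear_sum, rule bounded_linear_scaleR_const)
               (rule bounded_linear_coord)
          show "?L x \<in> Rn n" if "x \<in> Rn n" for x by (intro Rn_sum Rn_scale Rn_diff x basis_vec_Rn) auto
          show "norm (?L x) \<le> norm x / 2" if "x \<in> Rn n" for x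
          proof -
            have "norm (?L x) \<le> (\<Sum>l<n. norm x * norm (?x l i - basis_vec l))"
              by (rule norm_sum[THEN order_trans], rule sum_mono, unfold norm_scaleR)
                 (intro mult_right_mono norm_coord norm_ge_zero)
            also have "\<dots> = norm x * (\<Sum>l<n. norm (?x l i - basis_vec l))" by (simp add: sum_distrib_left)
            also have "\<dots> \<le> norm x * (1/2)" using elim by (intro mult_left_mono) auto
            finally show ?thesis by simp
          qed
        qed
        then obtain x where xx: "x \<in> Rn n" "x + ?L x = y" by blast
        have "y = (\<Sum>l<n. apply_bcontfun x l *\<^sub>R basis_vec l) + ?L x" using xx Rn_expand[OF xx(1)] by simp
        also have "\<dots> = (\<Sum>l<n. apply_bcontfun x l *\<^sub>R ?x l i)"
          by (simp add: sum.distrib[symmetric] scaleR_diff_right scaleR_add_right)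
        also have "\<dots> = Di i (\<Sum>l<n. apply_bcontfun x l *\<^sub>R u l) + (\<Sum>l<n. apply_bcontfun x l *\<^sub>R w l i)"
          by (simp add: linear_sum[OF lin] linear_cmul[OF lin] scaleR_add_right sum.distrib)
        finally have "y = \<dots>" .
        moreover have "(\<Sum>l<n. apply_bcontfun x l *\<^sub>R u l) \<in> Rn m"
          using uw(1) by (intro Rn_sum Rn_scale) auto
        moreover have "(\<Sum>l<n. apply_bcontfun x l *\<^sub>R w l i) \<in> W i"
          using uw(2) by (intro subspace_sum subspace_scale W(1)) auto
        ultimately show "y \<in> Di i ` Rn m + W i" by (simp add: set_plus_intro)
      qed
    qed
  qed
qed

section \<open>Derivatives within the coordinate spaces\<close>

abbreviation ropen :: "nat \<Rightarrow> rseq set \<Rightarrow> bool" where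
  "ropen n U \<equiv> openin (top_of_set (Rn n)) U"

lemma ropen_imp_subset: "ropen n U \<Longrightarrow> U \<subseteq> Rn n"
  by (rule openin_imp_subset)

lemma at_within_ropen:
  assumes "ropen n U" "x \<in> U"
  shows "at x within U = at x within Rn n"
proof -
  obtain S where S: "open S" "U = Rn n \<inter> S" using assms(1) by (auto simp: openin_open)
  then show ?thesis using assms(2) by (intro at_within_nhd[of x S]) auto
qed

lemma fderiv_works:
  "F differentiable (at x within Rn n) \<Longrightarrow> (F has_derivative fderiv n F x) (at x within Rn n)"
  unfolding fderiv_def by (simp add: frechet_derivative_works)

text \<open>Within \<open>Rn n\<close> a derivative is determined on the vectors of \<open>Rn n\<close> only, by the lines with these directions.\<close>

lemma has_derivative_Rn_unique:
  fixes F :: "rseq \<Rightarrow> 'b::real_normed_vector"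
  assumes F: "(F has_derivative D) (at x within Rn n)" "(F has_derivative D') (at x within Rn n)"
    and xv: "x \<in> Rn n" "v \<in> Rn n"
  shows "D v = D' v"
proof -
  have *: "((\<lambda>t::real. F (x + t *\<^sub>R v)) has_derivative (\<lambda>t. E (t *\<^sub>R v))) (at 0)"
    if "(F has_derivative E) (at x within Rn n)" for E
  proof (rule has_derivative_in_compose[where f="\<lambda>t. x + t *\<^sub>R v" and g=F])
    show "((\<lambda>t. x + t *\<^sub>R v) has_derivative (\<lambda>t. t *\<^sub>R v)) (at 0)"
      by (auto intro!: derivative_eq_intros)
    show "(F has_derivative E) (at (x + 0 *\<^sub>R v) within range (\<lambda>t. x + t *\<^sub>R v))"
      unfolding scale_zero_left add_0_right
      by (rule has_derivative_subset[OF that]) (use xv in \<open>auto intro!: Rn_add Rn_scale\<close>)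
  qed
  have "(\<lambda>t. D (t *\<^sub>R v)) = (\<lambda>t. D' (t *\<^sub>R v))"
    by (rule has_derivative_unique[OF * *]) (fact F)+
  then show ?thesis by (metis scaleR_one)
qed

lemma fderiv_eqI:
  assumes "(F has_derivative D) (at x within Rn n)" "x \<in> Rn n" "v \<in> Rn n"
  shows "fderiv n F x v = D v"
  using has_derivative_Rn_unique[OF fderiv_works assms(1) assms(2,3)] assms(1)
  by (auto simp: differentiable_def)

lemma linear_fderiv:
  assumes "F differentiable (at x within Rn n)"
  shows "linear (fderiv n F x)"
  using has_derivative_bounded_linear[OF fderiv_works[OF assms]] by (rule bounded_linear.linear)

lemma has_derivative_ropen_cong:
  assumes "ropen n U" "x \<in> U" "\<And>y. y \<in> U \<Longrightarrow> F y = G y"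
    and "(F has_derivative D) (at x within Rn n)"
  shows "(G has_derivative D) (at x within Rn n)"
proof -
  have "(F has_derivative D) (at x within U)"
    using assms by (simp add: at_within_ropen)
  then have "(G has_derivative D) (at x within U)"
    by (rule has_derivative_transform[rotated 2]) (use assms in auto)
  then show ?thesis using assms by (simp add: at_within_ropen)
qed

lemma has_derivative_ropen_compose:
  assumes U: "ropen n U" "x \<in> U" and FU: "\<And>y. y \<in> U \<Longrightarrow> F y \<in> Rn m"
    and F: "(F has_derivative D) (at x within Rn n)"
    and H: "(H has_derivative E) (at (F x) within Rn m)"
  shows "((H \<circ> F) has_derivative (E \<circ> D)) (at x within Rn n)"
proof -
  have "(F has_derivative D) (at x within U)" using F U by (simp add: at_within_ropen)
  moreover have "(H has_derivative E) (at (F x) within F ` U)"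
    by (rule has_derivative_subset[OF H]) (use FU in auto)
  ultimately have "((\<lambda>y. H (F y)) has_derivative (\<lambda>v. E (D v))) (at x within U)"
    by (rule has_derivative_in_compose)
  then show ?thesis using U by (simp add: at_within_ropen o_def)
qed

lemma ropen_Int_Rn:
  assumes "ropen n U" "k \<le> n" shows "ropen k (U \<inter> Rn k)"
proof -
  obtain S where "open S" "U = Rn n \<inter> S" using assms(1) by (auto simp: openin_open)
  then have "U \<inter> Rn k = Rn k \<inter> S" using Rn_mono[OF assms(2)] by auto
  then show ?thesis using \<open>open S\<close> by auto
qed

text \<open>If a map sends a coordinate subspace into another one, so does its derivative: the transversal
  components of the map vanish identically along the first subspace.\<close>

lemma has_derivative_Rn_range:
  assumes U: "ropen n U" "x \<in> U" "k \<le> n" "x \<in> Rn k"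
    and FU: "\<And>y. y \<in> U \<Longrightarrow> y \<in> Rn k \<Longrightarrow> F y \<in> Rn l"
    and F: "(F has_derivative D) (at x within Rn n)" and v: "v \<in> Rn k"
  shows "D v \<in> Rn l"
  unfolding Rn_def
proof (intro CollectI allI impI)
  fix j assume j: "l \<le> j"
  let ?f = "\<lambda>y. apply_bcontfun (F y) j"
  have 1: "(?f has_derivative (\<lambda>v. apply_bcontfun (D v) j)) (at x within Rn k)"
    by (rule bounded_linear.has_derivative[OF bounded_linear_coord])
       (rule has_derivative_subset[OF F Rn_mono[OF U(3)]])
  have W: "ropen k (U \<inter> Rn k)" by (rule ropen_Int_Rn[OF U(1,3)])
  have 2: "(?f has_derivative (\<lambda>v. 0)) (at x within Rn k)"
  proof -
    have "((\<lambda>y. 0::real) has_derivative (\<lambda>v. 0)) (at x within (U \<inter> Rn k))" by simp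
    then have "(?f has_derivative (\<lambda>v. 0)) (at x within (U \<inter> Rn k))"
      by (rule has_derivative_transform[rotated 2]) (use U FU j in \<open>auto simp: Rn_def\<close>)
    then show ?thesis using at_within_ropen[OF W] U by simp
  qed
  show "apply_bcontfun (D v) j = 0"
    by (rule has_derivative_Rn_unique[OF 1 2 U(4) v])
qed

lemma fderiv_Rn:
  assumes U: "ropen n U" "x \<in> U" and FU: "\<And>y. y \<in> U \<Longrightarrow> F y \<in> Rn m"
    and F: "F differentiable (at x within Rn n)" and v: "v \<in> Rn n"
  shows "fderiv n F x v \<in> Rn m"
  by (rule has_derivative_Rn_range[OF U order_refl _ _ fderiv_works[OF F] v])
     (use FU U ropen_imp_subset in auto)

lemma fderiv_ropen_cong:
  assumes "ropen n U" "x \<in> U" "\<And>y. y \<in> U \<Longrightarrow> F y = G y"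
    and "F differentiable (at x within Rn n)" "v \<in> Rn n"
  shows "fderiv n G x v = fderiv n F x v"
  by (rule fderiv_eqI[OF has_derivative_ropen_cong[OF assms(1-3) fderiv_works[OF assms(4)]]])
     (use assms ropen_imp_subset in auto)

lemma fderiv_compose:
  assumes U: "ropen n U" "x \<in> U" and FU: "\<And>y. y \<in> U \<Longrightarrow> F y \<in> Rn m"
    and F: "F differentiable (at x within Rn n)" and H: "H differentiable (at (F x) within Rn m)"
    and v: "v \<in> Rn n"
  shows "fderiv n (H \<circ> F) x v = fderiv m H (F x) (fderiv n F x v)"
  using fderiv_eqI[OF has_derivative_ropen_compose[OF U FU fderiv_works[OF F] fderiv_works[OF H]] _ v]
    U ropen_imp_subset by auto

lemma C1_onI:
  assumes "\<And>x. x \<in> U \<Longrightarrow> (F has_derivative D x) (at x within Rn n)" "U \<subseteq> Rn n"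
    and "\<And>v. v \<in> Rn n \<Longrightarrow> continuous_on U (\<lambda>x. D x v)"
  shows "C1_on n U F"
  unfolding C1_on_def
proof (intro conjI ballI)
  show "F differentiable (at x within Rn n)" if "x \<in> U" for x
    using assms(1)[OF that] by (auto simp: differentiable_def)
  fix v assume v: "v \<in> Rn n"
  have "fderiv n F x v = D x v" if "x \<in> U" for x
    by (rule fderiv_eqI[OF assms(1)]) (use that assms(2) v in auto)
  then show "continuous_on U (\<lambda>x. fderiv n F x v)"
    using continuous_on_cong[OF refl, of U "\<lambda>x. fderiv n F x v" "\<lambda>x. D x v"] assms(3)[OF v] by simp
qed

lemma C1_on_differentiable: "C1_on n U F \<Longrightarrow> x \<in> U \<Longrightarrow> F differentiable (at x within Rn n)"
  by (auto simp: C1_on_def)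

lemma C1_on_has_derivative: "C1_on n U F \<Longrightarrow> x \<in> U \<Longrightarrow> (F has_derivative fderiv n F x) (at x within Rn n)"
  by (intro fderiv_works C1_on_differentiable)

lemma C1_on_subset: "C1_on n U F \<Longrightarrow> W \<subseteq> U \<Longrightarrow> C1_on n W F"
  by (auto simp: C1_on_def intro: continuous_on_subset)

lemma C1_on_cong:
  assumes "ropen n U" "\<And>y. y \<in> U \<Longrightarrow> F y = G y" "C1_on n U F"
  shows "C1_on n U G"
proof (rule C1_onI[where D="fderiv n F"])
  show "(G has_derivative fderiv n F x) (at x within Rn n)" if "x \<in> U" for x
    by (rule has_derivative_ropen_cong[OF assms(1) that assms(2) C1_on_has_derivative[OF assms(3) that]])
qed (use assms ropen_imp_subset in \<open>auto simp: C1_on_def\<close>)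

lemma C1_on_local:
  assumes U: "U \<subseteq> Rn n"
    and loc: "\<And>x. x \<in> U \<Longrightarrow> \<exists>W. ropen n W \<and> x \<in> W \<and> C1_on n W F"
  shows "C1_on n U F"
  unfolding C1_on_def
proof (intro conjI ballI)
  show "F differentiable (at x within Rn n)" if "x \<in> U" for x
    using loc[OF that] C1_on_differentiable by auto
  fix v assume v: "v \<in> Rn n"
  let ?f = "\<lambda>x. fderiv n F x v"
  have "continuous (at x within U) ?f" if x: "x \<in> U" for x
  proof -
    obtain W where W: "ropen n W" "x \<in> W" "C1_on n W F" using loc[OF x] by auto
    then have "continuous_on W ?f" using v by (auto simp: C1_on_def)
    then have "continuous (at x within Rn n) ?f"
      using W at_within_ropen[OF W(1,2)] by (auto simp: continuous_on_eq_continuous_within)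
    then show ?thesis using U continuous_within_subset by blast
  qed
  then show "continuous_on U ?f" by (simp add: continuous_on_eq_continuous_within)
qed

lemma C1_on_continuous_on: "C1_on n U F \<Longrightarrow> U \<subseteq> Rn n \<Longrightarrow> continuous_on U F"
  unfolding continuous_on_eq_continuous_within
  using C1_on_has_derivative has_derivative_continuous continuous_within_subset by metis

text \<open>Expansion in the standard basis gives the continuity of the derivative in the point and the vector
  jointly, from its continuity in the point for each fixed vector.\<close>

lemma fderiv_expand:
  assumes "C1_on m W H" "y \<in> W" "v \<in> Rn m"
  shows "fderiv m H y v = (\<Sum>j<m. apply_bcontfun v j *\<^sub>R fderiv m H y (basis_vec j))"
proof -
  have l: "linear (fderiv m H y)" by (rule linear_fderiv[OF C1_on_differentiable[OF assms(1,2)]])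
  have "fderiv m H y v = fderiv m H y (\<Sum>j<m. apply_bcontfun v j *\<^sub>R basis_vec j)"
    by (simp only: Rn_expand[OF assms(3)])
  then show ?thesis by (simp only: linear_sum[OF l] linear_cmul[OF l])
qed

lemma continuous_on_fderiv:
  assumes H: "C1_on m W H" and F: "continuous_on U F" "F ` U \<subseteq> W" and G: "continuous_on U G" "G ` U \<subseteq> Rn m"
  shows "continuous_on U (\<lambda>x. fderiv m H (F x) (G x))"
proof -
  have "continuous_on U (\<lambda>x. \<Sum>j<m. apply_bcontfun (G x) j *\<^sub>R fderiv m H (F x) (basis_vec j))"
  proof (intro continuous_on_sum continuous_on_scaleR)
    show "continuous_on U (\<lambda>x. apply_bcontfun (G x) j)" for j
      by (rule bounded_linear.continuous_on[OF bounded_linear_coord G(1)])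
    show "continuous_on U (\<lambda>x. fderiv m H (F x) (basis_vec j))" if "j \<in> {..<m}" for j
      using H that by (intro continuous_on_compose2[OF _ F]) (auto simp: C1_on_def basis_vec_Rn)
  qed
  moreover have "fderiv m H (F x) (G x) = (\<Sum>j<m. apply_bcontfun (G x) j *\<^sub>R fderiv m H (F x) (basis_vec j))"
    if "x \<in> U" for x
    by (rule fderiv_expand[OF H]) (use F(2) G(2) that in auto)
  ultimately show ?thesis by simp
qed

lemma tendsto_fderiv:
  assumes H: "C1_on m W H"
    and y: "\<forall>\<^sub>F i in sequentially. y i \<in> W" "y0 \<in> W" "y \<longlonglongrightarrow> y0"
    and v: "\<forall>\<^sub>F i in sequentially. v i \<in> Rn m" "v0 \<in> Rn m" "v \<longlonglongrightarrow> v0"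
  shows "(\<lambda>i. fderiv m H (y i) (v i)) \<longlonglongrightarrow> fderiv m H y0 v0"
proof -
  have "(\<lambda>i. \<Sum>j<m. apply_bcontfun (v i) j *\<^sub>R fderiv m H (y i) (basis_vec j))
    \<longlonglongrightarrow> (\<Sum>j<m. apply_bcontfun v0 j *\<^sub>R fderiv m H y0 (basis_vec j))"
  proof (intro tendsto_sum tendsto_scaleR)
    show "(\<lambda>i. apply_bcontfun (v i) j) \<longlonglongrightarrow> apply_bcontfun v0 j" for j
      by (rule bounded_linear.tendsto[OF bounded_linear_coord v(3)])
    show "(\<lambda>i. fderiv m H (y i) (basis_vec j)) \<longlonglongrightarrow> fderiv m H y0 (basis_vec j)" if "j \<in> {..<m}" for j
    proof (rule continuous_on_tendsto_compose[OF _ y(3,2,1)])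
      show "continuous_on W (\<lambda>x. fderiv m H x (basis_vec j))" using H that by (auto simp: C1_on_def basis_vec_Rn)
    qed
  qed
  moreover have "\<forall>\<^sub>F i in sequentially.
      (\<Sum>j<m. apply_bcontfun (v i) j *\<^sub>R fderiv m H (y i) (basis_vec j)) = fderiv m H (y i) (v i)"
    using y(1) v(1) by eventually_elim (rule fderiv_expand[OF H, symmetric])
  ultimately show ?thesis
    unfolding fderiv_expand[OF H y(2) v(2)] by (rule Lim_transform_eventually)
qed

lemma C1_on_compose:
  assumes U: "ropen n U" and F: "C1_on n U F" "F ` U \<subseteq> W" and H: "C1_on m W H" "W \<subseteq> Rn m"
  shows "C1_on n U (H \<circ> F)"
proof (rule C1_onI[where D="\<lambda>x v. fderiv m H (F x) (fderiv n F x v)"])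
  have FU: "F y \<in> Rn m" if "y \<in> U" for y using F(2) H(2) that by auto
  show "(H \<circ> F has_derivative (\<lambda>v. fderiv m H (F x) (fderiv n F x v))) (at x within Rn n)" if "x \<in> U" for x
    using has_derivative_ropen_compose[OF U that FU C1_on_has_derivative[OF F(1) that] C1_on_has_derivative[OF H(1)]]
      that F(2) by (auto simp: o_def)
  show "U \<subseteq> Rn n" by (rule ropen_imp_subset[OF U])
  show "continuous_on U (\<lambda>x. fderiv m H (F x) (fderiv n F x v))" if v: "v \<in> Rn n" for v
  proof (rule continuous_on_fderiv[OF H(1) _ F(2)])
    show "continuous_on U F" by (rule C1_on_continuous_on[OF F(1) ropen_imp_subset[OF U]])
    show "continuous_on U (\<lambda>x. fderiv n F x v)" using F(1) v by (auto simp: C1_on_def)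
    show "(\<lambda>x. fderiv n F x v) ` U \<subseteq> Rn m"
      using fderiv_Rn[OF U _ FU C1_on_differentiable[OF F(1)] v] by auto
  qed
qed

lemma fderiv_id: "x \<in> Rn n \<Longrightarrow> v \<in> Rn n \<Longrightarrow> fderiv n (\<lambda>x. x) x v = v"
  by (rule fderiv_eqI) auto

section \<open>Charts\<close>

lemma is_chart_inj: "is_chart X n c \<Longrightarrow> inj_on (snd c) (fst c)"
  using homeomorphic_imp_injective_map[of "subtopology X (fst c)"] openin_subset
  by (fastforce simp: is_chart_def topspace_subtopology inf_absorb2)

lemma is_chart_topspace: "is_chart X n c \<Longrightarrow> fst c \<subseteq> topspace X"
  by (auto simp: is_chart_def dest: openin_subset)

lemma is_chart_cinv [simp]: "is_chart X n c \<Longrightarrow> p \<in> fst c \<Longrightarrow> cinv c (snd c p) = p"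
  by (simp add: cinv_def is_chart_inj)

lemma is_chart_open_image:
  assumes c: "is_chart X n c" and Q: "openin X Q" "Q \<subseteq> fst c"
  shows "ropen n (snd c ` Q)"
proof -
  have "openin (subtopology X (fst c)) Q"
    using Q by (auto simp: openin_subtopology)
  then have "openin (top_of_set (snd c ` fst c)) (snd c ` Q)"
    using c homeomorphic_imp_open_map[of "subtopology X (fst c)"] by (auto simp: is_chart_def open_map_def)
  then show ?thesis using c openin_trans by (auto simp: is_chart_def)
qed

lemma is_chart_open_preimage:
  assumes c: "is_chart X n c" and W: "ropen n W"
  shows "openin X {p \<in> fst c. snd c p \<in> W}"
proof -
  have cont: "continuous_map (subtopology X (fst c)) (top_of_set (snd c ` fst c)) (snd c)"
    using c by (auto simp: is_chart_def homeomorphic_imp_continuous_map)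
  obtain S where S: "open S" "W = Rn n \<inter> S" using W by (auto simp: openin_open)
  have "openin (top_of_set (snd c ` fst c)) (snd c ` fst c \<inter> S)" using S by auto
  from openin_continuous_map_preimage[OF cont this]
  have "openin (subtopology X (fst c)) {p \<in> fst c. snd c p \<in> W}"
    using S c is_chart_topspace[OF c]
    by (elim back_subst[of "openin _"]) (auto simp: is_chart_def topspace_subtopology dest: ropen_imp_subset)
  then show ?thesis using c openin_trans_full[of X "fst c"] by (auto simp: is_chart_def)
qed

lemma is_chart_restrict:
  assumes c: "is_chart X n c" and Q: "openin X Q"
  shows "is_chart X n (fst c \<inter> Q, snd c)"
proof -
  have o: "openin X (fst c \<inter> Q)" using c Q by (auto simp: is_chart_def)
  have h: "homeomorphic_map (subtopology X (fst c)) (top_of_set (snd c ` fst c)) (snd c)"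
    using c by (simp add: is_chart_def)
  have "snd c ` fst c \<inter> snd c ` (fst c \<inter> Q) = snd c ` (fst c \<inter> Q)" by auto
  then have "homeomorphic_map (subtopology X (fst c \<inter> Q)) (top_of_set (snd c ` (fst c \<inter> Q))) (snd c)"
    using homeomorphic_map_subtopologies[OF h, of "fst c \<inter> Q" "snd c ` (fst c \<inter> Q)"]
      is_chart_topspace[OF c] is_chart_inj[OF c]
    by (simp add: subtopology_subtopology topspace_subtopology Int_absorb1 inf.absorb2 Int_assoc[symmetric] image_Int_subset
        subtopology_subtopology)
  then show ?thesis using o is_chart_open_image[OF c o] by (simp add: is_chart_def)
qed

lemma local_rep_apply: "is_chart X n c \<Longrightarrow> p \<in> fst c \<Longrightarrow> local_rep c d g (snd c p) = snd d (g p)"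
  by (simp add: local_rep_def)

abbreviation rep_deriv :: "'m c1mfd \<Rightarrow> 'm chart \<Rightarrow> 'a chart \<Rightarrow> ('m \<Rightarrow> 'a) \<Rightarrow> 'm \<Rightarrow> rseq \<Rightarrow> rseq" where
  "rep_deriv M c d g w \<equiv> fderiv (mdim M) (local_rep c d g) (snd c w)"

abbreviation chart_change :: "'a c1mfd \<Rightarrow> 'a chart \<Rightarrow> 'a chart \<Rightarrow> 'a \<Rightarrow> rseq \<Rightarrow> rseq" where
  "chart_change N c d p \<equiv> fderiv (mdim N) (snd d \<circ> cinv c) (snd c p)"

lemma charts_is_chart: "c \<in> charts N \<Longrightarrow> is_chart (mtop N) (mdim N) c"
  by (simp add: charts_def)

lemma charts_open: "c \<in> charts N \<Longrightarrow> openin (mtop N) (fst c)"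
  using charts_is_chart is_chart_def by metis

lemma charts_Rn: "c \<in> charts N \<Longrightarrow> p \<in> fst c \<Longrightarrow> snd c p \<in> Rn (mdim N)"
  using charts_is_chart[of c N] by (auto simp: is_chart_def dest!: ropen_imp_subset)

lemma charts_topspace: "c \<in> charts N \<Longrightarrow> p \<in> fst c \<Longrightarrow> p \<in> topspace (mtop N)"
  using charts_is_chart is_chart_topspace by blast

lemma charts_cinv: "c \<in> charts N \<Longrightarrow> p \<in> fst c \<Longrightarrow> cinv c (snd c p) = p"
  using charts_is_chart is_chart_cinv by metis

lemma charts_local_rep: "c \<in> charts N \<Longrightarrow> p \<in> fst c \<Longrightarrow> local_rep c d g (snd c p) = snd d (g p)"
  using charts_is_chart local_rep_apply by metis

lemma charts_open_image: "c \<in> charts N \<Longrightarrow> openin (mtop N) Q \<Longrightarrow> Q \<subseteq> fst c \<Longrightarrow> ropen (mdim N) (snd c ` Q)"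
  using charts_is_chart is_chart_open_image by metis

lemma matlas_charts: "c1_manifold N \<Longrightarrow> c \<in> matlas N \<Longrightarrow> c \<in> charts N"
  by (auto simp: c1_manifold_def charts_def)

lemma charts_at_exists:
  assumes "c1_manifold N" "p \<in> topspace (mtop N)"
  obtains c where "c \<in> charts N" "p \<in> fst c"
proof -
  have "p \<in> (\<Union>c\<in>matlas N. fst c)" using assms by (simp add: c1_manifold_def)
  then show ?thesis using that matlas_charts[OF assms(1)] by auto
qed

text \<open>Near each point the change of charts factors through a chart of the atlas that defines the manifold.\<close>

lemma charts_compatible:
  assumes N: "c1_manifold N" and c: "c \<in> charts N" and d: "d \<in> charts N"
  shows "C1_on (mdim N) (snd c ` (fst c \<inter> fst d)) (snd d \<circ> cinv c)"
proof (rule C1_on_local)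
  let ?n = "mdim N"
  show "snd c ` (fst c \<inter> fst d) \<subseteq> Rn ?n" using charts_Rn[OF c] by auto
  fix x assume "x \<in> snd c ` (fst c \<inter> fst d)"
  then obtain p where p: "p \<in> fst c" "p \<in> fst d" "x = snd c p" by auto
  have "p \<in> (\<Union>e\<in>matlas N. fst e)"
    using N charts_topspace[OF c p(1)] by (simp add: c1_manifold_def)
  then obtain e where e: "e \<in> matlas N" "p \<in> fst e" by auto
  have eN: "e \<in> charts N" by (rule matlas_charts[OF N e(1)])
  let ?Q = "fst c \<inter> fst d \<inter> fst e"
  have Q: "openin (mtop N) ?Q" using charts_open c d eN by blast
  have oc: "ropen ?n (snd c ` ?Q)" by (rule charts_open_image[OF c Q]) auto
  have 1: "C1_on ?n (snd c ` ?Q) (snd e \<circ> cinv c)"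
    using c e(1) by (auto simp: charts_def compatible_def intro: C1_on_subset)
  have 2: "C1_on ?n (snd e ` ?Q) (snd d \<circ> cinv e)"
    using d e(1) by (auto simp: charts_def compatible_def intro: C1_on_subset)
  have "C1_on ?n (snd c ` ?Q) ((snd d \<circ> cinv e) \<circ> (snd e \<circ> cinv c))"
    by (rule C1_on_compose[OF oc 1 _ 2]) (use charts_Rn[OF eN] in \<open>auto simp: charts_cinv[OF c]\<close>)
  then have "C1_on ?n (snd c ` ?Q) (snd d \<circ> cinv c)"
    by (rule C1_on_cong[OF oc, rotated]) (auto simp: charts_cinv[OF c] charts_cinv[OF eN])
  then show "\<exists>W. ropen ?n W \<and> x \<in> W \<and> C1_on ?n W (snd d \<circ> cinv c)"
    using oc p e(2) by blast
qed

lemma charts_restrict: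
  assumes N: "c1_manifold N" and c: "c \<in> charts N" and Q: "openin (mtop N) Q"
  shows "(fst c \<inter> Q, snd c) \<in> charts N"
proof -
  let ?c = "(fst c \<inter> Q, snd c)" and ?n = "mdim N"
  have ch: "is_chart (mtop N) ?n ?c" by (rule is_chart_restrict[OF charts_is_chart[OF c] Q])
  have "compatible ?n ?c d" if d: "d \<in> matlas N" for d
    unfolding compatible_def
  proof
    have dN: "d \<in> charts N" by (rule matlas_charts[OF N d])
    have o: "openin (mtop N) (fst c \<inter> Q \<inter> fst d)" using Q charts_open c dN by blast
    have r: "C1_on ?n (snd c ` (fst c \<inter> Q \<inter> fst d)) (snd d \<circ> cinv c)"
      by (rule C1_on_subset[OF charts_compatible[OF N c dN]]) auto
    have ci: "cinv ?c (snd c p) = p" if "p \<in> fst c \<inter> Q" for p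
      using is_chart_cinv[OF ch, of p] that by simp
    have "(snd d \<circ> cinv c) y = (snd d \<circ> cinv ?c) y" if y: "y \<in> snd c ` (fst c \<inter> Q \<inter> fst d)" for y
    proof -
      obtain p where "y = snd c p" "p \<in> fst c \<inter> Q" using y by auto
      then show ?thesis using ci[of p] charts_cinv[OF c, of p] by simp
    qed
    then have "C1_on ?n (snd c ` (fst c \<inter> Q \<inter> fst d)) (snd d \<circ> cinv ?c)"
      by (rule C1_on_cong[OF charts_open_image[OF c o] _ r, rotated]) auto
    then show "C1_on ?n (snd ?c ` (fst ?c \<inter> fst d)) (snd d \<circ> cinv ?c)" by simp
    show "C1_on ?n (snd d ` (fst ?c \<inter> fst d)) (snd ?c \<circ> cinv d)"
      unfolding fst_conv snd_conv by (rule C1_on_subset[OF charts_compatible[OF N dN c]]) auto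
  qed
  then show ?thesis using ch by (simp add: charts_def)
qed

lemma compactin_chart_cball:
  assumes c: "c \<in> charts M" and sub: "Rn (mdim M) \<inter> cball z e \<subseteq> snd c ` fst c"
  shows "compactin (mtop M) {q \<in> fst c. snd c q \<in> cball z e}" (is "compactin _ ?K")
proof -
  have im: "snd c ` ?K = Rn (mdim M) \<inter> cball z e"
    using sub charts_Rn[OF c] by auto
  have sub: "snd c ` ?K \<subseteq> snd c ` fst c" "?K \<subseteq> fst c" by auto
  have "compactin (top_of_set (snd c ` fst c)) (snd c ` ?K)"
    unfolding compactin_subtopology using sub(1) by (simp add: im compact_Rn_cball del: mem_cball)
  moreover have "homeomorphic_map (subtopology (mtop M) (fst c)) (top_of_set (snd c ` fst c)) (snd c)"
    using charts_is_chart[OF c] by (simp add: is_chart_def)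
  moreover have "?K \<subseteq> topspace (subtopology (mtop M) (fst c))"
    using sub(2) charts_topspace[OF c] by (auto simp: topspace_subtopology)
  ultimately have "compactin (subtopology (mtop M) (fst c)) ?K"
    using homeomorphic_map_compactness by blast
  then show ?thesis by (simp add: compactin_subtopology)
qed

lemma compactin_chart_image:
  assumes c: "c \<in> charts M" and K: "compactin (mtop M) K" "K \<subseteq> fst c"
  shows "compact (snd c ` K)"
proof -
  have "continuous_map (subtopology (mtop M) (fst c)) (top_of_set (snd c ` fst c)) (snd c)"
    using charts_is_chart[OF c] homeomorphic_imp_continuous_map unfolding is_chart_def by blast
  moreover have "compactin (subtopology (mtop M) (fst c)) K" using K by (simp add: compactin_subtopology)
  ultimately have "compactin (top_of_set (snd c ` fst c)) (snd c ` K)" by (rule image_compactin[rotated])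
  then show ?thesis by (simp add: compactin_subtopology)
qed

subsection \<open>Change of charts for local representations\<close>

lemma local_rep_source_change:
  assumes M: "c1_manifold M" and c: "c \<in> charts M" and c': "c' \<in> charts M"
    and Q: "openin (mtop M) Q" "Q \<subseteq> fst c" "Q \<subseteq> fst c'"
    and g: "C1_on (mdim M) (snd c ` Q) (local_rep c d g)"
  shows "C1_on (mdim M) (snd c' ` Q) (local_rep c' d g)"
    and "\<And>p v. p \<in> Q \<Longrightarrow> v \<in> Rn (mdim M) \<Longrightarrow> rep_deriv M c' d g p v =
      rep_deriv M c d g p (chart_change M c' c p v)"
proof -
  let ?m = "mdim M"
  have o': "ropen ?m (snd c' ` Q)" by (rule charts_open_image[OF c' Q(1,3)])
  have t: "C1_on ?m (snd c' ` Q) (snd c \<circ> cinv c')"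
    by (rule C1_on_subset[OF charts_compatible[OF M c' c]]) (use Q in auto)
  have im: "(snd c \<circ> cinv c') ` snd c' ` Q \<subseteq> snd c ` Q" using Q by (auto simp: charts_cinv[OF c'])
  have R: "snd c ` Q \<subseteq> Rn ?m" using charts_Rn[OF c] Q by auto
  have eq: "(local_rep c d g \<circ> (snd c \<circ> cinv c')) y = local_rep c' d g y" if y: "y \<in> snd c' ` Q" for y
  proof -
    obtain p where p: "p \<in> Q" "y = snd c' p" using y by auto
    then have "p \<in> fst c" "p \<in> fst c'" using Q by auto
    then show ?thesis using p by (simp add: charts_cinv[OF c'] charts_local_rep[OF c] charts_local_rep[OF c'])
  qed
  have comp: "C1_on ?m (snd c' ` Q) (local_rep c d g \<circ> (snd c \<circ> cinv c'))"
    by (rule C1_on_compose[OF o' t im g R])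
  show "C1_on ?m (snd c' ` Q) (local_rep c' d g)" by (rule C1_on_cong[OF o' eq comp])
  fix p v assume p: "p \<in> Q" and v: "v \<in> Rn ?m"
  then have x: "snd c' p \<in> snd c' ` Q" and pc: "(snd c \<circ> cinv c') (snd c' p) = snd c p"
    using Q by (auto simp: charts_cinv[OF c'])
  have "rep_deriv M c' d g p v = fderiv ?m (local_rep c d g \<circ> (snd c \<circ> cinv c')) (snd c' p) v"
    by (rule fderiv_ropen_cong[OF o' x eq C1_on_differentiable[OF comp x] v])
  also have "\<dots> = fderiv ?m (local_rep c d g) ((snd c \<circ> cinv c') (snd c' p)) (chart_change M c' c p v)"
    by (rule fderiv_compose[OF o' x _ C1_on_differentiable[OF t x] _ v])
       (use im R C1_on_differentiable[OF g] p in \<open>auto simp: pc[unfolded o_def]\<close>)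
  finally show "rep_deriv M c' d g p v =
      rep_deriv M c d g p (chart_change M c' c p v)" by (simp only: pc)
qed

lemma local_rep_target_change:
  assumes N: "c1_manifold N" and c: "c \<in> charts M" and d: "d \<in> charts N" and d': "d' \<in> charts N"
    and Q: "openin (mtop M) Q" "Q \<subseteq> fst c" "g ` Q \<subseteq> fst d" "g ` Q \<subseteq> fst d'"
    and g: "C1_on (mdim M) (snd c ` Q) (local_rep c d g)"
  shows "C1_on (mdim M) (snd c ` Q) (local_rep c d' g)"
    and "\<And>p v. p \<in> Q \<Longrightarrow> v \<in> Rn (mdim M) \<Longrightarrow> rep_deriv M c d' g p v =
      chart_change N d d' (g p) (rep_deriv M c d g p v)"
proof -
  let ?m = "mdim M" and ?n = "mdim N"
  have o': "ropen ?m (snd c ` Q)" by (rule charts_open_image[OF c Q(1,2)])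
  have t: "C1_on ?n (snd d ` (fst d \<inter> fst d')) (snd d' \<circ> cinv d)" by (rule charts_compatible[OF N d d'])
  have im: "local_rep c d g ` snd c ` Q \<subseteq> snd d ` (fst d \<inter> fst d')"
  proof (clarify)
    fix p assume "p \<in> Q"
    then have "p \<in> fst c" "g p \<in> fst d \<inter> fst d'" using Q by auto
    then show "local_rep c d g (snd c p) \<in> snd d ` (fst d \<inter> fst d')" by (simp add: charts_local_rep[OF c])
  qed
  have R: "snd d ` (fst d \<inter> fst d') \<subseteq> Rn ?n" using charts_Rn[OF d] by auto
  have eq: "((snd d' \<circ> cinv d) \<circ> local_rep c d g) y = local_rep c d' g y" if y: "y \<in> snd c ` Q" for y
  proof -
    obtain p where p: "p \<in> Q" "y = snd c p" using y by auto
    then have "p \<in> fst c" "g p \<in> fst d" using Q by auto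
    then show ?thesis using p by (simp add: charts_cinv[OF d] charts_local_rep[OF c])
  qed
  have comp: "C1_on ?m (snd c ` Q) ((snd d' \<circ> cinv d) \<circ> local_rep c d g)"
    by (rule C1_on_compose[OF o' g im t R])
  show "C1_on ?m (snd c ` Q) (local_rep c d' g)" by (rule C1_on_cong[OF o' eq comp])
  fix p v assume p: "p \<in> Q" and v: "v \<in> Rn ?m"
  then have x: "snd c p \<in> snd c ` Q" and pc: "local_rep c d g (snd c p) = snd d (g p)"
    using Q by (auto simp: charts_local_rep[OF c])
  have "rep_deriv M c d' g p v = fderiv ?m ((snd d' \<circ> cinv d) \<circ> local_rep c d g) (snd c p) v"
    by (rule fderiv_ropen_cong[OF o' x eq C1_on_differentiable[OF comp x] v])
  also have "\<dots> = fderiv ?n (snd d' \<circ> cinv d) (local_rep c d g (snd c p)) (rep_deriv M c d g p v)"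
    by (rule fderiv_compose[OF o' x _ C1_on_differentiable[OF g x] C1_on_differentiable[OF t] v])
       (use im R x in auto)
  finally show "rep_deriv M c d' g p v =
      chart_change N d d' (g p) (rep_deriv M c d g p v)" by (simp only: pc)
qed

subsection \<open>Tangent spaces in charts\<close>

lemma transition_derivative:
  assumes N: "c1_manifold N" and c: "c \<in> charts N" "p \<in> fst c" and d: "d \<in> charts N" "p \<in> fst d"
    and e: "e \<in> charts N" "p \<in> fst e" and v: "v \<in> Rn (mdim N)"
  shows "chart_change N c d p v \<in> Rn (mdim N)"
    and "chart_change N c c p v = v"
    and "chart_change N d e p (chart_change N c d p v)
       = chart_change N c e p v"
proof -
  let ?n = "mdim N"
  let ?Q = "fst c \<inter> fst d \<inter> fst e"
  have Q: "openin (mtop N) ?Q" using charts_open c d e by blast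
  have oc: "ropen ?n (snd c ` ?Q)" by (rule charts_open_image[OF c(1) Q]) auto
  have x: "snd c p \<in> snd c ` ?Q" using c d e by auto
  have t: "C1_on ?n (snd c ` ?Q) (snd d \<circ> cinv c)"
    by (rule C1_on_subset[OF charts_compatible[OF N c(1) d(1)]]) auto
  show "chart_change N c d p v \<in> Rn ?n"
    by (rule fderiv_Rn[OF oc x _ C1_on_differentiable[OF t x] v])
       (use charts_Rn[OF d(1)] in \<open>auto simp: charts_cinv[OF c(1)]\<close>)
  have idd: "(\<lambda>x. x) differentiable (at (snd c p) within Rn ?n)" by simp
  show "chart_change N c c p v = v"
    by (subst fderiv_ropen_cong[OF oc x _ idd v]) (auto simp: charts_cinv[OF c(1)] fderiv_id[OF charts_Rn[OF c] v])
  have eq: "snd e \<circ> cinv c = local_rep c e (\<lambda>x. x)" "snd d \<circ> cinv c = local_rep c d (\<lambda>x. x)"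
    by (auto simp: local_rep_def)
  show "chart_change N d e p (chart_change N c d p v)
       = chart_change N c e p v"
    unfolding eq
    by (rule local_rep_target_change(2)[OF N c(1) d(1) e(1) Q, symmetric])
       (use t v c d e in \<open>auto simp: eq\<close>)
qed

lemma charts_at_iff: "c \<in> charts_at N p \<longleftrightarrow> c \<in> charts N \<and> p \<in> fst c"
  by (auto simp: charts_at_def)

lemma tangent_space_Rn: "v \<in> tangent_space N p \<Longrightarrow> c \<in> charts_at N p \<Longrightarrow> v c \<in> Rn (mdim N)"
  unfolding tangent_space_def by blast

lemma tangent_space_outside: "v \<in> tangent_space N p \<Longrightarrow> c \<notin> charts_at N p \<Longrightarrow> v c = 0"
  unfolding tangent_space_def by blast

lemma tangent_space_change: "v \<in> tangent_space N p \<Longrightarrow> c \<in> charts_at N p \<Longrightarrow> d \<in> charts_at N p \<Longrightarrow>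
    v d = chart_change N c d p (v c)"
  unfolding tangent_space_def by blast

lemma tangent_space_eqI:
  assumes "v \<in> tangent_space N p" "w \<in> tangent_space N p" "c \<in> charts_at N p" "v c = w c"
  shows "v = w"
proof
  fix d show "v d = w d"
    using assms(4) tangent_space_change[OF assms(1,3), of d] tangent_space_change[OF assms(2,3), of d]
      tangent_space_outside[OF assms(1), of d] tangent_space_outside[OF assms(2), of d]
    by (cases "d \<in> charts_at N p") simp_all
qed

text \<open>The vector is transported to the other charts by their derivatives; the chain rule makes this consistent.\<close>

lemma tangent_space_lift:
  assumes N: "c1_manifold N" and c: "c \<in> charts_at N p" and u: "u \<in> Rn (mdim N)"
  shows "\<exists>v\<in>tangent_space N p. v c = u"
proof
  let ?n = "mdim N"
  let ?v = "\<lambda>d. if d \<in> charts_at N p then chart_change N c d p u else 0"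
  show "?v \<in> tangent_space N p"
    unfolding tangent_space_def
  proof (intro CollectI conjI allI ballI impI)
    fix d assume d: "d \<in> charts_at N p"
    then show "?v d \<in> Rn ?n" using transition_derivative(1)[OF N _ _ _ _ _ _ u, of c p d d] c by (auto simp: charts_at_iff)
    fix e assume e: "e \<in> charts_at N p"
    show "?v e = chart_change N d e p (?v d)"
      using transition_derivative(3)[OF N _ _ _ _ _ _ u, of c p d e] c d e by (auto simp: charts_at_iff)
  qed auto
  show "?v c = u" using transition_derivative(2)[OF N _ _ _ _ _ _ u, of c p c c] c by (auto simp: charts_at_iff)
qed

lemma plus_tvec: "(v + w) c = v c + w c" and zero_tvec: "(0 :: 'a tvec) c = 0"
  and scale_tvec: "(r *\<^sub>R v) c = r *\<^sub>R v c" for v w :: "'a tvec"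
  by (auto simp: scaleR_fun_def)

lemma linear_transition:
  assumes N: "c1_manifold N" and "c \<in> charts_at N p" "d \<in> charts_at N p"
  shows "linear (chart_change N c d p)"
  by (rule linear_fderiv[OF C1_on_differentiable[OF charts_compatible[OF N]]])
     (use assms in \<open>auto simp: charts_at_iff\<close>)

lemma subspace_tangent_space:
  assumes N: "c1_manifold N" shows "subspace (tangent_space N p)"
  unfolding subspace_def
proof (intro conjI ballI allI)
  note L = linear_transition[OF N]
  show "0 \<in> tangent_space N p"
    by (auto simp: tangent_space_def Rn_0 linear_0[OF L])
  show "v + w \<in> tangent_space N p" if "v \<in> tangent_space N p" "w \<in> tangent_space N p" for v w
    unfolding tangent_space_def plus_tvec
  proof (intro CollectI conjI allI ballI impI)
    fix c d assume "c \<in> charts_at N p" "d \<in> charts_at N p"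
    then show "v d + w d = chart_change N c d p (v c + w c)"
      using tangent_space_change[OF that(1)] tangent_space_change[OF that(2)] linear_add[OF L] by metis
  qed (use tangent_space_outside[OF that(1)] tangent_space_outside[OF that(2)]
         tangent_space_Rn[OF that(1)] tangent_space_Rn[OF that(2)] in \<open>auto intro: Rn_add\<close>)
  show "r *\<^sub>R v \<in> tangent_space N p" if that: "v \<in> tangent_space N p" for v r
    unfolding tangent_space_def scale_tvec
  proof (intro CollectI conjI allI ballI impI)
    fix c d assume "c \<in> charts_at N p" "d \<in> charts_at N p"
    then show "r *\<^sub>R v d = chart_change N c d p (r *\<^sub>R v c)"
      using tangent_space_change[OF that(1)] linear_cmul[OF L] by metis
  qed (use tangent_space_outside[OF that(1)] tangent_space_Rn[OF that(1)] in \<open>auto intro: Rn_scale\<close>)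
qed

lemma linear_eval: "linear (\<lambda>v::'a tvec. v c)"
  by (rule linearI) (auto simp: plus_tvec scale_tvec)

lemma inj_on_eval: "c \<in> charts_at N p \<Longrightarrow> inj_on (\<lambda>v. v c) (tangent_space N p)"
  by (rule inj_onI) (rule tangent_space_eqI)

lemma eval_tangent_space:
  assumes "c1_manifold N" "c \<in> charts_at N p"
  shows "(\<lambda>v. v c) ` tangent_space N p = Rn (mdim N)"
  using tangent_space_lift[OF assms] tangent_space_Rn[OF _ assms(2)] by (auto simp: image_iff)

subsection \<open>The differential in charts\<close>

lemma C1_maps_continuous: "g \<in> C1_maps M N \<Longrightarrow> continuous_map (mtop M) (mtop N) g"
  by (simp add: C1_maps_def)

lemma C1_maps_preimage_open:
  assumes "g \<in> C1_maps M N" "c \<in> charts M" "d \<in> charts N"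
  shows "openin (mtop M) {p \<in> fst c. g p \<in> fst d}"
proof -
  have "openin (mtop M) (fst c \<inter> {p \<in> topspace (mtop M). g p \<in> fst d})"
    using openin_continuous_map_preimage[OF C1_maps_continuous[OF assms(1)] charts_open[OF assms(3)]]
      charts_open[OF assms(2)] by blast
  then show ?thesis
    by (rule back_subst[of "openin _"]) (use charts_topspace[OF assms(2)] in auto)
qed

lemma C1_maps_rep: "g \<in> C1_maps M N \<Longrightarrow> c \<in> charts M \<Longrightarrow> d \<in> charts N \<Longrightarrow>
    C1_on (mdim M) (snd c ` {p \<in> fst c. g p \<in> fst d}) (local_rep c d g)"
  by (simp add: C1_maps_def)

lemma rep_derivative_Rn:
  assumes g: "g \<in> C1_maps M N" and c: "c \<in> charts M" "w \<in> fst c" and d: "d \<in> charts N" "g w \<in> fst d"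
    and v: "v \<in> Rn (mdim M)"
  shows "rep_deriv M c d g w v \<in> Rn (mdim N)"
proof (rule fderiv_Rn[OF charts_open_image[OF c(1) C1_maps_preimage_open[OF g c(1) d(1)]] _ _
      C1_on_differentiable[OF C1_maps_rep[OF g c(1) d(1)]] v])
  fix y assume "y \<in> snd c ` {p \<in> fst c. g p \<in> fst d}"
  then show "local_rep c d g y \<in> Rn (mdim N)"
    using charts_Rn[OF d(1)] by (auto simp: charts_local_rep[OF c(1)])
qed (use c d in auto)

lemma linear_rep_derivative:
  assumes "g \<in> C1_maps M N" "c \<in> charts M" "w \<in> fst c" "d \<in> charts N" "g w \<in> fst d"
  shows "linear (rep_deriv M c d g w)"
  by (rule linear_fderiv[OF C1_on_differentiable[OF C1_maps_rep]]) (use assms in auto)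

text \<open>The differential is defined by an arbitrary chart of the source; by the chain rule every other chart
  gives the same value.\<close>

lemma differential_chart:
  assumes M: "c1_manifold M" and g: "g \<in> C1_maps M N"
    and c: "c \<in> charts_at M w" and d: "d \<in> charts_at N (g w)" and v: "v \<in> tangent_space M w"
  shows "differential M N g w v d = rep_deriv M c d g w (v c)"
proof -
  let ?m = "mdim M"
  define b where "b = (SOME c. c \<in> charts_at M w)"
  have b: "b \<in> charts_at M w" unfolding b_def using c by (rule someI)
  have bM: "b \<in> charts M" "w \<in> fst b" and cM: "c \<in> charts M" "w \<in> fst c"
    and dN: "d \<in> charts N" "g w \<in> fst d" using b c d by (auto simp: charts_at_iff)
  let ?Q = "fst b \<inter> {p \<in> fst c. g p \<in> fst d}"
  have Q: "openin (mtop M) ?Q" using C1_maps_preimage_open[OF g cM(1) dN(1)] charts_open[OF bM(1)] by blast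
  have r: "C1_on ?m (snd c ` ?Q) (local_rep c d g)"
    by (rule C1_on_subset[OF C1_maps_rep[OF g cM(1) dN(1)]]) auto
  have "rep_deriv M b d g w (v b) =
      rep_deriv M c d g w (chart_change M b c w (v b))"
    by (rule local_rep_source_change(2)[OF M cM(1) bM(1) Q _ _ r])
       (use bM cM dN tangent_space_Rn[OF v b] in auto)
  also have "chart_change M b c w (v b) = v c"
    by (rule tangent_space_change[OF v b c, symmetric])
  finally show ?thesis using d by (simp add: differential_def b_def[symmetric])
qed

lemma differential_tangent_space:
  assumes M: "c1_manifold M" and N: "c1_manifold N" and g: "g \<in> C1_maps M N" and w: "w \<in> topspace (mtop M)"
    and v: "v \<in> tangent_space M w"
  shows "differential M N g w v \<in> tangent_space N (g w)"
proof -
  obtain c where c: "c \<in> charts M" "w \<in> fst c" using charts_at_exists[OF M w] .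
  then have ca: "c \<in> charts_at M w" by (simp add: charts_at_iff)
  have vc: "v c \<in> Rn (mdim M)" by (rule tangent_space_Rn[OF v ca])
  show ?thesis
    unfolding tangent_space_def
  proof (intro CollectI conjI allI ballI impI)
    show "differential M N g w v d = 0" if "d \<notin> charts_at N (g w)" for d
      using that by (simp add: differential_def Let_def)
    fix d assume d: "d \<in> charts_at N (g w)"
    then have dN: "d \<in> charts N" "g w \<in> fst d" by (auto simp: charts_at_iff)
    show "differential M N g w v d \<in> Rn (mdim N)"
      unfolding differential_chart[OF M g ca d v] by (rule rep_derivative_Rn[OF g c dN vc])
    fix e assume e: "e \<in> charts_at N (g w)"
    then have eN: "e \<in> charts N" "g w \<in> fst e" by (auto simp: charts_at_iff)
    let ?Q = "{p \<in> fst c. g p \<in> fst e} \<inter> {p \<in> fst c. g p \<in> fst d}"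
    have Q: "openin (mtop M) ?Q"
      using C1_maps_preimage_open[OF g c(1) dN(1)] C1_maps_preimage_open[OF g c(1) eN(1)] by blast
    have r: "C1_on (mdim M) (snd c ` ?Q) (local_rep c d g)"
      by (rule C1_on_subset[OF C1_maps_rep[OF g c(1) dN(1)]]) auto
    show "differential M N g w v e = chart_change N d e (g w) (differential M N g w v d)"
      unfolding differential_chart[OF M g ca d v] differential_chart[OF M g ca e v]
      by (rule local_rep_target_change(2)[OF N c(1) dN(1) eN(1) Q _ _ _ r]) (use c dN eN vc in auto)
  qed
qed

lemma continuous_map_localI:
  assumes loc: "\<And>p. p \<in> topspace (mtop M) \<Longrightarrow> \<exists>c\<in>charts M. \<exists>d\<in>charts N. \<exists>Q. openin (mtop M) Q \<and> p \<in> Q \<and>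
       Q \<subseteq> fst c \<and> g ` Q \<subseteq> fst d \<and> C1_on (mdim M) (snd c ` Q) (local_rep c d g)"
  shows "continuous_map (mtop M) (mtop N) g"
  unfolding continuous_map_def
proof (intro conjI allI impI Pi_I)
  fix p assume "p \<in> topspace (mtop M)"
  then obtain d Q where "d \<in> charts N" "p \<in> Q" "g ` Q \<subseteq> fst d" using loc[of p] by auto
  then show "g p \<in> topspace (mtop N)" using charts_topspace[of d N "g p"] by auto
next
  fix U assume U: "openin (mtop N) U"
  show "openin (mtop M) {p \<in> topspace (mtop M). g p \<in> U}"
  proof (subst openin_subopen, intro ballI)
    fix p assume p: "p \<in> {p \<in> topspace (mtop M). g p \<in> U}"
    then obtain c d Q where c: "c \<in> charts M" and d: "d \<in> charts N" and Q: "openin (mtop M) Q" "p \<in> Q"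
       "Q \<subseteq> fst c" "g ` Q \<subseteq> fst d" and r: "C1_on (mdim M) (snd c ` Q) (local_rep c d g)"
      using loc[of p] by auto
    let ?W = "snd d ` (fst d \<inter> U)"
    have W: "ropen (mdim N) ?W" by (rule charts_open_image[OF d]) (use U charts_open[OF d] in auto)
    have o: "ropen (mdim M) (snd c ` Q)" by (rule charts_open_image[OF c Q(1,3)])
    have rep: "local_rep c d g (snd c q) = snd d (g q)" if "q \<in> Q" for q
      using charts_local_rep[OF c] Q(3) that by blast
    have "local_rep c d g \<in> snd c ` Q \<rightarrow> Rn (mdim N)"
      using rep charts_Rn[OF d] Q(4) by auto
    from continuous_openin_preimage[OF C1_on_continuous_on[OF r ropen_imp_subset[OF o]] this W]
    have "ropen (mdim M) (snd c ` Q \<inter> local_rep c d g -` ?W)" using o openin_trans by blast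
    from is_chart_open_preimage[OF charts_is_chart[OF c] this]
    have "openin (mtop M) (Q \<inter> {q \<in> fst c. snd c q \<in> snd c ` Q \<inter> local_rep c d g -` ?W})" (is "openin _ ?T")
      using Q(1) by blast
    moreover have "p \<in> ?T" using p Q rep[OF Q(2)] by auto
    moreover have "?T \<subseteq> {p \<in> topspace (mtop M). g p \<in> U}"
    proof
      fix q assume q: "q \<in> ?T"
      then have "q \<in> Q" by (rule IntD1)
      have "snd c q \<in> snd c ` Q \<inter> local_rep c d g -` ?W"
        using CollectD[OF IntD2[OF q]] by (rule conjunct2)
      then have "local_rep c d g (snd c q) \<in> ?W" by (rule IntD2[THEN vimageD])
      then have "snd d (g q) \<in> ?W" by (simp only: rep[OF \<open>q \<in> Q\<close>])
      then obtain z where "z \<in> fst d" "z \<in> U" "snd d z = snd d (g q)" by auto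
      moreover have "g q \<in> fst d" using Q(4) \<open>q \<in> Q\<close> by auto
      ultimately have "g q \<in> U" using charts_cinv[OF d, of "g q"] charts_cinv[OF d, of z] by simp
      then show "q \<in> {p \<in> topspace (mtop M). g p \<in> U}" 
        using \<open>q \<in> Q\<close> Q(3) charts_topspace[OF c] by auto
    qed
    ultimately show "\<exists>T. openin (mtop M) T \<and> p \<in> T \<and> T \<subseteq> {p \<in> topspace (mtop M). g p \<in> U}" by blast
  qed
qed

text \<open>One pair of charts at each point suffices, since a change of charts composes with C1 maps on both sides.\<close>

lemma C1_maps_localI:
  assumes M: "c1_manifold M" and N: "c1_manifold N"
    and g: "g \<in> extensional (topspace (mtop M))"
    and loc: "\<And>p. p \<in> topspace (mtop M) \<Longrightarrow> \<exists>c\<in>charts M. \<exists>d\<in>charts N. \<exists>Q. openin (mtop M) Q \<and> p \<in> Q \<and>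
       Q \<subseteq> fst c \<and> g ` Q \<subseteq> fst d \<and> C1_on (mdim M) (snd c ` Q) (local_rep c d g)"
  shows "g \<in> C1_maps M N"
  unfolding C1_maps_def
proof (intro CollectI conjI ballI g C1_on_local)
  show cont: "continuous_map (mtop M) (mtop N) g" by (rule continuous_map_localI[OF loc])
  fix c' d' assume c': "c' \<in> charts M" and d': "d' \<in> charts N"
  show "snd c' ` {p \<in> fst c'. g p \<in> fst d'} \<subseteq> Rn (mdim M)" using charts_Rn[OF c'] by auto
  fix x assume "x \<in> snd c' ` {p \<in> fst c'. g p \<in> fst d'}"
  then obtain p where p: "p \<in> fst c'" "g p \<in> fst d'" "x = snd c' p" by auto
  obtain c d Q where c: "c \<in> charts M" and d: "d \<in> charts N" and Q: "openin (mtop M) Q" "p \<in> Q"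
       "Q \<subseteq> fst c" "g ` Q \<subseteq> fst d" and r: "C1_on (mdim M) (snd c ` Q) (local_rep c d g)"
    using loc[OF charts_topspace[OF c' p(1)]] by blast
  let ?Q = "Q \<inter> fst c' \<inter> {p \<in> topspace (mtop M). g p \<in> fst d'}"
  have oO: "openin (mtop M) ?Q"
    using openin_continuous_map_preimage[OF cont charts_open[OF d']] Q(1) charts_open[OF c'] by blast
  have "C1_on (mdim M) (snd c ` ?Q) (local_rep c d g)" by (rule C1_on_subset[OF r]) auto
  then have "C1_on (mdim M) (snd c' ` ?Q) (local_rep c' d g)"
    by (rule local_rep_source_change(1)[OF M c c' oO, rotated 2]) (use Q in auto)
  then have "C1_on (mdim M) (snd c' ` ?Q) (local_rep c' d' g)"
    by (rule local_rep_target_change(1)[OF N c' d d' oO, rotated 3]) (use Q in auto)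
  moreover have "ropen (mdim M) (snd c' ` ?Q)" by (rule charts_open_image[OF c' oO]) auto
  moreover have "x \<in> snd c' ` ?Q" using p Q charts_topspace[OF c' p(1)] by auto
  ultimately show "\<exists>W. ropen (mdim M) W \<and> x \<in> W \<and> C1_on (mdim M) W (local_rep c' d' g)" by blast
qed

lemma rep_derivative_change:
  assumes M: "c1_manifold M" and N: "c1_manifold N" and h: "h \<in> C1_maps M N"
    and c: "c \<in> charts M" "w \<in> fst c" and b: "b \<in> charts M" "w \<in> fst b"
    and d: "d \<in> charts N" "h w \<in> fst d" and e: "e \<in> charts N" "h w \<in> fst e" and v: "v \<in> Rn (mdim M)"
  shows "rep_deriv M c d h w v =
    chart_change N e d (h w)
      (rep_deriv M b e h w (chart_change M c b w v))"
proof -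
  let ?Q = "{p \<in> fst c. h p \<in> fst d} \<inter> {p \<in> fst b. h p \<in> fst e}"
  have Q: "openin (mtop M) ?Q"
    using C1_maps_preimage_open[OF h c(1) d(1)] C1_maps_preimage_open[OF h b(1) e(1)] by blast
  have wQ: "w \<in> ?Q" using c b d e by simp
  have rb: "C1_on (mdim M) (snd b ` ?Q) (local_rep b e h)"
    by (rule C1_on_subset[OF C1_maps_rep[OF h b(1) e(1)]]) auto
  have rc: "C1_on (mdim M) (snd c ` ?Q) (local_rep c e h)"
    by (rule C1_on_subset[OF C1_maps_rep[OF h c(1) e(1)]]) auto
  have "rep_deriv M c d h w v =
      chart_change N e d (h w) (rep_deriv M c e h w v)"
    by (rule local_rep_target_change(2)[OF N c(1) e(1) d(1) Q _ _ _ rc wQ v]) auto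
  also have "rep_deriv M c e h w v =
      rep_deriv M b e h w (chart_change M c b w v)"
    by (rule local_rep_source_change(2)[OF M b(1) c(1) Q _ _ rb wQ v]) auto
  finally show ?thesis .
qed

section \<open>Submanifolds and leaves\<close>

lemma slice_chart_mem:
  assumes "slice_chart N S k c" "q \<in> fst c"
  shows "snd c q \<in> Rn k \<longleftrightarrow> q \<in> S"
proof -
  have c: "c \<in> charts N" and eq: "snd c ` (fst c \<inter> S) = snd c ` fst c \<inter> Rn k"
    using assms(1) by (auto simp: slice_chart_def)
  show ?thesis
  proof
    assume "snd c q \<in> Rn k"
    then have "snd c q \<in> snd c ` (fst c \<inter> S)" unfolding eq using assms(2) by blast
    then obtain q' where "q' \<in> fst c" "q' \<in> S" "snd c q' = snd c q" by auto
    then show "q \<in> S" using charts_cinv[OF c] assms(2) by metis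
  next
    assume "q \<in> S"
    then have "snd c q \<in> snd c ` (fst c \<inter> S)" using assms(2) by blast
    then show "snd c q \<in> Rn k" unfolding eq by blast
  qed
qed

text \<open>The change between two slice charts maps the slice to the slice, hence so does its derivative.\<close>

lemma slice_chart_tangent_change:
  assumes N: "c1_manifold N" and c: "slice_chart N S k c" "p \<in> fst c" and d: "slice_chart N S l d" "p \<in> fst d"
    and p: "p \<in> S" and v: "v \<in> tangent_space N p" "v c \<in> Rn k"
  shows "v d \<in> Rn l"
proof -
  have cN: "c \<in> charts N" "k \<le> mdim N" and dN: "d \<in> charts N" using c d by (auto simp: slice_chart_def)
  let ?Q = "fst c \<inter> fst d"
  have Q: "openin (mtop N) ?Q" using charts_open cN dN by blast
  have oc: "ropen (mdim N) (snd c ` ?Q)" by (rule charts_open_image[OF cN(1) Q]) auto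
  have "chart_change N c d p (v c) \<in> Rn l"
  proof (rule has_derivative_Rn_range[OF oc _ cN(2) _ _ C1_on_has_derivative[OF charts_compatible[OF N cN(1) dN]] v(2)])
    show "snd c p \<in> Rn k" using slice_chart_mem[OF c] p by simp
    fix y assume "y \<in> snd c ` ?Q" "y \<in> Rn k"
    then obtain q where q: "q \<in> fst c" "q \<in> fst d" "y = snd c q" "snd c q \<in> Rn k" by auto
    then have "q \<in> S" using slice_chart_mem[OF c(1)] by blast
    then show "(snd d \<circ> cinv c) y \<in> Rn l" using slice_chart_mem[OF d(1)] q by (simp add: charts_cinv[OF cN(1)])
  qed (use c d in auto)
  then show ?thesis
    using tangent_space_change[OF v(1), of c d] c d cN dN by (simp add: charts_at_iff)
qed

lemma sub_tangent_space_slice: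
  assumes N: "c1_manifold N" and c: "slice_chart N S k c" "p \<in> fst c" and p: "p \<in> S"
  shows "sub_tangent_space N S p = {v \<in> tangent_space N p. v c \<in> Rn k}"
  unfolding sub_tangent_space_def using slice_chart_tangent_change[OF N _ _ c p] c by blast

lemma embedded_slice:
  assumes "embedded_submanifold N S"
  obtains k where "\<And>p. p \<in> S \<Longrightarrow> \<exists>c. p \<in> fst c \<and> slice_chart N S k c"
  using assms unfolding embedded_submanifold_def by blast

lemma subspace_sub_tangent_space:
  assumes N: "c1_manifold N" and S: "embedded_submanifold N S" and p: "p \<in> S"
  shows "subspace (sub_tangent_space N S p)"
proof -
  obtain k c where c: "p \<in> fst c" "slice_chart N S k c" using embedded_slice[OF S] p by blast
  show ?thesis unfolding sub_tangent_space_slice[OF N c(2,1) p]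
    using subspace_tangent_space[OF N, of p] subspace_Rn[of k]
    unfolding subspace_def by (auto simp: plus_tvec zero_tvec scale_tvec)
qed

lemma tangent_space_finite_span:
  assumes N: "c1_manifold N" and c: "c \<in> charts_at N p"
  shows "\<exists>C. finite C \<and> tangent_space N p \<subseteq> span C"
proof -
  let ?n = "mdim N"
  have "\<forall>j. \<exists>b. j < ?n \<longrightarrow> b \<in> tangent_space N p \<and> b c = basis_vec j"
    using tangent_space_lift[OF N c basis_vec_Rn] by blast
  then obtain b where "\<forall>j. j < ?n \<longrightarrow> b j \<in> tangent_space N p \<and> b j c = basis_vec j"
    by (rule choice[THEN exE])
  then have b: "\<And>j. j < ?n \<Longrightarrow> b j \<in> tangent_space N p" "\<And>j. j < ?n \<Longrightarrow> b j c = basis_vec j" by blast+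
  have "v \<in> span (b ` {..<?n})" if v: "v \<in> tangent_space N p" for v
  proof -
    let ?w = "\<Sum>j<?n. apply_bcontfun (v c) j *\<^sub>R b j"
    have w: "?w \<in> tangent_space N p"
      by (intro subspace_sum subspace_scale subspace_tangent_space N b(1)) auto
    have "?w c = (\<Sum>j<?n. apply_bcontfun (v c) j *\<^sub>R b j c)"
      using linear_sum[OF linear_eval[of c], of "\<lambda>j. apply_bcontfun (v c) j *\<^sub>R b j" "{..<?n}"] by (simp add: scale_tvec)
    also have "\<dots> = (\<Sum>j<?n. apply_bcontfun (v c) j *\<^sub>R basis_vec j)" using b(2) by simp
    also have "\<dots> = v c" by (rule Rn_expand[OF tangent_space_Rn[OF v c]])
    finally have "?w = v" by (rule tangent_space_eqI[OF w v c])
    moreover have "?w \<in> span (b ` {..<?n})" by (intro span_sum span_scale span_base imageI) auto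
    ultimately show ?thesis by simp
  qed
  then show ?thesis by (intro exI[of _ "b ` {..<?n}"]) auto
qed

lemma dim_eval_image:
  assumes N: "c1_manifold N" and c: "c \<in> charts_at N p" and W: "subspace W" "W \<subseteq> tangent_space N p"
  shows "dim ((\<lambda>v. v c) ` W) = dim W"
proof -
  obtain C where C: "finite C" "tangent_space N p \<subseteq> span C" using tangent_space_finite_span[OF N c] by blast
  have "{v \<in> W. v c = 0} = {0}"
    using tangent_space_eqI[OF _ subspace_0[OF subspace_tangent_space[OF N]] c] W subspace_0[OF W(1)]
    by (auto simp: zero_tvec)
  moreover have "dim {0 :: 'a tvec} = 0" using dim_eq_card[of "{}" "{0 :: 'a tvec}"] by (simp add: independent_empty)
  ultimately show ?thesis
    using dim_image_kernel[OF W(1) C(1), of "\<lambda>v. v c"] C W by (simp add: plus_tvec scale_tvec)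
qed

lemma subspace_eval_image:
  "subspace W \<Longrightarrow> subspace ((\<lambda>v. v c) ` W)" for W :: "'a tvec set"
  by (rule linear_subspace_image[OF linear_eval])

lemma differential_linear:
  assumes M: "c1_manifold M" and g: "g \<in> C1_maps M N" and w: "w \<in> topspace (mtop M)"
    and v: "v \<in> tangent_space M w" "v' \<in> tangent_space M w"
  shows "differential M N g w (v + v') = differential M N g w v + differential M N g w v'"
    and "differential M N g w (r *\<^sub>R v) = r *\<^sub>R differential M N g w v"
proof -
  obtain c where c: "c \<in> charts M" "w \<in> fst c" using charts_at_exists[OF M w] .
  then have ca: "c \<in> charts_at M w" by (simp add: charts_at_iff)
  note T = subspace_tangent_space[OF M, of w]
  show "differential M N g w (v + v') = differential M N g w v + differential M N g w v'"
  proof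
    fix d
    show "differential M N g w (v + v') d = (differential M N g w v + differential M N g w v') d"
    proof (cases "d \<in> charts_at N (g w)")
      case True
      then have "linear (rep_deriv M c d g w)"
        using linear_rep_derivative[OF g c] by (auto simp: charts_at_iff)
      then show ?thesis
        by (simp only: differential_chart[OF M g ca True] v subspace_add[OF T v] plus_tvec linear_add)
    qed (simp add: differential_def Let_def plus_tvec)
  qed
  show "differential M N g w (r *\<^sub>R v) = r *\<^sub>R differential M N g w v"
  proof
    fix d
    show "differential M N g w (r *\<^sub>R v) d = (r *\<^sub>R differential M N g w v) d"
    proof (cases "d \<in> charts_at N (g w)")
      case True
      then have "linear (rep_deriv M c d g w)"
        using linear_rep_derivative[OF g c] by (auto simp: charts_at_iff)
      then show ?thesis
        by (simp only: differential_chart[OF M g ca True] v subspace_scale[OF T v(1)] scale_tvec linear_cmul)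
    qed (simp add: differential_def Let_def scale_tvec)
  qed
qed

lemma leaf_tangent_subset: "leaf_tangent N P f S x \<subseteq> tangent_space N x"
  by (auto simp: leaf_tangent_def sub_tangent_space_def)

lemma subspace_leaf_tangent:
  assumes N: "c1_manifold N" and f: "f \<in> C1_maps N P" and S: "embedded_submanifold N S" and x: "x \<in> S"
  shows "subspace (leaf_tangent N P f S x)"
proof -
  have xt: "x \<in> topspace (mtop N)" using S x by (auto simp: embedded_submanifold_def)
  note s = subspace_sub_tangent_space[OF N S x]
  have sub: "v \<in> sub_tangent_space N S x \<Longrightarrow> v \<in> tangent_space N x" for v by (simp add: sub_tangent_space_def)
  note l = differential_linear[OF N f xt]
  have "differential N P f x 0 = 0"
    using l(2)[OF sub[OF subspace_0[OF s]] sub[OF subspace_0[OF s]], of 0] by simp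
  moreover have "differential N P f x (r *\<^sub>R v) = r *\<^sub>R differential N P f x v"
    if "v \<in> sub_tangent_space N S x" for r v by (rule l(2)[OF sub[OF that] sub[OF that]])
  ultimately show ?thesis
    using s l(1) sub unfolding leaf_tangent_def subspace_def by auto
qed

text \<open>Rank and nullity, as the dimension of the stratum and the rank of the map on it do not depend on the point.\<close>

lemma dim_leaf_tangent_constant:
  assumes N: "c1_manifold N" and f: "f \<in> C1_maps N P" and S: "embedded_submanifold N S"
    and r: "constant_rank_on N P f S"
  shows "\<exists>l. \<forall>x\<in>S. dim (leaf_tangent N P f S x) = l"
proof -
  obtain k where k: "\<And>p. p \<in> S \<Longrightarrow> \<exists>c. p \<in> fst c \<and> slice_chart N S k c" using embedded_slice[OF S] by blast
  obtain r where r: "\<And>x. x \<in> S \<Longrightarrow> dim (differential N P f x ` sub_tangent_space N S x) = r"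
    using r by (auto simp: constant_rank_on_def)
  have "dim (leaf_tangent N P f S x) = dim (Rn k) - r" if x: "x \<in> S" for x
  proof -
    have xt: "x \<in> topspace (mtop N)" using S x by (auto simp: embedded_submanifold_def)
    obtain c where c: "x \<in> fst c" "slice_chart N S k c" using k[OF x] by blast
    then have ca: "c \<in> charts_at N x" "k \<le> mdim N" by (auto simp: charts_at_iff slice_chart_def)
    let ?T = "sub_tangent_space N S x"
    have T: "subspace ?T" "?T \<subseteq> tangent_space N x"
      using subspace_sub_tangent_space[OF N S x] by (auto simp: sub_tangent_space_def)
    obtain C where C: "finite C" "tangent_space N x \<subseteq> span C" using tangent_space_finite_span[OF N ca(1)] by blast
    have "dim ?T = dim (differential N P f x ` ?T) + dim {v \<in> ?T. differential N P f x v = 0}"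
      by (rule dim_image_kernel[OF T(1) C(1)])
         (use differential_linear[OF N f xt] T C in blast)+
    then have "dim ?T = r + dim (leaf_tangent N P f S x)" using r[OF x] by (simp add: leaf_tangent_def)
    moreover have "(\<lambda>v. v c) ` ?T = Rn k"
    proof
      show "(\<lambda>v. v c) ` ?T \<subseteq> Rn k" by (auto simp: sub_tangent_space_slice[OF N c(2,1) x])
      show "Rn k \<subseteq> (\<lambda>v. v c) ` ?T"
      proof
        fix u assume u: "u \<in> Rn k"
        then obtain v where "v \<in> tangent_space N x" "v c = u"
          using tangent_space_lift[OF N ca(1)] Rn_mono[OF ca(2)] by blast
        then show "u \<in> (\<lambda>v. v c) ` ?T" using u by (auto simp: sub_tangent_space_slice[OF N c(2,1) x])
      qed
    qed
    ultimately show ?thesis using dim_eval_image[OF N ca(1) T] by simp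
  qed
  then show ?thesis by blast
qed

section \<open>Transversality in charts\<close>

lemma set_plus_image:
  assumes "linear h" shows "h ` (A + B) = h ` A + h ` B"
proof
  show "h ` (A + B) \<subseteq> h ` A + h ` B"
  proof
    fix y assume "y \<in> h ` (A + B)"
    then obtain a b where "a \<in> A" "b \<in> B" "y = h (a + b)" by (auto simp: set_plus_def)
    then show "y \<in> h ` A + h ` B" by (auto simp: linear_add[OF assms] intro!: set_plus_intro)
  qed
  show "h ` A + h ` B \<subseteq> h ` (A + B)"
  proof
    fix y assume "y \<in> h ` A + h ` B"
    then obtain a b where "a \<in> A" "b \<in> B" "y = h a + h b" by (auto simp: set_plus_def)
    then show "y \<in> h ` (A + B)" by (auto simp: linear_add[OF assms, symmetric] set_plus_intro)
  qed
qed

text \<open>Evaluation in a chart is injective on the tangent space, so the equality can be tested on coordinates.\<close>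

lemma transverse_chart_iff:
  assumes M: "c1_manifold M" and N: "c1_manifold N" and g: "g \<in> C1_maps M N"
    and c: "c \<in> charts M" "w \<in> fst c" and d: "d \<in> charts N" "g w \<in> fst d"
    and L: "L \<subseteq> tangent_space N (g w)"
  shows "differential M N g w ` tangent_space M w + L = tangent_space N (g w) \<longleftrightarrow>
    rep_deriv M c d g w ` Rn (mdim M) + (\<lambda>v. v d) ` L = Rn (mdim N)"
proof -
  let ?T = "tangent_space M w" and ?T' = "tangent_space N (g w)" and ?D = "differential M N g w"
  let ?F = "rep_deriv M c d g w"
  have ca: "c \<in> charts_at M w" "d \<in> charts_at N (g w)" using c d by (auto simp: charts_at_iff)
  have w: "w \<in> topspace (mtop M)" by (rule charts_topspace[OF c])
  have sub: "?D ` ?T + L \<subseteq> ?T'"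
    using differential_tangent_space[OF M N g w] L subspace_add[OF subspace_tangent_space[OF N, of "g w"]]
    by (auto simp: set_plus_def)
  have "(\<lambda>v. v d) ` (?D ` ?T) = ?F ` ((\<lambda>v. v c) ` ?T)"
    unfolding image_image by (rule image_cong[OF refl]) (rule differential_chart[OF M g ca])
  then have "(\<lambda>v. v d) ` (?D ` ?T + L) = ?F ` Rn (mdim M) + (\<lambda>v. v d) ` L"
    by (simp add: set_plus_image[OF linear_eval] eval_tangent_space[OF M ca(1)])
  moreover have "?D ` ?T + L = ?T' \<longleftrightarrow> (\<lambda>v. v d) ` (?D ` ?T + L) = (\<lambda>v. v d) ` ?T'"
    using inj_on_image_eq_iff[OF inj_on_eval[OF ca(2)] sub order_refl] by simp
  ultimately show ?thesis by (simp add: eval_tangent_space[OF N ca(2)])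
qed

lemma limitin_chart:
  assumes d: "d \<in> charts N" and q: "\<And>i::nat. q i \<in> fst d" "q0 \<in> fst d"
    and lim: "(\<lambda>i. snd d (q i)) \<longlonglongrightarrow> snd d q0"
  shows "limitin (mtop N) q q0 sequentially"
  unfolding limitin_def
proof (intro conjI allI impI)
  show "q0 \<in> topspace (mtop N)" by (rule charts_topspace[OF d q(2)])
  fix U assume U: "openin (mtop N) U \<and> q0 \<in> U"
  have "ropen (mdim N) (snd d ` (fst d \<inter> U))"
    by (rule charts_open_image[OF d]) (use U charts_open[OF d] in auto)
  then obtain S where S: "open S" "snd d ` (fst d \<inter> U) = Rn (mdim N) \<inter> S" by (auto simp: openin_open)
  then have "snd d q0 \<in> S" using U q(2) by blast
  then have "\<forall>\<^sub>F i in sequentially. snd d (q i) \<in> S" using topological_tendstoD[OF lim S(1)] by simp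
  then show "\<forall>\<^sub>F i in sequentially. q i \<in> U"
  proof eventually_elim
    case (elim i)
    then have "snd d (q i) \<in> snd d ` (fst d \<inter> U)" using S charts_Rn[OF d q(1)] by blast
    then obtain q' where "q' \<in> fst d" "q' \<in> U" "snd d q' = snd d (q i)" by auto
    then show ?case using charts_cinv[OF d] q(1) by metis
  qed
qed

lemma chart_limitin:
  assumes d: "d \<in> charts N" and q0: "q0 \<in> fst d"
    and lim: "limitin (mtop N) q q0 sequentially"
  shows "\<forall>\<^sub>F i in sequentially. q i \<in> fst d" and "(\<lambda>i. snd d (q i)) \<longlonglongrightarrow> snd d q0"
proof -
  show ev: "\<forall>\<^sub>F i in sequentially. q i \<in> fst d"
    using lim charts_open[OF d] q0 by (auto simp: limitin_def)
  show "(\<lambda>i. snd d (q i)) \<longlonglongrightarrow> snd d q0"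
  proof (rule topological_tendstoI)
    fix S assume S: "open S" "snd d q0 \<in> S"
    have "openin (mtop N) {p \<in> fst d. snd d p \<in> Rn (mdim N) \<inter> S}"
      by (rule is_chart_open_preimage[OF charts_is_chart[OF d]]) (use S in auto)
    moreover have "q0 \<in> {p \<in> fst d. snd d p \<in> Rn (mdim N) \<inter> S}" using q0 S charts_Rn[OF d q0] by auto
    ultimately have "\<forall>\<^sub>F i in sequentially. q i \<in> {p \<in> fst d. snd d p \<in> Rn (mdim N) \<inter> S}"
      using lim unfolding limitin_def by blast
    then show "\<forall>\<^sub>F i in sequentially. snd d (q i) \<in> S" by eventually_elim auto
  qed
qed

section \<open>Regularity implies openness\<close>

definition transverse_at ::
    "'m c1mfd \<Rightarrow> 'a c1mfd \<Rightarrow> 'b c1mfd \<Rightarrow> ('a \<Rightarrow> 'b) \<Rightarrow> 'a set \<Rightarrow> ('m \<Rightarrow> 'a) \<Rightarrow> 'm \<Rightarrow> bool" where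
  "transverse_at M N P f S g w \<longleftrightarrow>
     differential M N g w ` tangent_space M w + leaf_tangent N P f S (g w) = tangent_space N (g w)"

lemma transverse_iff:
  "transverse M N P f \<Sigma> g \<longleftrightarrow> (\<forall>w\<in>topspace (mtop M). \<forall>S\<in>\<Sigma>. g w \<in> S \<longrightarrow> transverse_at M N P f S g w)"
  by (simp add: transverse_def transverse_at_def)

lemma transverse_at_chart_iff:
  assumes M: "c1_manifold M" and N: "c1_manifold N" and g: "g \<in> C1_maps M N"
    and c: "c \<in> charts M" "w \<in> fst c" and d: "d \<in> charts N" "g w \<in> fst d"
  shows "transverse_at M N P f S g w \<longleftrightarrow>
    rep_deriv M c d g w ` Rn (mdim M) + (\<lambda>v. v d) ` leaf_tangent N P f S (g w) = Rn (mdim N)"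
  unfolding transverse_at_def by (rule transverse_chart_iff[OF assms leaf_tangent_subset])

definition C1_close ::
    "'m c1mfd \<Rightarrow> 'm chart \<Rightarrow> 'm set \<Rightarrow> 'a chart \<Rightarrow> real \<Rightarrow> ('m \<Rightarrow> 'a) \<Rightarrow> ('m \<Rightarrow> 'a) \<Rightarrow> bool" where
  "C1_close M c K d \<epsilon> g h \<longleftrightarrow> h ` K \<subseteq> fst d \<and>
     (\<forall>x \<in> snd c ` K.
        norm (local_rep c d h x - local_rep c d g x) < \<epsilon> \<and>
        (\<forall>v \<in> Rn (mdim M) \<inter> cball 0 1.
           norm (fderiv (mdim M) (local_rep c d h) x v - fderiv (mdim M) (local_rep c d g) x v) < \<epsilon>))"

lemma strong_nhd_eq:
  "strong_nhd M N g I c K d \<epsilon> = {h \<in> C1_maps M N. \<forall>i\<in>I. C1_close M (c i) (K i) (d i) (\<epsilon> i) g h}"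
  by (simp add: strong_nhd_def C1_close_def)

lemma C1_closeD:
  assumes "C1_close M c K d \<epsilon> g h" "w \<in> K"
  shows "h w \<in> fst d" "norm (local_rep c d h (snd c w) - local_rep c d g (snd c w)) < \<epsilon>"
    "v \<in> Rn (mdim M) \<Longrightarrow> norm v \<le> 1 \<Longrightarrow> norm (rep_deriv M c d h w v -
        rep_deriv M c d g w v) < \<epsilon>"
  using assms by (auto simp: C1_close_def)

text \<open>This is where regularity enters.  Along the sequence of points \<open>h i (w i)\<close> the tangent spaces of the leaves of \<open>X\<close>
  have a constant dimension, so a subsequence converges to some \<open>\<tau>\<close>.  Regularity puts the tangent space
  of the leaf of \<open>Y\<close> at the limit point into \<open>\<tau>\<close>; as \<open>g\<close> is transverse to that leaf, the image of its differential and
  \<open>\<tau>\<close> span the tangent space of \<open>N\<close>, and this is stable.\<close>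

lemma transverse_sequence:
  fixes h :: "nat \<Rightarrow> 'm \<Rightarrow> 'a"
  assumes M: "c1_manifold M" and N: "c1_manifold N" and f: "f \<in> C1_maps N P"
    and S: "\<And>S. S \<in> \<Sigma> \<Longrightarrow> embedded_submanifold N S \<and> constant_rank_on N P f S"
    and af: "af_regular N P f \<Sigma>"
    and g: "g \<in> C1_maps M N" "transverse M N P f \<Sigma> g"
    and c: "c \<in> charts M" and d: "d \<in> charts N"
    and X: "X \<in> \<Sigma>" and Y: "Y \<in> \<Sigma>"
    and w0: "w0 \<in> fst c" "g w0 \<in> fst d" "g w0 \<in> Y"
    and h: "\<And>i. h i \<in> C1_maps M N" "\<And>i. w i \<in> fst c" "\<And>i. h i (w i) \<in> fst d" "\<And>i. h i (w i) \<in> X"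
    and lim: "(\<lambda>i. snd d (h i (w i))) \<longlonglongrightarrow> snd d (g w0)"
    and dlim: "\<And>u. u \<in> Rn (mdim M) \<Longrightarrow> (\<lambda>i. rep_deriv M c d (h i) (w i) u)
      \<longlonglongrightarrow> rep_deriv M c d g w0 u"
  shows "\<exists>i. transverse_at M N P f X (h i) (w i)"
proof -
  let ?n = "mdim N" and ?m = "mdim M"
  let ?p = "\<lambda>i. h i (w i)"
  let ?L = "\<lambda>x. leaf_tangent N P f X x" and ?ev = "\<lambda>v::'a tvec. v d"
  let ?T = "\<lambda>i. ?ev ` ?L (?p i)"
  have SX: "embedded_submanifold N X" "constant_rank_on N P f X" using S X by auto
  have da: "d \<in> charts_at N (?p i)" for i using d h(3) by (simp add: charts_at_iff)
  have da0: "d \<in> charts_at N (g w0)" using d w0 by (simp add: charts_at_iff)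
  have sL: "subspace (?L (?p i))" for i by (rule subspace_leaf_tangent[OF N f SX(1) h(4)])
  have T: "subspace (?T i)" "?T i \<subseteq> Rn ?n" for i
    by (rule subspace_eval_image[OF sL], rule image_subsetI)
       (rule tangent_space_Rn[OF subsetD[OF leaf_tangent_subset] da])
  obtain l where l: "\<And>x. x \<in> X \<Longrightarrow> dim (?L x) = l" using dim_leaf_tangent_constant[OF N f SX] by blast
  have "dim (?T i) = l" for i
    using dim_eval_image[OF N da sL leaf_tangent_subset] l[OF h(4)] by simp
  then obtain r A where r: "strict_mono r" "subspace A" "A \<subseteq> Rn ?n" "grassmann_tendsto (\<lambda>i. ?T (r i)) A"
    using grassmann_compact[of ?T, OF T] by blast
  define \<tau> where "\<tau> = {v \<in> tangent_space N (g w0). v d \<in> A}"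
  have \<tau>: "subspace \<tau>" "\<tau> \<subseteq> tangent_space N (g w0)"
    using subspace_tangent_space[OF N, of "g w0"] r(2)
    unfolding \<tau>_def subspace_def by (auto simp: plus_tvec zero_tvec scale_tvec)
  have ev\<tau>: "?ev ` \<tau> = A"
  proof
    show "A \<subseteq> ?ev ` \<tau>"
    proof
      fix a assume a: "a \<in> A"
      then obtain v where "v \<in> tangent_space N (g w0)" "v d = a"
        using tangent_space_lift[OF N da0] r(3) by blast
      then show "a \<in> ?ev ` \<tau>" using a by (auto simp: \<tau>_def)
    qed
  qed (auto simp: \<tau>_def)
  have limr: "limitin (mtop N) (\<lambda>i. ?p (r i)) (g w0) sequentially"
    by (rule limitin_chart[OF d]) (use h w0 LIMSEQ_subseq_LIMSEQ[OF lim r(1)] in \<open>auto simp: o_def\<close>)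
  have gb: "grassmann_bundle_tendsto N (\<lambda>i. ?p (r i)) (\<lambda>i. ?L (?p (r i))) (g w0) \<tau>"
    unfolding grassmann_bundle_tendsto_def using limr \<tau> da0 r(4) ev\<tau> by auto
  have "g w0 \<in> mtop N closure_of X"
  proof (rule limitin_closedin[OF limr closedin_closure_of])
    have "X \<subseteq> mtop N closure_of X" using SX(1) closure_of_subset by (auto simp: embedded_submanifold_def)
    then show "\<forall>\<^sub>F i in sequentially. ?p (r i) \<in> mtop N closure_of X"
      using h(4) by (intro always_eventually) auto
  qed simp
  then have at: "af_regular_at N P f X Y (g w0)"
    using af X Y w0 unfolding af_regular_def af_regular_pair_def by blast
  have sub: "leaf_tangent N P f Y (g w0) \<subseteq> \<tau>"
    by (rule at[unfolded af_regular_at_def, rule_format, OF conjI[OF _ gb]]) (rule allI, rule h(4))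
  let ?F = "\<lambda>i. rep_deriv M c d (h i) (w i)"
  let ?D = "rep_deriv M c d g w0"
  have "?D ` Rn ?m + ?ev ` leaf_tangent N P f Y (g w0) = Rn ?n"
    by (rule transverse_at_chart_iff[OF M N g(1) c w0(1) d w0(2), THEN iffD1])
       (rule g(2)[unfolded transverse_iff, rule_format, OF charts_topspace[OF c w0(1)] Y w0(3)])
  moreover have "?ev ` leaf_tangent N P f Y (g w0) \<subseteq> A" using sub ev\<tau> by blast
  ultimately have tr: "Rn ?n \<subseteq> ?D ` Rn ?m + A"
    using set_plus_mono2[OF order_refl, of "?ev ` leaf_tangent N P f Y (g w0)" A "?D ` Rn ?m"] by simp
  have "\<forall>\<^sub>F i in sequentially. ?F (r i) ` Rn ?m + ?T (r i) = Rn ?n"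
  proof (rule transversality_stable[OF tr])
    show "(\<lambda>i. ?F (r i) u) \<longlonglongrightarrow> ?D u" if "u \<in> Rn ?m" for u
      using LIMSEQ_subseq_LIMSEQ[OF dlim[OF that] r(1)] by (simp add: o_def)
    show "linear (?F (r i))" for i by (rule linear_rep_derivative[OF h(1) c h(2) d h(3)])
    show "?F (r i) u \<in> Rn ?n" if "u \<in> Rn ?m" for i u by (rule rep_derivative_Rn[OF h(1) c h(2) d h(3) that])
    show "\<exists>w. (\<forall>i. w i \<in> ?T (r i)) \<and> w \<longlonglongrightarrow> t" if "t \<in> A" for t
      by (rule grassmann_tendsto_approx[OF r(4) T(1) r(2) that])
  qed (rule T)+
  then obtain i where "?F (r i) ` Rn ?m + ?T (r i) = Rn ?n"
    using eventually_happens'[OF sequentially_bot] by blast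
  then show ?thesis
    by (intro exI[of _ "r i"] transverse_at_chart_iff[OF M N h(1) c h(2) d h(3), THEN iffD2])
qed

lemma constant_subsequence:
  assumes "finite F" "\<forall>\<^sub>F i in sequentially. s i \<in> F"
  shows "\<exists>x\<in>F. \<exists>r. strict_mono r \<and> (\<forall>i::nat. s (r i) = x)"
proof -
  obtain k where k: "\<And>i. i \<ge> k \<Longrightarrow> s i \<in> F" using assms(2) by (auto simp: eventually_sequentially)
  have "\<exists>x\<in>F. infinite {i\<in>{k..}. s i = x}"
    by (rule pigeonhole_infinite_rel[of "{k..}" F "\<lambda>i x. s i = x"]) (use k assms(1) in \<open>auto simp: infinite_Ici\<close>)
  then obtain x where x: "x \<in> F" "infinite {i\<in>{k..}. s i = x}" by blast
  then obtain r :: "nat \<Rightarrow> nat" where "strict_mono r" "\<forall>i. r i \<in> {i\<in>{k..}. s i = x}"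
    using infinite_enumerate[OF x(2)] by auto
  then show ?thesis using x(1) by blast
qed

text \<open>Otherwise there are maps \<open>h i\<close> tending to \<open>g\<close> and points \<open>w i\<close> of \<open>K\<close> tending to some \<open>w0\<close> where \<open>h i\<close> fails to be
  transverse to a stratum \<open>s i\<close>.  The points \<open>h i (w i)\<close> of \<open>V\<close> converge to \<open>g w0\<close>, which lies in \<open>V\<close> as \<open>V\<close> is
  closed; by local finiteness one stratum occurs infinitely often among the \<open>s i\<close>.\<close>

lemma transverse_near_compact:
  assumes M: "c1_manifold M" and N: "c1_manifold N" and V: "closedin (mtop N) V"
    and \<Sigma>: "prestratification N V \<Sigma>" and f: "stratified_map N P \<Sigma> f"
    and af: "af_regular N P f \<Sigma>"
    and g: "g \<in> C1_maps M N" "transverse M N P f \<Sigma> g"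
    and c: "c \<in> charts M" and d: "d \<in> charts N"
    and K: "compactin (mtop M) K" "K \<subseteq> fst c" "g ` K \<subseteq> fst d"
  shows "\<exists>\<epsilon>>0. \<forall>h\<in>C1_maps M N. C1_close M c K d \<epsilon> g h \<longrightarrow>
      (\<forall>w\<in>K. \<forall>S\<in>\<Sigma>. h w \<in> S \<longrightarrow> transverse_at M N P f S h w)"
proof (rule ccontr)
  let ?n = "mdim N" and ?m = "mdim M"
  have fC: "f \<in> C1_maps N P" using f by (simp add: stratified_map_def)
  have S: "S \<in> \<Sigma> \<Longrightarrow> embedded_submanifold N S \<and> constant_rank_on N P f S" for S
    using \<Sigma> f by (auto simp: prestratification_def stratified_map_def)
  assume neg: "\<not> ?thesis"
  have "\<exists>h w S. h \<in> C1_maps M N \<and> C1_close M c K d (inverse (Suc i)) g h \<and> w \<in> K \<and> S \<in> \<Sigma> \<and>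
      h w \<in> S \<and> \<not> transverse_at M N P f S h w" for i :: nat
  proof -
    have "0 < inverse (real (Suc i))" by simp
    then show ?thesis using neg by blast
  qed
  then obtain h w s where h: "\<And>i. h i \<in> C1_maps M N" and near: "\<And>i. C1_close M c K d (inverse (Suc i)) g (h i)"
    and w: "\<And>i. w i \<in> K" and s: "\<And>i. s i \<in> \<Sigma>" "\<And>i. h i (w i) \<in> s i"
    and ntr: "\<And>i. \<not> transverse_at M N P f (s i) (h i) (w i)"
    by metis
  have "seq_compact (snd c ` K)"
    using compactin_chart_image[OF c K(1,2)] by (simp add: compact_eq_seq_compact_metric)
  then obtain x0 r where x0: "x0 \<in> snd c ` K" and r: "strict_mono r" "((\<lambda>i. snd c (w i)) \<circ> r) \<longlonglongrightarrow> x0"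
    by (rule seq_compactE[where f="\<lambda>i. snd c (w i)"]) (use w in auto)
  obtain w0 where w0: "w0 \<in> K" "x0 = snd c w0" using x0 by auto
  have wc: "w i \<in> fst c" and w0c: "w0 \<in> fst c" for i using w w0 K(2) by auto
  have gw: "g (w i) \<in> fst d" and gw0: "g w0 \<in> fst d" for i using w w0 K(3) by auto
  have hw: "h i (w i) \<in> fst d" for i using C1_closeD(1)[OF near w] .
  let ?U = "snd c ` {p \<in> fst c. g p \<in> fst d}"
  have C: "C1_on ?m ?U (local_rep c d g)" by (rule C1_maps_rep[OF g(1) c d])
  have UR: "?U \<subseteq> Rn ?m" using charts_Rn[OF c] by auto
  have xU: "snd c (w i) \<in> ?U" and x0U: "x0 \<in> ?U" for i using wc gw w0c gw0 w0 by auto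
  have xlim: "(\<lambda>i. snd c (w (r i))) \<longlonglongrightarrow> x0" using r(2) by (simp add: o_def)
  have small: "(\<lambda>i. inverse (real (Suc (r i)))) \<longlonglongrightarrow> 0"
    using LIMSEQ_subseq_LIMSEQ[OF LIMSEQ_inverse_real_of_nat r(1)] by (simp add: o_def)
  have lim: "(\<lambda>i. snd d (h (r i) (w (r i)))) \<longlonglongrightarrow> snd d (g w0)"
  proof -
    have "(\<lambda>i. local_rep c d g (snd c (w (r i)))) \<longlonglongrightarrow> local_rep c d g x0"
      by (rule continuous_on_tendsto_compose[OF C1_on_continuous_on[OF C UR] xlim x0U]) (use xU in auto)
    moreover have "(\<lambda>i. local_rep c d (h (r i)) (snd c (w (r i))) - local_rep c d g (snd c (w (r i)))) \<longlonglongrightarrow> 0"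
    proof (rule Lim_null_comparison[OF always_eventually small], rule allI)
      fix i
      show "norm (local_rep c d (h (r i)) (snd c (w (r i))) - local_rep c d g (snd c (w (r i)))) \<le> inverse (real (Suc (r i)))"
        by (rule less_imp_le[OF C1_closeD(2)[OF near w]])
    qed
    ultimately have "(\<lambda>i. local_rep c d (h (r i)) (snd c (w (r i)))) \<longlonglongrightarrow> local_rep c d g x0"
      using tendsto_add by fastforce
    then show ?thesis by (simp only: charts_local_rep[OF c wc] charts_local_rep[OF c w0c] w0(2))
  qed
  have dlim: "(\<lambda>i. rep_deriv M c d (h (r i)) (w (r i)) u) \<longlonglongrightarrow> rep_deriv M c d g w0 u"
    if u: "u \<in> Rn ?m" for u
  proof -
    let ?a = "\<lambda>i. rep_deriv M c d (h (r i)) (w (r i))"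
    let ?b = "\<lambda>i. rep_deriv M c d g (w (r i))"
    have "(\<lambda>i. ?b i u) \<longlonglongrightarrow> fderiv ?m (local_rep c d g) x0 u"
      by (rule tendsto_fderiv[OF C _ x0U xlim _ u tendsto_const]) (use xU u in simp_all)
    moreover have "(\<lambda>i. ?a i u - ?b i u) \<longlonglongrightarrow> 0"
    proof (rule Lim_null_comparison[OF always_eventually], rule allI)
      show "(\<lambda>i. norm u * inverse (real (Suc (r i)))) \<longlonglongrightarrow> 0"
        using tendsto_mult[OF tendsto_const small, of "norm u"] by simp
      fix i
      show "norm (?a i u - ?b i u) \<le> norm u * inverse (real (Suc (r i)))"
      proof (cases "u = 0")
        case True
        then show ?thesis
          using linear_0[OF linear_rep_derivative[OF h c wc d hw, of "r i"]]
            linear_0[OF linear_rep_derivative[OF g(1) c wc d gw, of "r i"]] by simp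
      next
        case False
        let ?v = "(1 / norm u) *\<^sub>R u"
        have "?v \<in> Rn ?m" "norm ?v \<le> 1" using u False by (auto intro: Rn_scale)
        then have "norm (?a i ?v - ?b i ?v) < inverse (real (Suc (r i)))"
          by (rule C1_closeD(3)[OF near w])
        moreover have "?a i ?v - ?b i ?v = (1 / norm u) *\<^sub>R (?a i u - ?b i u)"
          by (simp only: linear_cmul[OF linear_rep_derivative[OF h c wc d hw]]
              linear_cmul[OF linear_rep_derivative[OF g(1) c wc d gw]] scaleR_diff_right)
        ultimately have "norm (?a i u - ?b i u) / norm u < inverse (real (Suc (r i)))" by simp
        then have "norm (?a i u - ?b i u) < inverse (real (Suc (r i))) * norm u"
          using False pos_divide_less_eq[of "norm u"] by simp
        then show ?thesis by (simp only: mult.commute less_imp_le)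
      qed
    qed
    ultimately have "(\<lambda>i. ?a i u) \<longlonglongrightarrow> fderiv ?m (local_rep c d g) x0 u"
      using tendsto_add by fastforce
    then show ?thesis by (simp only: w0(2))
  qed
  have plim: "limitin (mtop N) (\<lambda>i. h (r i) (w (r i))) (g w0) sequentially"
    by (rule limitin_chart[OF d _ gw0 lim]) (rule hw)
  have "g w0 \<in> V"
  proof (rule limitin_closedin[OF plim V])
    show "\<forall>\<^sub>F i in sequentially. h (r i) (w (r i)) \<in> V"
      using s \<Sigma> by (intro always_eventually) (auto simp: prestratification_def)
  qed simp
  then obtain Y where Y: "Y \<in> \<Sigma>" "g w0 \<in> Y" using \<Sigma> by (auto simp: prestratification_def)
  obtain W where W: "openin (mtop N) W" "g w0 \<in> W" "finite {S \<in> \<Sigma>. S \<inter> W \<noteq> {}}"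
    using \<Sigma> \<open>g w0 \<in> V\<close> unfolding prestratification_def by blast
  have "\<forall>\<^sub>F i in sequentially. h (r i) (w (r i)) \<in> W" using plim W unfolding limitin_def by blast
  then have "\<forall>\<^sub>F i in sequentially. s (r i) \<in> {S \<in> \<Sigma>. S \<inter> W \<noteq> {}}"
    by eventually_elim (use s in blast)
  then obtain X and q :: "nat \<Rightarrow> nat" where X: "X \<in> \<Sigma>" and q: "strict_mono q" "\<And>i. s (r (q i)) = X"
    using constant_subsequence[OF W(3), of "\<lambda>i. s (r i)"] by auto
  have "\<exists>i. transverse_at M N P f X (h (r (q i))) (w (r (q i)))"
  proof (rule transverse_sequence[where h="\<lambda>i. h (r (q i))" and w="\<lambda>i. w (r (q i))",
        OF M N fC S af g c d X Y(1) w0c gw0 Y(2) h wc hw])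
    show "h (r (q i)) (w (r (q i))) \<in> X" for i using s(2)[of "r (q i)"] q(2) by simp
    show "(\<lambda>i. snd d (h (r (q i)) (w (r (q i))))) \<longlonglongrightarrow> snd d (g w0)"
      using LIMSEQ_subseq_LIMSEQ[OF lim q(1)] by (simp add: o_def)
    show "(\<lambda>i. rep_deriv M c d (h (r (q i))) (w (r (q i))) u)
        \<longlonglongrightarrow> rep_deriv M c d g w0 u" if "u \<in> Rn ?m" for u
      using LIMSEQ_subseq_LIMSEQ[OF dlim[OF that] q(1)] by (simp add: o_def)
  qed
  then obtain i where "transverse_at M N P f X (h (r (q i))) (w (r (q i)))" by blast
  then show False using ntr[of "r (q i)"] q(2)[of i] by simp
qed

subsection \<open>Locally finite families of charts\<close>

lemma compact_neighbourhood:
  assumes M: "c1_manifold M" and Q: "openin (mtop M) Q" "p \<in> Q"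
  shows "\<exists>U K. openin (mtop M) U \<and> compactin (mtop M) K \<and> p \<in> U \<and> U \<subseteq> K \<and> K \<subseteq> Q"
proof -
  let ?m = "mdim M"
  have "p \<in> topspace (mtop M)" using Q openin_subset by blast
  then obtain c where c: "c \<in> charts M" "p \<in> fst c" by (rule charts_at_exists[OF M])
  have "ropen ?m (snd c ` (fst c \<inter> Q))"
    by (rule charts_open_image[OF c(1)]) (use Q charts_open[OF c(1)] in auto)
  moreover have "snd c p \<in> snd c ` (fst c \<inter> Q)" using c Q by auto
  ultimately obtain e where e: "e > 0" "Rn ?m \<inter> cball (snd c p) e \<subseteq> snd c ` (fst c \<inter> Q)"
    unfolding openin_contains_cball by (metis Int_commute)
  define K where "K = {q \<in> fst c. snd c q \<in> cball (snd c p) e}"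
  define U where "U = {q \<in> fst c. snd c q \<in> Rn ?m \<inter> ball (snd c p) e}"
  have "openin (mtop M) U"
    unfolding U_def by (rule is_chart_open_preimage[OF charts_is_chart[OF c(1)]]) auto
  moreover have "p \<in> U" "U \<subseteq> K" using c e charts_Rn[OF c] by (auto simp: U_def K_def)
  moreover have "K \<subseteq> Q"
  proof
    fix q assume q: "q \<in> K"
    then have "snd c q \<in> snd c ` (fst c \<inter> Q)" using e(2) charts_Rn[OF c(1)] by (auto simp: K_def)
    then obtain q' where "q' \<in> fst c" "q' \<in> Q" "snd c q' = snd c q" by auto
    then show "q \<in> Q" using charts_cinv[OF c(1)] q unfolding K_def by (metis (mono_tags) mem_Collect_eq)
  qed
  moreover have "compactin (mtop M) K"
    unfolding K_def by (rule compactin_chart_cball[OF c(1)]) (use e(2) in blast)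
  ultimately show ?thesis by blast
qed

text \<open>Finite unions of a countable cover by relatively compact open sets; the subsequence \<open>e\<close> skips ahead
  until the next union contains the compact sets used so far.\<close>

lemma compact_exhaustion:
  assumes M: "c1_manifold M"
  shows "\<exists>U C :: nat \<Rightarrow> _. U 0 = {} \<and> C 0 = {} \<and>
    (\<forall>n. openin (mtop M) (U n) \<and> compactin (mtop M) (C n) \<and> U n \<subseteq> C n \<and> C n \<subseteq> U (Suc n)) \<and>
    (\<Union>n. U n) = topspace (mtop M)"
proof -
  let ?X = "mtop M"
  define B where "B = {U. openin ?X U \<and> (\<exists>K. compactin ?X K \<and> U \<subseteq> K)}"
  have UB: "\<Union>B = topspace ?X"
  proof
    show "\<Union>B \<subseteq> topspace ?X" using openin_subset by (fastforce simp: B_def)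
    show "topspace ?X \<subseteq> \<Union>B"
    proof
      fix p assume "p \<in> topspace ?X"
      then obtain U K where "openin ?X U" "compactin ?X K" "p \<in> U" "U \<subseteq> K"
        using compact_neighbourhood[OF M openin_topspace, of p] by auto
      then show "p \<in> \<Union>B" unfolding B_def by blast
    qed
  qed
  have "Lindelof_space ?X" using M by (intro second_countable_imp_Lindelof_space) (simp add: c1_manifold_def)
  then obtain A where A: "countable A" "A \<subseteq> B" "\<Union>A = topspace ?X"
    using UB unfolding Lindelof_space_def by (elim allE[of _ B]) (auto simp: B_def)
  define W where "W = from_nat_into (insert {} A)"
  have "countable (insert {} A)" using A by simp
  then have rW: "range W = insert {} A" unfolding W_def by (rule range_from_nat_into[rotated]) simp
  have "{} \<in> B" by (auto simp: B_def intro!: exI[of _ "{}"])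
  then have "insert {} A \<subseteq> B" using A(2) by simp
  then have "W j \<in> B" for j using rangeI[of W j] unfolding rW by (rule subsetD)
  then have "\<forall>j. openin ?X (W j) \<and> (\<exists>K. compactin ?X K \<and> W j \<subseteq> K)" by (simp add: B_def)
  then obtain L where W: "\<And>j. openin ?X (W j)" and L: "\<And>j. compactin ?X (L j)" "\<And>j. W j \<subseteq> L j"
    unfolding all_conj_distrib by (auto dest!: choice)
  have UW: "(\<Union>j. W j) = topspace ?X" unfolding rW using A(3) by simp
  let ?U = "\<lambda>m. \<Union>j<m. W j" and ?C = "\<lambda>m. \<Union>j<m. L j"
  have C: "compactin ?X (?C m)" for m by (rule compactin_Union) (use L in auto)
  have step: "\<exists>m'. ?C m \<subseteq> ?U m'" for m :: nat
  proof -
    have "?C m \<subseteq> \<Union>(range W)" using compactin_subset_topspace[OF C] UW by simp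
    moreover have "openin ?X V" if "V \<in> range W" for V using that W by auto
    ultimately obtain F where F: "finite F" "F \<subseteq> range W" "?C m \<subseteq> \<Union>F"
      using compactinD[OF C[of m], of "range W"] by metis
    then obtain J where J: "finite J" "F = W ` J" by (meson finite_subset_image)
    have "J \<subseteq> {..<Suc (Max J)}" using J(1) by (auto simp: less_Suc_eq_le)
    then have "\<Union>F \<subseteq> ?U (Suc (Max J))" unfolding J(2) by blast
    with F(3) have "?C m \<subseteq> ?U (Suc (Max J))" by (rule subset_trans)
    then show ?thesis by (rule exI)
  qed
  have "\<exists>e. \<forall>n. (n = 0 \<longrightarrow> e n = 0) \<and> (?C (e n) \<subseteq> ?U (e (Suc n)) \<and> e n < e (Suc n))"
  proof (rule dependent_nat_choice)
    fix x n :: nat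
    obtain m' where m': "?C x \<subseteq> ?U m'" using step[of x] by (rule exE)
    have "?U m' \<subseteq> ?U (max m' (Suc x))" by (intro UN_mono) auto
    then show "\<exists>y. (Suc n = 0 \<longrightarrow> y = 0) \<and> ?C x \<subseteq> ?U y \<and> x < y"
      using subset_trans[OF m'] by (intro exI[of _ "max m' (Suc x)"]) simp
  qed auto
  then obtain e where "\<forall>n. (n = 0 \<longrightarrow> e n = 0) \<and> (?C (e n) \<subseteq> ?U (e (Suc n)) \<and> e n < e (Suc n))" by (rule exE)
  then have e: "e 0 = 0" "\<And>n. ?C (e n) \<subseteq> ?U (e (Suc n))" "\<And>n. e n < e (Suc n)" by simp_all
  have sm: "strict_mono e" using e(3) by (simp add: strict_mono_Suc_iff)
  have "(\<Union>n. ?U (e n)) = topspace ?X"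
  proof
    show "(\<Union>n. ?U (e n)) \<subseteq> topspace ?X" using UW by blast
    show "topspace ?X \<subseteq> (\<Union>n. ?U (e n))"
    proof
      fix p assume "p \<in> topspace ?X"
      then obtain j where "p \<in> W j" using UW by blast
      moreover have "j < e (Suc j)" using strict_mono_imp_increasing[OF sm, of "Suc j"] by simp
      ultimately show "p \<in> (\<Union>n. ?U (e n))" by blast
    qed
  qed
  moreover have "openin ?X (?U (e n))" for n using W by blast
  moreover have "?U (e n) \<subseteq> ?C (e n)" for n using L(2) by (intro UN_mono) auto
  ultimately show ?thesis
    using e C by (intro exI[of _ "\<lambda>n. ?U (e n)"] exI[of _ "\<lambda>n. ?C (e n)"]) simp
qed

text \<open>Each compact annulus \<open>A n = C (Suc n) - U n\<close> is covered by finitely many compact sets in charts with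
  domains inside the slightly larger open annulus \<open>R n\<close>.  As \<open>R n\<close> is disjoint from \<open>U m\<close> for \<open>n > m\<close>, the charts
  are locally finite.\<close>

lemma locally_finite_chart_cover:
  assumes M: "c1_manifold M" and N: "c1_manifold N" and g: "g \<in> C1_maps M N"
  shows "\<exists>(I :: nat set) c K d.
    (\<forall>i\<in>I. c i \<in> charts M \<and> compactin (mtop M) (K i) \<and> K i \<subseteq> fst (c i) \<and> d i \<in> charts N \<and> g ` K i \<subseteq> fst (d i)) \<and>
    (\<forall>p\<in>topspace (mtop M). \<exists>W. openin (mtop M) W \<and> p \<in> W \<and> finite {i\<in>I. fst (c i) \<inter> W \<noteq> {}}) \<and>
    topspace (mtop M) \<subseteq> (\<Union>i\<in>I. K i)"
proof -
  let ?X = "mtop M"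
  obtain U C where *: "U 0 = {} \<and> C 0 = {} \<and>
    (\<forall>n::nat. openin ?X (U n) \<and> compactin ?X (C n) \<and> U n \<subseteq> C n \<and> C n \<subseteq> U (Suc n)) \<and>
    (\<Union>n. U n) = topspace ?X"
    using compact_exhaustion[OF M] by (elim exE)
  have U0: "U 0 = {}" and C0: "C 0 = {}"
    and UC: "\<And>n. openin ?X (U n)" "\<And>n. compactin ?X (C n)" "\<And>n. U n \<subseteq> C n" "\<And>n. C n \<subseteq> U (Suc n)"
    and cov: "(\<Union>n. U n) = topspace ?X"
    using * by (elim conjE, simp)+
  have Umono: "U m \<subseteq> U n" if "m \<le> n" for m n
    by (rule lift_Suc_mono_le[OF _ that]) (rule subset_trans[OF UC(3,4)])
  \<comment> \<open>for \<open>n = 0\<close> the truncated difference is harmless because \<open>C 0\<close> is empty\<close>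
  define R where "R n = U (Suc (Suc n)) - C (n - 1)" for n
  define A where "A n = C (Suc n) - U n" for n
  have R: "openin ?X (R n)" for n
    unfolding R_def using M UC by (intro openin_diff compactin_imp_closedin) (auto simp: c1_manifold_def)
  have A: "compactin ?X (A n)" for n
  proof -
    have "closedin ?X (topspace ?X - U n)" using UC by auto
    then have "compactin ?X ((topspace ?X - U n) \<inter> C (Suc n))" by (rule closed_Int_compactin[OF _ UC(2)])
    moreover have "(topspace ?X - U n) \<inter> C (Suc n) = A n"
      using compactin_subset_topspace[OF UC(2), of "Suc n"] by (auto simp: A_def)
    ultimately show ?thesis by simp
  qed
  have AR: "A n \<subseteq> R n" for n
  proof (cases n)
    case 0 then show ?thesis using UC(4)[of "Suc 0"] C0 by (auto simp: A_def R_def)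
  next
    case (Suc k) then show ?thesis using UC(4)[of k] UC(4)[of "Suc n"] by (auto simp: A_def R_def)
  qed
  define good where "good n t \<longleftrightarrow> fst t \<in> charts M \<and> compactin ?X (fst (snd t)) \<and> fst (snd t) \<subseteq> fst (fst t) \<and>
      fst (snd (snd t)) \<in> charts N \<and> g ` fst (snd t) \<subseteq> fst (fst (snd (snd t))) \<and> fst (fst t) \<subseteq> R n \<and>
      openin ?X (snd (snd (snd t))) \<and> snd (snd (snd t)) \<subseteq> fst (snd t)"
    for n :: nat and t :: "'a chart \<times> 'a set \<times> 'b chart \<times> 'a set"
  have "\<exists>F. finite F \<and> (\<forall>t\<in>F. good n t) \<and> A n \<subseteq> (\<Union>t\<in>F. fst (snd t))" for n
  proof -
    have "\<exists>t. good n t \<and> p \<in> snd (snd (snd t))" if p: "p \<in> A n" for p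
    proof -
      have pR: "p \<in> R n" and pt: "p \<in> topspace ?X" using p AR openin_subset[OF R] by blast+
      obtain b where b: "b \<in> charts M" "p \<in> fst b" using charts_at_exists[OF M pt] .
      have "g p \<in> topspace (mtop N)"
        using continuous_map_image_subset_topspace[OF C1_maps_continuous[OF g]] pt by blast
      then obtain d where d: "d \<in> charts N" "g p \<in> fst d" by (rule charts_at_exists[OF N])
      let ?Q = "{q \<in> fst b. g q \<in> fst d} \<inter> R n"
      have "openin ?X ?Q" using C1_maps_preimage_open[OF g b(1) d(1)] R by blast
      moreover have "p \<in> ?Q" using b d pR by auto
      ultimately obtain O' K where O': "openin ?X O'" "compactin ?X K" "p \<in> O'" "O' \<subseteq> K" "K \<subseteq> ?Q"
        using compact_neighbourhood[OF M, of ?Q p] by auto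
      have "(fst b \<inter> R n, snd b) \<in> charts M" by (rule charts_restrict[OF M b(1) R])
      then have "good n ((fst b \<inter> R n, snd b), K, d, O')" using O' d(1) by (auto simp: good_def)
      then show ?thesis using O'(3) by (intro exI[of _ "((fst b \<inter> R n, snd b), K, d, O')"]) simp
    qed
    then have "\<forall>p. \<exists>t. p \<in> A n \<longrightarrow> good n t \<and> p \<in> snd (snd (snd t))" by blast
    then obtain t where "\<forall>p. p \<in> A n \<longrightarrow> good n (t p) \<and> p \<in> snd (snd (snd (t p)))" by (rule choice[THEN exE])
    then have t: "\<And>p. p \<in> A n \<Longrightarrow> good n (t p) \<and> p \<in> snd (snd (snd (t p)))" by blast
    let ?V = "(\<lambda>p. snd (snd (snd (t p)))) ` A n"
    have "A n \<subseteq> \<Union>?V" using t by blast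
    moreover have "openin ?X V" if "V \<in> ?V" for V
      using that t by (auto simp: good_def)
    ultimately obtain \<F> where \<F>: "finite \<F>" "\<F> \<subseteq> ?V" "A n \<subseteq> \<Union>\<F>"
      using compactinD[OF A[of n], of ?V] by metis
    then obtain J where J: "finite J" "J \<subseteq> A n" "\<F> = (\<lambda>p. snd (snd (snd (t p)))) ` J"
      by (meson finite_subset_image)
    have "A n \<subseteq> (\<Union>u\<in>t ` J. fst (snd u))"
    proof
      fix q assume "q \<in> A n"
      then obtain p where p: "p \<in> J" "q \<in> snd (snd (snd (t p)))" using \<F>(3) J(3) by auto
      then have "snd (snd (snd (t p))) \<subseteq> fst (snd (t p))"
        using t[of p] J(2) by (auto simp: good_def)
      then show "q \<in> (\<Union>u\<in>t ` J. fst (snd u))" using p by auto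
    qed
    then show ?thesis using J t by (intro exI[of _ "t ` J"]) auto
  qed
  then have "\<forall>n. \<exists>F. finite F \<and> (\<forall>t\<in>F. good n t) \<and> A n \<subseteq> (\<Union>t\<in>F. fst (snd t))" by blast
  then obtain F where "\<forall>n. finite (F n) \<and> (\<forall>t\<in>F n. good n t) \<and> A n \<subseteq> (\<Union>t\<in>F n. fst (snd t))"
    by (rule choice[THEN exE])
  then have F: "\<And>n. finite (F n)" "\<And>n t. t \<in> F n \<Longrightarrow> good n t" "\<And>n. A n \<subseteq> (\<Union>t\<in>F n. fst (snd t))"
    by blast+
  \<comment> \<open>the pairs of a level and a member of its family, enumerated by natural numbers\<close>
  define T where "T = (SIGMA n:UNIV. F n)"
  have cT: "countable T" unfolding T_def using F(1) by (intro countable_SIGMA) (auto simp: countable_finite)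
  define I where "I = to_nat_on T ` T"
  define tt where "tt i = from_nat_into T i" for i
  have tt: "tt (to_nat_on T x) = x" if "x \<in> T" for x using cT that by (simp add: tt_def)
  define c where "c i = fst (snd (tt i))" for i
  define K where "K i = fst (snd (snd (tt i)))" for i
  define d where "d i = fst (snd (snd (snd (tt i))))" for i
  have I: "\<exists>n. tt i \<in> T \<and> n = fst (tt i) \<and> good n (snd (tt i))" if "i \<in> I" for i
    using that tt F(2) by (auto simp: I_def T_def)
  show ?thesis
  proof (intro exI[of _ I] exI[of _ c] exI[of _ K] exI[of _ d] conjI ballI)
    fix i assume "i \<in> I"
    then obtain n where "good n (snd (tt i))" using I by blast
    then show "c i \<in> charts M" "compactin ?X (K i)" "K i \<subseteq> fst (c i)" "d i \<in> charts N" "g ` K i \<subseteq> fst (d i)"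
      by (auto simp: good_def c_def K_def d_def)
  next
    fix p assume "p \<in> topspace ?X"
    then obtain m where m: "p \<in> U m" using cov by blast
    have "{i\<in>I. fst (c i) \<inter> U m \<noteq> {}} \<subseteq> to_nat_on T ` (SIGMA n:{..m}. F n)"
    proof
      fix i assume i: "i \<in> {i\<in>I. fst (c i) \<inter> U m \<noteq> {}}"
      then have "i \<in> to_nat_on T ` T" by (simp add: I_def)
      then obtain x where x: "x \<in> T" "i = to_nat_on T x" by blast
      obtain n t where nt: "x = (n, t)" "t \<in> F n" using x(1) by (auto simp: T_def)
      have "c i = fst t" using x tt nt by (simp add: c_def)
      then have "fst (c i) \<subseteq> R n" using F(2)[OF nt(2)] by (auto simp: good_def)
      then have "R n \<inter> U m \<noteq> {}" using i by blast
      then have "\<not> m \<le> n - 1" using Umono[of m "n - 1"] UC(3)[of "n - 1"] by (auto simp: R_def)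
      then show "i \<in> to_nat_on T ` (SIGMA n:{..m}. F n)" using nt x(2) by auto
    qed
    moreover have "finite (to_nat_on T ` (SIGMA n:{..m}. F n))" using F(1) by (intro finite_imageI finite_SigmaI) auto
    ultimately have "finite {i\<in>I. fst (c i) \<inter> U m \<noteq> {}}" by (rule finite_subset)
    then show "\<exists>W. openin ?X W \<and> p \<in> W \<and> finite {i\<in>I. fst (c i) \<inter> W \<noteq> {}}" using m UC(1) by blast
  next
    show "topspace ?X \<subseteq> (\<Union>i\<in>I. K i)"
    proof
      fix p assume "p \<in> topspace ?X"
      then obtain m where "p \<in> U m" using cov by blast
      define n where "n = (LEAST n. p \<in> U n)"
      have n: "p \<in> U n" "\<And>k. k < n \<Longrightarrow> p \<notin> U k"
        unfolding n_def using \<open>p \<in> U m\<close> LeastI not_less_Least by metis+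
      then obtain k where k: "n = Suc k" using U0 by (cases n) auto
      then have "p \<in> A k" using n(1) n(2)[of k] UC(3)[of n] by (auto simp: A_def)
      then obtain t where t: "t \<in> F k" "p \<in> fst (snd t)" using F(3) by blast
      then have "(k, t) \<in> T" by (simp add: T_def)
      then have "to_nat_on T (k, t) \<in> I" "K (to_nat_on T (k, t)) = fst (snd t)"
        using tt by (auto simp: I_def K_def)
      then show "p \<in> (\<Union>i\<in>I. K i)" using t(2) by blast
    qed
  qed
qed

theorem af_regular_imp_open:
  assumes M: "c1_manifold M" and N: "c1_manifold N" and V: "closedin (mtop N) V"
    and \<Sigma>: "prestratification N V \<Sigma>" and f: "stratified_map N P \<Sigma> f"
    and af: "af_regular N P f \<Sigma>"
  shows "openin (strong_topology M N) {g \<in> C1_maps M N. transverse M N P f \<Sigma> g}"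
proof (subst openin_subopen, intro ballI)
  let ?S = "{g \<in> C1_maps M N. transverse M N P f \<Sigma> g}"
  fix g assume "g \<in> ?S"
  then have g: "g \<in> C1_maps M N" "transverse M N P f \<Sigma> g" by auto
  obtain I :: "nat set" and c K d where cover:
    "\<forall>i\<in>I. c i \<in> charts M \<and> compactin (mtop M) (K i) \<and> K i \<subseteq> fst (c i) \<and> d i \<in> charts N \<and> g ` K i \<subseteq> fst (d i)"
    "\<forall>p\<in>topspace (mtop M). \<exists>W. openin (mtop M) W \<and> p \<in> W \<and> finite {i\<in>I. fst (c i) \<inter> W \<noteq> {}}"
    "topspace (mtop M) \<subseteq> (\<Union>i\<in>I. K i)"
    using locally_finite_chart_cover[OF M N g(1)] by (elim exE conjE) (rule that)
  have "\<forall>i. \<exists>e. i \<in> I \<longrightarrow> 0 < e \<and> (\<forall>h\<in>C1_maps M N. C1_close M (c i) (K i) (d i) e g h \<longrightarrow>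
      (\<forall>w\<in>K i. \<forall>S\<in>\<Sigma>. h w \<in> S \<longrightarrow> transverse_at M N P f S h w))"
  proof
    fix i
    show "\<exists>e. i \<in> I \<longrightarrow> 0 < e \<and> (\<forall>h\<in>C1_maps M N. C1_close M (c i) (K i) (d i) e g h \<longrightarrow>
      (\<forall>w\<in>K i. \<forall>S\<in>\<Sigma>. h w \<in> S \<longrightarrow> transverse_at M N P f S h w))"
    proof (cases "i \<in> I")
      case True
      note ci = bspec[OF cover(1) True]
      have "\<exists>e>0. \<forall>h\<in>C1_maps M N. C1_close M (c i) (K i) (d i) e g h \<longrightarrow>
          (\<forall>w\<in>K i. \<forall>S\<in>\<Sigma>. h w \<in> S \<longrightarrow> transverse_at M N P f S h w)"
        by (rule transverse_near_compact[OF M N V \<Sigma> f af g]) (use ci in simp_all)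
      then show ?thesis by (elim exE) (intro exI impI)
    qed simp
  qed
  then obtain e where "\<forall>i. i \<in> I \<longrightarrow> 0 < e i \<and> (\<forall>h\<in>C1_maps M N. C1_close M (c i) (K i) (d i) (e i) g h \<longrightarrow>
      (\<forall>w\<in>K i. \<forall>S\<in>\<Sigma>. h w \<in> S \<longrightarrow> transverse_at M N P f S h w))"
    by (rule choice[THEN exE])
  then have e: "\<And>i. i \<in> I \<Longrightarrow> 0 < e i" "\<And>i h w S. i \<in> I \<Longrightarrow> h \<in> C1_maps M N \<Longrightarrow>
      C1_close M (c i) (K i) (d i) (e i) g h \<Longrightarrow> w \<in> K i \<Longrightarrow> S \<in> \<Sigma> \<Longrightarrow> h w \<in> S \<Longrightarrow> transverse_at M N P f S h w"
    by blast+
  let ?T = "strong_nhd M N g I c K d e"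
  have "strong_data M N g I c K d e"
    using cover(1,2) e(1) g(1) by (simp add: strong_data_def)
  then have "openin (strong_topology M N) ?T"
    unfolding strong_topology_def by (intro topology_generated_by_Basis) blast
  moreover have "g \<in> ?T"
    using g(1) cover(1) e(1) by (auto simp: strong_nhd_eq C1_close_def)
  moreover have "?T \<subseteq> ?S"
  proof
    fix h assume h: "h \<in> ?T"
    then have hC: "h \<in> C1_maps M N" by (simp add: strong_nhd_eq)
    have "transverse_at M N P f S h w" if w: "w \<in> topspace (mtop M)" and S: "S \<in> \<Sigma>" "h w \<in> S" for w S
    proof -
      obtain i where i: "i \<in> I" "w \<in> K i" using w cover(3) by blast
      show ?thesis by (rule e(2)[OF i(1) hC _ i(2) S]) (use h i(1) in \<open>simp add: strong_nhd_eq\<close>)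
    qed
    then show "h \<in> ?S" using hC by (simp add: transverse_iff)
  qed
  ultimately show "\<exists>T. openin (strong_topology M N) T \<and> g \<in> T \<and> T \<subseteq> ?S" by blast
qed

section \<open>A map pinched at one point\<close>

lemma max_square_derivative: "((\<lambda>t::real. (max 0 t)\<^sup>2) has_real_derivative 2 * max 0 t) (at t)"
proof (cases t "0::real" rule: linorder_cases)
  case less
  have "((\<lambda>t::real. 0) has_real_derivative 2 * max 0 t) (at t)" using less by simp
  then show ?thesis
    by (rule has_field_derivative_transform_within_open[of _ _ _ "{..<0}"]) (use less in auto)
next
  case equal
  have "((\<lambda>y. (max 0 y)\<^sup>2 / y) \<longlongrightarrow> (0::real)) (at 0)"
  proof (rule Lim_null_comparison[OF always_eventually])
    show "((\<lambda>y::real. \<bar>y\<bar>) \<longlongrightarrow> 0) (at 0)" by (intro tendsto_eq_intros) auto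
    have "norm ((max 0 y)\<^sup>2 / y) \<le> \<bar>y\<bar>" for y :: real
      by (cases "y \<le> 0") (auto simp: max_def power2_eq_square)
    then show "\<forall>y::real. norm ((max 0 y)\<^sup>2 / y) \<le> \<bar>y\<bar>" by blast
  qed
  then show ?thesis unfolding has_field_derivative_iff equal by simp
next
  case greater
  have "((\<lambda>t::real. t\<^sup>2) has_real_derivative 2 * max 0 t) (at t)"
    using greater by (auto intro!: derivative_eq_intros)
  then show ?thesis
    by (rule has_field_derivative_transform_within_open[of _ _ _ "{0<..}"]) (use greater in auto)
qed

text \<open>Here \<open>lam\<close> is a functional with \<open>lam v = 1\<close>, and every \<open>x\<close> is decomposed into \<open>x - lam x *\<^sub>R v\<close> in its kernel and a
  multiple of \<open>v\<close>.  The function \<open>q\<close> is the sum of the squares of the coordinates of the two components, \<open>psi\<close> is a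
  C1 bump function of \<open>q\<close> with value 1 at the origin and support \<open>q \<le> \<rho>\<close>, and primes denote derivatives.

  For \<open>a = 0\<close> and \<open>B u = - (lam u *\<^sub>R v)\<close> the map \<open>pinch a B\<close> has as derivative at \<open>z0\<close> the projection to the kernel
  of \<open>lam\<close> along \<open>v\<close>, while it is a submersion everywhere else and the identity off a ball.  The other
  values of \<open>a\<close> and \<open>B\<close> give perturbations of it with prescribed value \<open>z0 + a\<close> and derivative \<open>u + B u\<close> at \<open>z0\<close>.\<close>

locale pinch_map =
  fixes n :: nat and z0 v :: rseq and lam :: "rseq \<Rightarrow> real" and \<rho> :: real
  assumes z0: "z0 \<in> Rn n" and v: "v \<in> Rn n" and lam: "bounded_linear lam" and lamv: "lam v = 1" and rho: "0 < \<rho>"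
begin

definition "q x = (\<Sum>i<n. (apply_bcontfun (x - lam x *\<^sub>R v) i)\<^sup>2) + (lam x)\<^sup>2"
definition "q' x u = (\<Sum>i<n. 2 * apply_bcontfun (x - lam x *\<^sub>R v) i * apply_bcontfun (u - lam u *\<^sub>R v) i) + 2 * lam x * lam u"
definition "psi x = (max 0 (1 - q x / \<rho>))\<^sup>2"
definition "psi' x u = - (q' x u / \<rho>) * (2 * max 0 (1 - q x / \<rho>))"
definition "pinch a B x = x + psi (x - z0) *\<^sub>R (a + B (x - z0))"
definition "pinch' a B x u = u + (psi (x - z0) *\<^sub>R B u + psi' (x - z0) u *\<^sub>R (a + B (x - z0)))"

lemmas lam_linear = bounded_linear.linear[OF lam]

lemma q_derivative: "(q has_derivative q' x) (at x within X)"
proof -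
  have h: "((\<lambda>x. apply_bcontfun (x - lam x *\<^sub>R v) i) has_derivative (\<lambda>u. apply_bcontfun (u - lam u *\<^sub>R v) i)) (at x within X)" for i
    by (intro bounded_linear_imp_has_derivative bounded_linear_compose[OF bounded_linear_coord] bounded_linear_sub
        bounded_linear_scaleR_const lam bounded_linear_ident)
  have l: "(lam has_derivative lam) (at x within X)" by (rule bounded_linear_imp_has_derivative[OF lam])
  from has_derivative_add[OF has_derivative_sum[where I="{..<n}", OF has_derivative_mult[OF h h]] has_derivative_mult[OF l l]]
  show ?thesis
    unfolding q_def[abs_def] q'_def[abs_def] power2_eq_square
    by (rule has_derivative_eq_rhs) (auto simp: fun_eq_iff mult_ac simp del: coord_simps intro!: sum.cong)
qed

lemma psi_derivative: "(psi has_derivative psi' x) (at x within X)"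
proof -
  have "((\<lambda>x. 1 - q x / \<rho>) has_derivative (\<lambda>u. - (q' x u / \<rho>))) (at x within X)"
    using rho by (auto intro!: derivative_eq_intros q_derivative)
  from DERIV_compose_FDERIV[OF max_square_derivative this]
  show ?thesis unfolding psi_def[abs_def] psi'_def[abs_def] .
qed

lemma continuous_lam: "continuous_on X lam"
  by (rule linear_continuous_on[OF lam])

lemma continuous_coord: "continuous_on X f \<Longrightarrow> continuous_on X (\<lambda>x. apply_bcontfun (f x :: rseq) i)"
  by (rule bounded_linear.continuous_on[OF bounded_linear_coord])

lemma continuous_q: "continuous_on X q" and continuous_q': "continuous_on X (\<lambda>x. q' x u)"
  unfolding q_def q'_def by (intro continuous_intros continuous_coord continuous_lam)+

lemma continuous_psi: "continuous_on X psi" and continuous_psi': "continuous_on X (\<lambda>x. psi' x u)"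
  unfolding psi_def psi'_def using rho by (intro continuous_intros continuous_q continuous_q'; simp)+

lemma linear_psi': "linear (psi' x)"
  using has_derivative_linear[OF psi_derivative[of x UNIV]] .

lemma pinch_derivative:
  assumes B: "bounded_linear B"
  shows "(pinch a B has_derivative pinch' a B x) (at x within X)"
proof -
  have 1: "((\<lambda>x. x - z0) has_derivative (\<lambda>u. u)) (at x within X)"
    by (auto intro!: derivative_eq_intros)
  have 2: "((\<lambda>x. psi (x - z0)) has_derivative psi' (x - z0)) (at x within X)"
    using has_derivative_in_compose[OF 1 psi_derivative] by simp
  have 3: "((\<lambda>x. a + B (x - z0)) has_derivative B) (at x within X)"
    using has_derivative_add[OF has_derivative_const bounded_linear.has_derivative[OF B 1]] by simp
  show ?thesis
    unfolding pinch_def[abs_def] pinch'_def[abs_def]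
    by (rule has_derivative_add[OF has_derivative_ident has_derivative_scaleR[OF 2 3]])
qed

lemma C1_on_pinch:
  assumes B: "bounded_linear B"
  shows "C1_on n (Rn n) (pinch a B)"
proof (rule C1_onI[OF pinch_derivative[OF B] order_refl])
  fix u
  have c: "continuous_on (Rn n) (\<lambda>x. f (x - z0))" if "continuous_on UNIV f" for f :: "rseq \<Rightarrow> 'x::topological_space"
    by (rule continuous_on_compose2[OF that]) (auto intro!: continuous_intros)
  show "continuous_on (Rn n) (\<lambda>x. pinch' a B x u)"
    unfolding pinch'_def
    by (intro continuous_intros c continuous_psi continuous_psi' linear_continuous_on B)
qed

lemma fderiv_pinch:
  assumes "bounded_linear B" "x \<in> Rn n" "u \<in> Rn n"
  shows "fderiv n (pinch a B) x u = pinch' a B x u"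
  by (rule fderiv_eqI[OF pinch_derivative]) (use assms in auto)

lemma q_nonneg: "0 \<le> q x" and psi_nonneg: "0 \<le> psi x" and psi_le_1: "psi x \<le> 1"
proof -
  show q: "0 \<le> q x" unfolding q_def by (intro add_nonneg_nonneg sum_nonneg) auto
  show "0 \<le> psi x" by (simp add: psi_def)
  have "max 0 (1 - q x / \<rho>) \<le> 1" using q rho by auto
  then show "psi x \<le> 1" unfolding psi_def by (intro power_le_one) auto
qed

lemma q_bounds:
  assumes "q x \<le> s\<^sup>2" "0 \<le> s"
  shows "\<bar>lam x\<bar> \<le> s" and "x \<in> Rn n \<Longrightarrow> norm (x - lam x *\<^sub>R v) \<le> s"
proof -
  have sum0: "0 \<le> (\<Sum>i<n. (apply_bcontfun (x - lam x *\<^sub>R v) i)\<^sup>2)" by (intro sum_nonneg) auto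
  then have "(lam x)\<^sup>2 \<le> s\<^sup>2" using assms by (simp add: q_def)
  then show "\<bar>lam x\<bar> \<le> s" using assms(2) by (simp add: abs_le_square_iff[symmetric])
  assume x: "x \<in> Rn n"
  show "norm (x - lam x *\<^sub>R v) \<le> s"
  proof (rule norm_bound)
    fix i
    show "norm (apply_bcontfun (x - lam x *\<^sub>R v) i) \<le> s"
    proof (cases "i < n")
      case True
      have "(apply_bcontfun (x - lam x *\<^sub>R v) i)\<^sup>2 \<le> (\<Sum>i<n. (apply_bcontfun (x - lam x *\<^sub>R v) i)\<^sup>2)"
        by (rule member_le_sum) (use True in auto)
      also have "\<dots> \<le> s\<^sup>2" using assms(1) zero_le_power2[of "lam x"] unfolding q_def by linarith
      finally show ?thesis using assms(2) unfolding real_norm_def by (simp only: abs_le_square_iff[symmetric] abs_of_nonneg)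
    next
      case False
      have "x - lam x *\<^sub>R v \<in> Rn n" using x v by (intro Rn_diff Rn_scale)
      then have "apply_bcontfun (x - lam x *\<^sub>R v) i = 0" using False by (simp only: Rn_def mem_Collect_eq not_less)
      then show ?thesis using assms(2) by (simp only: norm_zero)
    qed
  qed
qed

lemma q_eq_0: "x \<in> Rn n \<Longrightarrow> q x = 0 \<Longrightarrow> x = 0"
  using q_bounds[of x 0] by simp

lemma q_0 [simp]: "q 0 = 0" by (simp add: q_def linear_0[OF lam_linear])

lemma psi_0 [simp]: "psi 0 = 1" by (simp add: psi_def)

lemma psi'_0: "psi' 0 u = 0" by (simp add: psi'_def q'_def linear_0[OF lam_linear])

lemma psi_less_1: "x \<in> Rn n \<Longrightarrow> x \<noteq> 0 \<Longrightarrow> psi x < 1"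
proof -
  assume "x \<in> Rn n" "x \<noteq> 0"
  then have "0 < q x" using q_eq_0[of x] q_nonneg[of x] by linarith
  then have "0 < q x / \<rho>" using rho by simp
  then have "max 0 (1 - q x / \<rho>) < 1" by linarith
  then have "(max 0 (1 - q x / \<rho>))\<^sup>2 < 1" using power_strict_mono[of "max 0 (1 - q x / \<rho>)" 1 2] by simp
  then show ?thesis by (simp only: psi_def)
qed

lemma q'_v: "q' x v = 2 * lam x"
  by (simp add: q'_def lamv)

text \<open>The sum of squares over the kernel component is constant along \<open>v\<close>, so that only \<open>(lam x)\<^sup>2\<close> contributes.\<close>

lemma psi'_v: "psi' x v * lam x \<le> 0"
proof -
  have "psi' x v * lam x = - ((lam x)\<^sup>2 * (4 * max 0 (1 - q x / \<rho>) / \<rho>))"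
    by (simp add: psi'_def q'_v power2_eq_square)
  also have "\<dots> \<le> 0" using rho by simp
  finally show ?thesis .
qed

text \<open>The derivative is \<open>u \<mapsto> u - \<theta> u *\<^sub>R v\<close> for a functional \<open>\<theta>\<close>, and it is onto as soon as \<open>\<theta> v \<noteq> 1\<close>.  Off the
  centre \<open>\<theta> v < 1\<close>, since there \<open>psi < 1\<close>, and since \<open>psi\<close> decreases along \<open>v\<close> away from the kernel of \<open>lam\<close>.\<close>

lemma pinch'_onto:
  assumes x: "x \<in> Rn n" "x \<noteq> z0"
  shows "pinch' 0 (\<lambda>u. - (lam u *\<^sub>R v)) x ` Rn n = Rn n"
proof -
  let ?y = "x - z0"
  define \<theta> where "\<theta> u = psi ?y * lam u + psi' ?y u * lam ?y" for u
  have eq: "pinch' 0 (\<lambda>u. - (lam u *\<^sub>R v)) x u = u - \<theta> u *\<^sub>R v" for u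
    by (simp add: pinch'_def \<theta>_def scaleR_add_left)
  have \<theta>: "\<theta> (u + c *\<^sub>R w) = \<theta> u + c * \<theta> w" for u c w
    by (simp add: \<theta>_def linear_add[OF lam_linear] linear_cmul[OF lam_linear] linear_add[OF linear_psi']
        linear_cmul[OF linear_psi'] algebra_simps)
  have "\<theta> v < 1"
    using psi_less_1[of ?y] psi'_v[of ?y] x z0 by (simp add: \<theta>_def lamv Rn_diff)
  show ?thesis
    unfolding eq
  proof
    show "(\<lambda>u. u - \<theta> u *\<^sub>R v) ` Rn n \<subseteq> Rn n" using v by (auto intro!: Rn_diff Rn_scale)
    show "Rn n \<subseteq> (\<lambda>u. u - \<theta> u *\<^sub>R v) ` Rn n"
    proof
      fix w assume w: "w \<in> Rn n"
      define s where "s = \<theta> w / (1 - \<theta> v)"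
      have s: "s - \<theta> w - s * \<theta> v = 0" using \<open>\<theta> v < 1\<close> by (simp add: s_def field_simps)
      have "w + s *\<^sub>R v - \<theta> (w + s *\<^sub>R v) *\<^sub>R v = w + (s - \<theta> w - s * \<theta> v) *\<^sub>R v"
        by (simp add: \<theta> algebra_simps)
      also have "\<dots> = w" by (simp only: s scale_zero_left add_0_right)
      finally have "w = w + s *\<^sub>R v - \<theta> (w + s *\<^sub>R v) *\<^sub>R v" by simp
      moreover have "w + s *\<^sub>R v \<in> Rn n" using w v by (intro Rn_add Rn_scale)
      ultimately show "w \<in> (\<lambda>u. u - \<theta> u *\<^sub>R v) ` Rn n" by (rule image_eqI)
    qed
  qed
qed

lemma pinch'_centre: "linear B \<Longrightarrow> pinch' a B z0 u = u + B u"
  by (simp add: pinch'_def psi'_0)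

lemma pinch_centre: "linear B \<Longrightarrow> pinch a B z0 = z0 + a"
  by (simp add: pinch_def linear_0)

lemma pinch_Rn:
  assumes "a \<in> Rn n" "\<And>u. u \<in> Rn n \<Longrightarrow> B u \<in> Rn n" "x \<in> Rn n"
  shows "pinch a B x \<in> Rn n"
  unfolding pinch_def using assms z0 by (intro Rn_add Rn_scale) (auto intro: Rn_diff)

text \<open>Where \<open>psi\<close> does not vanish, \<open>q < \<rho>\<close> bounds both components of \<open>x - z0\<close> and thus its norm by \<open>R\<close>.  The increment of
  the map has norm at most \<open>3 * R\<close>: one \<open>R\<close> for \<open>a\<close>, one for \<open>lam u *\<^sub>R v\<close>, one for the deviation of \<open>B u\<close> from \<open>- (lam u *\<^sub>R v)\<close>.\<close>

lemma pinch_support: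
  assumes R: "R = sqrt \<rho> * (1 + norm v)"
    and a: "norm a \<le> R" and B: "\<And>u. u \<in> Rn n \<Longrightarrow> norm (B u + lam u *\<^sub>R v) \<le> norm u"
    and x: "x \<in> Rn n"
  shows "pinch a B x = x \<or> x \<in> cball z0 (4 * R) \<and> pinch a B x \<in> cball z0 (4 * R)"
proof (cases "psi (x - z0) = 0")
  case True then show ?thesis by (simp add: pinch_def)
next
  case False
  let ?y = "x - z0"
  have y: "?y \<in> Rn n" using x z0 by (rule Rn_diff)
  have "q ?y < \<rho>"
  proof (rule ccontr)
    assume "\<not> q ?y < \<rho>"
    then have "max 0 (1 - q ?y / \<rho>) = 0" using rho by simp
    then show False using False by (simp add: psi_def)
  qed
  then have q: "q ?y \<le> (sqrt \<rho>)\<^sup>2" using rho by simp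
  have l: "\<bar>lam ?y\<bar> \<le> sqrt \<rho>" and m: "norm (?y - lam ?y *\<^sub>R v) \<le> sqrt \<rho>"
    using q_bounds[OF q] rho y by auto
  have lv: "norm (lam ?y *\<^sub>R v) \<le> sqrt \<rho> * norm v" using l by (simp add: mult_right_mono)
  have "norm ?y \<le> norm (?y - lam ?y *\<^sub>R v) + norm (lam ?y *\<^sub>R v)"
    using norm_triangle_ineq[of "?y - lam ?y *\<^sub>R v" "lam ?y *\<^sub>R v"] by simp
  then have yR: "norm ?y \<le> R" using lv m by (simp add: R algebra_simps)
  have R0: "0 \<le> R" using yR norm_ge_zero order_trans by blast
  have "norm (B ?y) \<le> norm (B ?y + lam ?y *\<^sub>R v) + norm (lam ?y *\<^sub>R v)"
    using norm_triangle_ineq4[of "B ?y + lam ?y *\<^sub>R v" "lam ?y *\<^sub>R v"] by simp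
  moreover have "sqrt \<rho> * norm v \<le> R" using rho by (simp add: R algebra_simps)
  ultimately have "norm (B ?y) \<le> 2 * R" using B[OF y] yR lv by linarith
  then have aB: "norm (a + B ?y) \<le> 3 * R" using a norm_triangle_ineq[of a "B ?y"] by linarith
  have "norm (psi ?y *\<^sub>R (a + B ?y)) \<le> 1 * norm (a + B ?y)"
    unfolding norm_scaleR using psi_nonneg[of ?y] psi_le_1[of ?y] by (intro mult_right_mono) auto
  then have "norm (?y + psi ?y *\<^sub>R (a + B ?y)) \<le> 4 * R"
    using norm_triangle_ineq[of ?y "psi ?y *\<^sub>R (a + B ?y)"] aB yR by linarith
  moreover have "pinch a B x - z0 = ?y + psi ?y *\<^sub>R (a + B ?y)" by (simp add: pinch_def)
  ultimately have "norm (pinch a B x - z0) \<le> 4 * R" by (simp only:)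
  then show ?thesis using yR R0 by (simp add: dist_norm norm_minus_commute)
qed

lemma tendsto_linear_joint:
  assumes B: "\<And>i::nat. linear (Bi i)" "linear B" "\<And>u. u \<in> Rn n \<Longrightarrow> (\<lambda>i. Bi i u) \<longlonglongrightarrow> B u"
    and x: "\<And>i. x i \<in> Rn n" "x0 \<in> Rn n" "x \<longlonglongrightarrow> x0"
  shows "(\<lambda>i. Bi i (x i)) \<longlonglongrightarrow> (B x0 :: rseq)"
proof -
  have e: "A y = (\<Sum>j<n. apply_bcontfun y j *\<^sub>R A (basis_vec j))" if "linear A" "y \<in> Rn n" for A :: "rseq \<Rightarrow> rseq" and y
  proof -
    have "A y = A (\<Sum>j<n. apply_bcontfun y j *\<^sub>R basis_vec j)" by (simp only: Rn_expand[OF that(2)])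
    then show ?thesis by (simp only: linear_sum[OF that(1)] linear_cmul[OF that(1)])
  qed
  have "(\<lambda>i. \<Sum>j<n. apply_bcontfun (x i) j *\<^sub>R Bi i (basis_vec j)) \<longlonglongrightarrow> (\<Sum>j<n. apply_bcontfun x0 j *\<^sub>R B (basis_vec j))"
    by (intro tendsto_sum tendsto_scaleR bounded_linear.tendsto[OF bounded_linear_coord] x(3) B(3) basis_vec_Rn) auto
  then show ?thesis by (simp only: e[OF B(1) x(1), symmetric] e[OF B(2) x(2), symmetric])
qed

lemma pinch_tendsto:
  assumes a: "ai \<longlonglongrightarrow> a" and B: "\<And>i::nat. linear (Bi i)" "linear B" "\<And>u. u \<in> Rn n \<Longrightarrow> (\<lambda>i. Bi i u) \<longlonglongrightarrow> B u"
    and x: "\<And>i. x i \<in> Rn n" "x0 \<in> Rn n" "x \<longlonglongrightarrow> x0"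
    and u: "\<And>i. u i \<in> Rn n" "u0 \<in> Rn n" "u \<longlonglongrightarrow> u0"
  shows "(\<lambda>i. pinch (ai i) (Bi i) (x i)) \<longlonglongrightarrow> pinch a B x0"
    and "(\<lambda>i. pinch' (ai i) (Bi i) (x i) (u i)) \<longlonglongrightarrow> pinch' a B x0 u0"
proof -
  have y: "(\<lambda>i. x i - z0) \<longlonglongrightarrow> x0 - z0" by (intro tendsto_intros x)
  have yR: "x i - z0 \<in> Rn n" "x0 - z0 \<in> Rn n" for i using x z0 by (auto intro: Rn_diff)
  have psi: "(\<lambda>i. psi (x i - z0)) \<longlonglongrightarrow> psi (x0 - z0)"
    by (rule continuous_on_tendsto_compose[OF continuous_psi[of UNIV] y]) auto
  have By: "(\<lambda>i. Bi i (x i - z0)) \<longlonglongrightarrow> B (x0 - z0)" by (rule tendsto_linear_joint[OF B yR y])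
  show "(\<lambda>i. pinch (ai i) (Bi i) (x i)) \<longlonglongrightarrow> pinch a B x0"
    unfolding pinch_def by (intro tendsto_intros x psi a By)
  have Bu: "(\<lambda>i. Bi i (u i)) \<longlonglongrightarrow> B u0" by (rule tendsto_linear_joint[OF B u])
  have cl: "(\<lambda>i. lam (f i)) \<longlonglongrightarrow> lam f0" if "f \<longlonglongrightarrow> f0" for f f0
    by (rule bounded_linear.tendsto[OF lam that])
  have cq: "(\<lambda>i. q (x i - z0)) \<longlonglongrightarrow> q (x0 - z0)"
    by (rule continuous_on_tendsto_compose[OF continuous_q[of UNIV] y]) auto
  have cq': "(\<lambda>i. q' (x i - z0) (u i)) \<longlonglongrightarrow> q' (x0 - z0) u0"
    unfolding q'_def
    by (intro tendsto_intros bounded_linear.tendsto[OF bounded_linear_coord] cl y u)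
  have psi': "(\<lambda>i. psi' (x i - z0) (u i)) \<longlonglongrightarrow> psi' (x0 - z0) u0"
    unfolding psi'_def using rho by (intro tendsto_intros cq cq') auto
  show "(\<lambda>i. pinch' (ai i) (Bi i) (x i) (u i)) \<longlonglongrightarrow> pinch' a B x0 u0"
    unfolding pinch'_def by (intro tendsto_intros u psi psi' a By Bu)
qed

end

section \<open>Gluing and convergence in the strong topology\<close>

text \<open>Continuous convergence of a sequence of maps together with its derivatives in charts implies
  uniform convergence on compact sets, hence membership in a given neighbourhood.\<close>

lemma eventually_C1_close:
  fixes H :: "nat \<Rightarrow> 'm \<Rightarrow> 'a"
  assumes c: "c \<in> charts M" and d: "d \<in> charts N" and K: "compactin (mtop M) K" "K \<subseteq> fst c"
    and g: "g \<in> C1_maps M N" "g ` K \<subseteq> fst d" and close: "C1_close M c K d \<epsilon> g h"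
    and conv: "\<And>r w w0 v v0. strict_mono (r :: nat \<Rightarrow> nat) \<Longrightarrow> (\<And>n. w n \<in> K) \<Longrightarrow> w0 \<in> K \<Longrightarrow>
      (\<lambda>n. snd c (w n)) \<longlonglongrightarrow> snd c w0 \<Longrightarrow> (\<And>n. v n \<in> Rn (mdim M)) \<Longrightarrow> v0 \<in> Rn (mdim M) \<Longrightarrow> v \<longlonglongrightarrow> v0 \<Longrightarrow>
      (\<forall>\<^sub>F n in sequentially. H (r n) (w n) \<in> fst d) \<and>
      (\<lambda>n. local_rep c d (H (r n)) (snd c (w n))) \<longlonglongrightarrow> local_rep c d h (snd c w0) \<and>
      (\<lambda>n. rep_deriv M c d (H (r n)) (w n) (v n))
        \<longlonglongrightarrow> rep_deriv M c d h w0 v0"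
  shows "\<forall>\<^sub>F n in sequentially. C1_close M c K d \<epsilon> g (H n)"
proof (rule ccontr)
  let ?m = "mdim M"
  define good where "good n w v \<longleftrightarrow> H n w \<in> fst d \<and>
      norm (local_rep c d (H n) (snd c w) - local_rep c d g (snd c w)) < \<epsilon> \<and>
      norm (rep_deriv M c d (H n) w v - rep_deriv M c d g w v) < \<epsilon>" for n w v
  assume "\<not> ?thesis"
  then have "\<exists>\<^sub>F n in sequentially. \<not> C1_close M c K d \<epsilon> g (H n)" by (simp add: not_eventually)
  then have "infinite {n. \<not> C1_close M c K d \<epsilon> g (H n)}"
    by (simp add: frequently_cofinite[symmetric] cofinite_eq_sequentially)
  then obtain r :: "nat \<Rightarrow> nat" where r: "strict_mono r" "\<And>n. \<not> C1_close M c K d \<epsilon> g (H (r n))"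
    using infinite_enumerate by blast
  \<comment> \<open>a point where closeness fails, with a vector that witnesses it; any vector serves if the values already differ\<close>
  have "\<exists>w v. w \<in> K \<and> v \<in> Rn ?m \<inter> cball 0 1 \<and> \<not> good (r n) w v" for n
  proof (rule ccontr)
    assume "\<not> ?thesis"
    then have *: "\<And>w v. w \<in> K \<Longrightarrow> v \<in> Rn ?m \<inter> cball 0 1 \<Longrightarrow> good (r n) w v" by blast
    have "0 \<in> Rn ?m \<inter> cball 0 1" using Rn_0 by simp
    with * have "good (r n) w 0" if "w \<in> K" for w using that by blast
    with * have "C1_close M c K d \<epsilon> g (H (r n))" unfolding C1_close_def good_def by blast
    then show False using r(2) by simp
  qed
  then obtain w v where w: "\<And>n. w n \<in> K" and v: "\<And>n. v n \<in> Rn ?m \<inter> cball 0 1"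
    and bad: "\<And>n. \<not> good (r n) (w n) (v n)"
    by metis
  have "compact ((snd c ` K) \<times> (Rn ?m \<inter> cball 0 1))"
    by (intro compact_Times compactin_chart_image[OF c K] compact_Rn_cball)
  then have "seq_compact ((snd c ` K) \<times> (Rn ?m \<inter> cball 0 1))" by (simp add: compact_eq_seq_compact_metric)
  then obtain l s where l: "l \<in> (snd c ` K) \<times> (Rn ?m \<inter> cball 0 1)"
    and s: "strict_mono s" "((\<lambda>n. (snd c (w n), v n)) \<circ> s) \<longlonglongrightarrow> l"
    by (rule seq_compactE[where f="\<lambda>n. (snd c (w n), v n)"]) (use w v in auto)
  obtain w0 v0 where w0: "w0 \<in> K" "l = (snd c w0, v0)" and v0: "v0 \<in> Rn ?m" using l by auto
  have xlim: "(\<lambda>n. snd c (w (s n))) \<longlonglongrightarrow> snd c w0" and vlim: "(\<lambda>n. v (s n)) \<longlonglongrightarrow> v0"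
    using tendsto_fst[OF s(2)] tendsto_snd[OF s(2)] w0(2) by (simp_all add: o_def)
  have vR: "v (s n) \<in> Rn ?m" for n using v by blast
  note cv = conv[OF strict_mono_o[OF r(1) s(1)] w w0(1) xlim vR v0 vlim, unfolded o_def]
  let ?U = "snd c ` {p \<in> fst c. g p \<in> fst d}"
  have C: "C1_on ?m ?U (local_rep c d g)" by (rule C1_maps_rep[OF g(1) c d])
  have xU: "snd c (w n) \<in> ?U" "snd c w0 \<in> ?U" for n using w w0(1) K(2) g(2) by blast+
  have UR: "?U \<subseteq> Rn ?m" using charts_Rn[OF c] by auto
  have g1: "(\<lambda>n. local_rep c d g (snd c (w (s n)))) \<longlonglongrightarrow> local_rep c d g (snd c w0)"
    by (rule continuous_on_tendsto_compose[OF C1_on_continuous_on[OF C UR] xlim xU(2)]) (use xU in simp)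
  have g2: "(\<lambda>n. rep_deriv M c d g (w (s n)) (v (s n))) \<longlonglongrightarrow> rep_deriv M c d g w0 v0"
    by (rule tendsto_fderiv[OF C _ xU(2) xlim _ v0 vlim]) (use xU vR in simp_all)
  have "norm v0 \<le> 1" using l w0(2) by auto
  then have cl: "norm (local_rep c d h (snd c w0) - local_rep c d g (snd c w0)) < \<epsilon>"
    "norm (rep_deriv M c d h w0 v0 - rep_deriv M c d g w0 v0) < \<epsilon>"
    using C1_closeD(2,3)[OF close w0(1)] v0 by auto
  have "\<forall>\<^sub>F n in sequentially. norm (local_rep c d (H (r (s n))) (snd c (w (s n))) - local_rep c d g (snd c (w (s n)))) < \<epsilon>"
    by (rule order_tendstoD(2)[OF tendsto_norm[OF tendsto_diff[OF _ g1]] cl(1)]) (use cv in blast)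
  moreover have "\<forall>\<^sub>F n in sequentially. norm (rep_deriv M c d (H (r (s n))) (w (s n)) (v (s n)) -
      rep_deriv M c d g (w (s n)) (v (s n))) < \<epsilon>"
    by (rule order_tendstoD(2)[OF tendsto_norm[OF tendsto_diff[OF _ g2]] cl(2)]) (use cv in blast)
  moreover have "\<forall>\<^sub>F n in sequentially. H (r (s n)) (w (s n)) \<in> fst d" using cv by blast
  ultimately have "\<forall>\<^sub>F n in sequentially. good (r (s n)) (w (s n)) (v (s n))"
    unfolding good_def by eventually_elim simp
  then obtain n where "good (r (s n)) (w (s n)) (v (s n))"
    using eventually_happens'[OF sequentially_bot] by blast
  then show False using bad by blast
qed

lemma C1_close_cong:
  assumes c: "c \<in> charts M" and d: "d \<in> charts N" and K: "K \<subseteq> fst c"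
    and h: "h \<in> C1_maps M N" and eq: "\<And>p. p \<in> fst c \<Longrightarrow> h' p = h p"
    and close: "C1_close M c K d \<epsilon> g h"
  shows "C1_close M c K d \<epsilon> g h'"
proof -
  have im: "h ` K \<subseteq> fst d" using close by (simp add: C1_close_def)
  have "h' ` K = h ` K" using eq K by (intro image_cong) auto
  let ?Q = "{p \<in> fst c. h p \<in> fst d}"
  have o: "ropen (mdim M) (snd c ` ?Q)"
    by (rule charts_open_image[OF c C1_maps_preimage_open[OF h c d]]) auto
  have re: "local_rep c d h y = local_rep c d h' y" if y: "y \<in> snd c ` ?Q" for y
  proof -
    obtain p where "p \<in> fst c" "y = snd c p" using y by blast
    then show ?thesis using eq by (simp add: charts_local_rep[OF c])
  qed
  have "fderiv (mdim M) (local_rep c d h') x v = fderiv (mdim M) (local_rep c d h) x v"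
    if "x \<in> snd c ` ?Q" "v \<in> Rn (mdim M)" for x v
    by (rule fderiv_ropen_cong[OF o that(1) re C1_on_differentiable[OF C1_maps_rep[OF h c d] that(1)] that(2)])
  moreover have "snd c ` K \<subseteq> snd c ` ?Q" using K im by blast
  ultimately show ?thesis
    using close re \<open>h' ` K = h ` K\<close> unfolding C1_close_def by (simp add: subset_iff)
qed

lemma compact_meets_finitely_many:
  assumes K: "compactin X K"
    and lf: "\<forall>p\<in>topspace X. \<exists>W. openin X W \<and> p \<in> W \<and> finite {i\<in>I. A i \<inter> W \<noteq> {}}"
  shows "finite {i\<in>I. A i \<inter> K \<noteq> {}}"
proof -
  let ?B = "{W. openin X W \<and> finite {i\<in>I. A i \<inter> W \<noteq> {}}}"
  have "K \<subseteq> \<Union>?B" using lf compactin_subset_topspace[OF K] by blast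
  then obtain F where F: "finite F" "F \<subseteq> ?B" "K \<subseteq> \<Union>F"
    using compactinD[OF K, of ?B] by auto
  have "{i\<in>I. A i \<inter> K \<noteq> {}} \<subseteq> (\<Union>W\<in>F. {i\<in>I. A i \<inter> W \<noteq> {}})" using F(3) by blast
  moreover have "finite (\<Union>W\<in>F. {i\<in>I. A i \<inter> W \<noteq> {}})" using F(1,2) by blast
  ultimately show ?thesis by (rule finite_subset)
qed

text \<open>It suffices to consider the generating sets: the sets that eventually contain the sequence are closed
  under finite intersections, and a union that contains \<open>g\<close> has a member that does.\<close>

lemma strong_topology_tendsto:
  assumes nhd: "\<And>g' I c K d \<epsilon>. strong_data M N g' I c K d \<epsilon> \<Longrightarrow> g \<in> strong_nhd M N g' I c K d \<epsilon> \<Longrightarrow>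
      \<forall>\<^sub>F n in sequentially. H n \<in> strong_nhd M N g' I c K d \<epsilon>"
    and S: "openin (strong_topology M N) S" "g \<in> S"
  shows "\<forall>\<^sub>F n in sequentially. H n \<in> S"
proof -
  have "generate_topology_on {strong_nhd M N g I c K d \<epsilon> | g I c K d \<epsilon>. strong_data M N g I c K d \<epsilon>} S"
    using S(1) by (simp add: strong_topology_def openin_topology_generated_by_iff)
  then show ?thesis using S(2)
  proof induction
    case (Int a b) then show ?case using eventually_conj[of "\<lambda>n. H n \<in> a" sequentially "\<lambda>n. H n \<in> b"] by simp
  next
    case (UN C)
    then obtain k where "k \<in> C" "g \<in> k" by blast
    then have "\<forall>\<^sub>F n in sequentially. H n \<in> k" using UN.IH by blast
    then show ?case by eventually_elim (use \<open>k \<in> C\<close> in blast)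
  next
    case (Basis s)
    then show ?case using nhd by blast
  qed simp
qed

subsection \<open>Maps supported in a chart\<close>

text \<open>The source manifold may be a copy of the target, with points of another type; this is why all the
  maps built here are compositions with a diffeomorphism.\<close>

locale diffeo =
  fixes M :: "'m c1mfd" and N :: "'a c1mfd" and \<iota> :: "'m \<Rightarrow> 'a"
  assumes M: "c1_manifold M" and N: "c1_manifold N"
    and homeo: "homeomorphic_map (mtop M) (mtop N) \<iota>"
    and dims: "mdim M = mdim N"
    and pull: "\<And>c. c \<in> charts N \<Longrightarrow> ({p \<in> topspace (mtop M). \<iota> p \<in> fst c}, snd c \<circ> \<iota>) \<in> charts M"
begin

definition pullback :: "'a chart \<Rightarrow> 'm chart" where
  "pullback c = ({p \<in> topspace (mtop M). \<iota> p \<in> fst c}, snd c \<circ> \<iota>)"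

lemma pullback_charts: "c \<in> charts N \<Longrightarrow> pullback c \<in> charts M"
  using pull by (simp add: pullback_def)

lemma mem_pullback: "p \<in> fst (pullback c) \<longleftrightarrow> p \<in> topspace (mtop M) \<and> \<iota> p \<in> fst c"
  and snd_pullback: "snd (pullback c) p = snd c (\<iota> p)"
  by (simp_all add: pullback_def)

lemma \<iota>_topspace: "p \<in> topspace (mtop M) \<Longrightarrow> \<iota> p \<in> topspace (mtop N)"
  using homeomorphic_imp_surjective_map[OF homeo] by blast

lemma \<iota>_surj: "q \<in> topspace (mtop N) \<Longrightarrow> \<exists>p\<in>topspace (mtop M). \<iota> p = q"
  unfolding homeomorphic_imp_surjective_map[OF homeo, symmetric] by auto

lemma \<iota>_open: "openin (mtop N) Q \<Longrightarrow> openin (mtop M) {p \<in> topspace (mtop M). \<iota> p \<in> Q}"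
  by (rule openin_continuous_map_preimage[OF homeomorphic_imp_continuous_map[OF homeo]])

lemma \<iota>_compact:
  assumes "compactin (mtop N) K"
  shows "compactin (mtop M) {p \<in> topspace (mtop M). \<iota> p \<in> K}"
proof -
  have "\<iota> ` {p \<in> topspace (mtop M). \<iota> p \<in> K} = K"
    using \<iota>_surj compactin_subset_topspace[OF assms] by blast
  then show ?thesis
    using homeomorphic_map_compactness[OF homeo, of "{p \<in> topspace (mtop M). \<iota> p \<in> K}"] assms by simp
qed

end

locale chart_support = diffeo M N \<iota>
  for M :: "'m c1mfd" and N :: "'a c1mfd" and \<iota> :: "'m \<Rightarrow> 'a" +
  fixes c :: "'a chart" and z0 :: rseq and R :: real
  assumes c: "c \<in> charts N" and ball: "Rn (mdim N) \<inter> cball z0 R \<subseteq> snd c ` fst c"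
begin

abbreviation n where "n \<equiv> mdim N"

definition core :: "'a set" where "core = {q \<in> fst c. snd c q \<in> cball z0 R}"

text \<open>Transported to the manifold by the chart, such a map extends by the identity.\<close>

definition supported :: "(rseq \<Rightarrow> rseq) \<Rightarrow> bool" where
  "supported F \<longleftrightarrow> C1_on n (Rn n) F \<and> (\<forall>x\<in>Rn n. F x \<in> Rn n \<and> (F x = x \<or> x \<in> cball z0 R \<and> F x \<in> cball z0 R))"

definition glue :: "(rseq \<Rightarrow> rseq) \<Rightarrow> 'm \<Rightarrow> 'a" where
  "glue F p = (if p \<in> topspace (mtop M) then if \<iota> p \<in> fst c then cinv c (F (snd c (\<iota> p))) else \<iota> p else undefined)"

lemma compactin_core: "compactin (mtop N) core"
  unfolding core_def by (rule compactin_chart_cball[OF c ball])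

lemma closedin_core: "closedin (mtop N) core"
  using compactin_imp_closedin[OF _ compactin_core] N by (simp add: c1_manifold_def)

lemma supported_image:
  assumes F: "supported F" and x: "x \<in> snd c ` fst c"
  shows "F x \<in> snd c ` fst c"
proof -
  have "x \<in> Rn n" using x charts_Rn[OF c] by auto
  then have "F x \<in> Rn n" "F x = x \<or> F x \<in> cball z0 R" using F by (auto simp: supported_def)
  then show ?thesis using x ball by auto
qed

lemma glue_in:
  assumes F: "supported F" and p: "p \<in> topspace (mtop M)" "\<iota> p \<in> fst c"
  shows "glue F p \<in> fst c" and "snd c (glue F p) = F (snd c (\<iota> p))"
proof -
  obtain q where q: "q \<in> fst c" "F (snd c (\<iota> p)) = snd c q"
    using supported_image[OF F imageI[OF p(2)]] by blast
  have "glue F p = q" using p q(2) charts_cinv[OF c q(1)] by (simp add: glue_def)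
  then show "glue F p \<in> fst c" "snd c (glue F p) = F (snd c (\<iota> p))" using q by simp_all
qed

lemma glue_out:
  assumes F: "supported F" and p: "p \<in> topspace (mtop M)" "\<iota> p \<notin> core"
  shows "glue F p = \<iota> p"
proof (cases "\<iota> p \<in> fst c")
  case True
  then have "snd c (\<iota> p) \<notin> cball z0 R" "snd c (\<iota> p) \<in> Rn n"
    using p(2) charts_Rn[OF c] by (simp_all add: core_def)
  then have "F (snd c (\<iota> p)) = snd c (\<iota> p)" using F unfolding supported_def by blast
  then show ?thesis using p True charts_cinv[OF c True] by (simp add: glue_def)
qed (use p in \<open>simp add: glue_def\<close>)

lemma glue_rep_in:
  assumes F: "supported F" and p: "p \<in> fst (pullback c)"
  shows "local_rep (pullback c) c (glue F) (snd (pullback c) p) = F (snd (pullback c) p)"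
  using p glue_in(2)[OF F] charts_local_rep[OF pullback_charts[OF c] p, of c "glue F"] by (simp add: mem_pullback snd_pullback)

lemma away_open: "openin (mtop M) {p \<in> topspace (mtop M). \<iota> p \<notin> core}"
proof -
  have "openin (mtop N) (topspace (mtop N) - core)" using closedin_core by blast
  from \<iota>_open[OF this] show ?thesis
    by (rule back_subst[of "openin _"]) (use \<iota>_topspace in auto)
qed

lemma glue_rep_out:
  assumes F: "supported F" and p: "p \<in> fst (pullback d)" "\<iota> p \<notin> core" and d: "d \<in> charts N"
  shows "local_rep (pullback d) d (glue F) (snd (pullback d) p) = snd (pullback d) p"
  using p glue_out[OF F] charts_local_rep[OF pullback_charts[OF d] p(1), of d "glue F"] by (simp add: mem_pullback snd_pullback)

lemma C1_on_ident: "U \<subseteq> Rn n \<Longrightarrow> C1_on n U (\<lambda>x. x)"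
  by (rule C1_onI[where D="\<lambda>x v. v"]) auto

lemma glue_local:
  assumes F: "supported F" and p: "p \<in> topspace (mtop M)"
  shows "\<exists>b\<in>charts M. \<exists>d\<in>charts N. \<exists>Q. openin (mtop M) Q \<and> p \<in> Q \<and> Q \<subseteq> fst b \<and> glue F ` Q \<subseteq> fst d \<and>
    C1_on (mdim M) (snd b ` Q) (local_rep b d (glue F))"
proof (cases "\<iota> p \<in> fst c")
  case True
  have o: "ropen n (snd (pullback c) ` fst (pullback c))"
    using charts_open_image[OF pullback_charts[OF c] charts_open[OF pullback_charts[OF c]] order_refl] dims by simp
  have "C1_on n (snd (pullback c) ` fst (pullback c)) F"
    using F ropen_imp_subset[OF o] by (auto simp: supported_def intro: C1_on_subset)
  then have 1: "C1_on n (snd (pullback c) ` fst (pullback c)) (local_rep (pullback c) c (glue F))"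
    by (rule C1_on_cong[OF o, rotated]) (auto simp: glue_rep_in[OF F])
  have 2: "p \<in> fst (pullback c)" using p True by (simp add: mem_pullback)
  have 3: "glue F ` fst (pullback c) \<subseteq> fst c" using glue_in(1)[OF F] by (auto simp: mem_pullback)
  show ?thesis
    unfolding dims
    by (rule bexI[OF _ pullback_charts[OF c]], rule bexI[OF _ c], rule exI[of _ "fst (pullback c)"])
       (intro conjI charts_open[OF pullback_charts[OF c]] order_refl 1 2 3)
next
  case False
  obtain d where d: "d \<in> charts N" "\<iota> p \<in> fst d" using charts_at_exists[OF N \<iota>_topspace[OF p]] .
  let ?Q = "fst (pullback d) \<inter> {p \<in> topspace (mtop M). \<iota> p \<notin> core}"
  have Q: "openin (mtop M) ?Q" using charts_open[OF pullback_charts[OF d(1)]] away_open by blast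
  have o: "ropen n (snd (pullback d) ` ?Q)" using charts_open_image[OF pullback_charts[OF d(1)] Q] dims by simp
  have 1: "C1_on n (snd (pullback d) ` ?Q) (local_rep (pullback d) d (glue F))"
    by (rule C1_on_cong[OF o _ C1_on_ident[OF ropen_imp_subset[OF o]]]) (auto simp: glue_rep_out[OF F _ _ d(1)])
  have 2: "p \<in> ?Q" using p False d by (simp add: mem_pullback core_def)
  have 3: "glue F ` ?Q \<subseteq> fst d" using glue_out[OF F] by (auto simp: mem_pullback)
  show ?thesis
    unfolding dims
    by (rule bexI[OF _ pullback_charts[OF d(1)]], rule bexI[OF _ d(1)], rule exI[of _ ?Q])
       (intro conjI Q Int_lower1 1 2 3)
qed

lemma glue_C1:
  assumes F: "supported F" shows "glue F \<in> C1_maps M N"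
  by (rule C1_maps_localI[OF M N _ glue_local[OF F]])
     (auto simp: glue_def extensional_def)

lemma glue_derivative_in:
  assumes F: "supported F" and p: "p \<in> fst (pullback c)" and u: "u \<in> Rn n"
  shows "rep_deriv M (pullback c) c (glue F) p u = fderiv n F (snd (pullback c) p) u"
proof -
  have o: "ropen n (snd (pullback c) ` fst (pullback c))"
    using charts_open_image[OF pullback_charts[OF c] charts_open[OF pullback_charts[OF c]] order_refl] dims by simp
  have x: "snd (pullback c) p \<in> snd (pullback c) ` fst (pullback c)" using p by blast
  have "F differentiable (at (snd (pullback c) p) within Rn n)"
    using F x ropen_imp_subset[OF o] by (auto simp: supported_def intro: C1_on_differentiable)
  then have "fderiv n (local_rep (pullback c) c (glue F)) (snd (pullback c) p) u = fderiv n F (snd (pullback c) p) u"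
    by (rule fderiv_ropen_cong[OF o x _ _ u, rotated]) (auto simp: glue_rep_in[OF F])
  then show ?thesis by (simp only: dims)
qed

lemma glue_derivative_out:
  assumes F: "supported F" and d: "d \<in> charts N" and p: "p \<in> fst (pullback d)" "\<iota> p \<notin> core" and u: "u \<in> Rn n"
  shows "rep_deriv M (pullback d) d (glue F) p u = u"
proof -
  let ?Q = "fst (pullback d) \<inter> {p \<in> topspace (mtop M). \<iota> p \<notin> core}"
  have Q: "openin (mtop M) ?Q" using charts_open[OF pullback_charts[OF d(1)]] away_open by blast
  have o: "ropen n (snd (pullback d) ` ?Q)" using charts_open_image[OF pullback_charts[OF d(1)] Q] dims by simp
  have x: "snd (pullback d) p \<in> snd (pullback d) ` ?Q" using p by (auto simp: mem_pullback)
  have "fderiv n (local_rep (pullback d) d (glue F)) (snd (pullback d) p) u = fderiv n (\<lambda>x. x) (snd (pullback d) p) u"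
    by (rule fderiv_ropen_cong[OF o x _ _ u]) (auto simp: glue_rep_out[OF F _ _ d])
  also have "\<dots> = u" by (rule fderiv_id) (use x ropen_imp_subset[OF o] u in auto)
  finally show ?thesis using dims by simp
qed

text \<open>Over the chart \<open>c\<close> the representation of a glued map in other charts is the coordinate map composed with
  changes of charts, and the derivatives of these are continuous in the point and the vector jointly.\<close>

lemma glue_converges:
  assumes Fi: "\<And>i. supported (Fi i)" and F: "supported F"
    and conv: "\<And>x x0 u u0. (\<And>i::nat. x i \<in> Rn n) \<Longrightarrow> x0 \<in> Rn n \<Longrightarrow> x \<longlonglongrightarrow> x0 \<Longrightarrow>
      (\<And>i. u i \<in> Rn n) \<Longrightarrow> u0 \<in> Rn n \<Longrightarrow> u \<longlonglongrightarrow> u0 \<Longrightarrow>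
      (\<lambda>i. Fi i (x i)) \<longlonglongrightarrow> F x0 \<and> (\<lambda>i. fderiv n (Fi i) (x i) (u i)) \<longlonglongrightarrow> fderiv n F x0 u0"
    and b: "b \<in> charts M" and d: "d \<in> charts N" and w: "\<And>i. w i \<in> fst b" "w0 \<in> fst b"
    and lim: "(\<lambda>i. snd b (w i)) \<longlonglongrightarrow> snd b w0" and d0: "glue F w0 \<in> fst d"
    and v: "\<And>i. v i \<in> Rn n" "v0 \<in> Rn n" "v \<longlonglongrightarrow> v0"
    and inside: "\<And>i. w i \<in> fst (pullback c)" "w0 \<in> fst (pullback c)"
  shows "(\<forall>\<^sub>F i in sequentially. glue (Fi i) (w i) \<in> fst d) \<and>
      (\<lambda>i. local_rep b d (glue (Fi i)) (snd b (w i))) \<longlonglongrightarrow> local_rep b d (glue F) (snd b w0) \<and>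
      (\<lambda>i. rep_deriv M b d (glue (Fi i)) (w i) (v i))
        \<longlonglongrightarrow> rep_deriv M b d (glue F) w0 v0"
proof -
  let ?p = "pullback c"
  have pM: "?p \<in> charts M" by (rule pullback_charts[OF c])
  have wT: "w i \<in> topspace (mtop M)" "\<iota> (w i) \<in> fst c" "w0 \<in> topspace (mtop M)" "\<iota> w0 \<in> fst c" for i
    using inside by (auto simp: mem_pullback)
  define x where "x i = snd ?p (w i)" for i
  define x0 where "x0 = snd ?p w0"
  define u where "u i = chart_change M b ?p (w i) (v i)" for i
  define u0 where "u0 = chart_change M b ?p w0 v0"
  have xR: "x i \<in> Rn n" "x0 \<in> Rn n" for i
    using charts_Rn[OF pM inside(1)] charts_Rn[OF pM inside(2)] by (simp_all add: x_def x0_def dims)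
  have xlim: "x \<longlonglongrightarrow> x0"
    using chart_limitin(2)[OF pM inside(2) limitin_chart[OF b w lim]] by (simp add: x_def[abs_def] x0_def)
  have uR: "u i \<in> Rn n" "u0 \<in> Rn n" for i
    using transition_derivative(1)[OF M b w(1) pM inside(1) pM inside(1)] v(1)
      transition_derivative(1)[OF M b w(2) pM inside(2) pM inside(2)] v(2)
    by (simp_all add: u_def u0_def dims)
  have "(\<lambda>i. chart_change M b ?p (w i) (v i)) \<longlonglongrightarrow> u0"
    unfolding u0_def
    by (rule tendsto_fderiv[OF charts_compatible[OF M b pM] _ _ lim _ _ v(3)]) (use w inside v dims in simp_all)
  then have ulim: "u \<longlonglongrightarrow> u0" by (simp add: u_def[abs_def])
  from conv[OF xR xlim uR ulim]
  have ylim: "(\<lambda>i. Fi i (x i)) \<longlonglongrightarrow> F x0" and zlim: "(\<lambda>i. fderiv n (Fi i) (x i) (u i)) \<longlonglongrightarrow> fderiv n F x0 u0"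
    by auto
  have gi: "glue (Fi i) (w i) \<in> fst c" "snd c (glue (Fi i) (w i)) = Fi i (x i)" for i
    using glue_in[OF Fi wT(1,2)] by (simp_all add: x_def snd_pullback)
  have g0: "glue F w0 \<in> fst c" "snd c (glue F w0) = F x0"
    using glue_in[OF F wT(3,4)] by (simp_all add: x0_def snd_pullback)
  have glim: "limitin (mtop N) (\<lambda>i. glue (Fi i) (w i)) (glue F w0) sequentially"
    by (rule limitin_chart[OF c]) (use gi g0 ylim in simp_all)
  note gd = chart_limitin[OF d d0 glim]
  have rep: "(\<lambda>i. local_rep b d (glue (Fi i)) (snd b (w i))) \<longlonglongrightarrow> local_rep b d (glue F) (snd b w0)"
    using gd(2) by (simp add: charts_local_rep[OF b w(1)] charts_local_rep[OF b w(2)])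
  let ?W = "snd c ` (fst c \<inter> fst d)"
  have der_i: "rep_deriv M b d (glue (Fi i)) (w i) (v i) =
      fderiv n (snd d \<circ> cinv c) (Fi i (x i)) (fderiv n (Fi i) (x i) (u i))" if "glue (Fi i) (w i) \<in> fst d" for i
    using rep_derivative_change[OF M N glue_C1[OF Fi] b w(1) pM inside(1) d that c gi(1), of "v i"] v(1)[of i]
      glue_derivative_in[OF Fi inside(1) uR(1), of i i] gi(2)[of i]
    by (simp add: dims x_def u_def)
  have der_0: "rep_deriv M b d (glue F) w0 v0 =
      fderiv n (snd d \<circ> cinv c) (F x0) (fderiv n F x0 u0)"
    using rep_derivative_change[OF M N glue_C1[OF F] b w(2) pM inside(2) d d0 c g0(1) v(2)[folded dims]]
      glue_derivative_in[OF F inside(2) uR(2)] g0(2)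
    by (simp add: dims x0_def u0_def)
  have zR: "fderiv n (Fi i) (x i) (u i) \<in> Rn n" "fderiv n F x0 u0 \<in> Rn n" for i
  proof -
    have t: "ropen n (Rn n)" by simp
    show "fderiv n (Fi i) (x i) (u i) \<in> Rn n"
      by (rule fderiv_Rn[OF t xR(1) _ _ uR(1)]) (use Fi[of i] xR(1) in \<open>auto simp: supported_def intro: C1_on_differentiable\<close>)
    show "fderiv n F x0 u0 \<in> Rn n"
      by (rule fderiv_Rn[OF t xR(2) _ _ uR(2)]) (use F xR(2) in \<open>auto simp: supported_def intro: C1_on_differentiable\<close>)
  qed
  have "(\<lambda>i. fderiv n (snd d \<circ> cinv c) (Fi i (x i)) (fderiv n (Fi i) (x i) (u i)))
      \<longlonglongrightarrow> fderiv n (snd d \<circ> cinv c) (F x0) (fderiv n F x0 u0)"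
  proof (rule tendsto_fderiv[OF charts_compatible[OF N c d] _ _ ylim _ zR(2) zlim])
    show "\<forall>\<^sub>F i in sequentially. Fi i (x i) \<in> ?W"
      using gd(1) by eventually_elim (use gi in \<open>metis IntI imageI\<close>)
    show "F x0 \<in> ?W" using g0 d0 by (metis IntI imageI)
  qed (simp add: zR(1))
  moreover have "\<forall>\<^sub>F i in sequentially. fderiv n (snd d \<circ> cinv c) (Fi i (x i)) (fderiv n (Fi i) (x i) (u i)) =
      rep_deriv M b d (glue (Fi i)) (w i) (v i)"
    using gd(1) by eventually_elim (simp add: der_i)
  ultimately have "(\<lambda>i. rep_deriv M b d (glue (Fi i)) (w i) (v i))
      \<longlonglongrightarrow> rep_deriv M b d (glue F) w0 v0"
    unfolding der_0 by (rule Lim_transform_eventually)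
  then show ?thesis using gd(1) rep by blast
qed

lemma glue_agree:
  assumes F: "supported F" and G: "supported G" and b: "b \<in> charts M" and d: "d \<in> charts N"
    and p: "p \<in> fst b" "\<iota> p \<notin> core" "glue G p \<in> fst d" and v: "v \<in> Rn n"
  shows "glue F p = glue G p"
    and "rep_deriv M b d (glue F) p v = rep_deriv M b d (glue G) p v"
proof -
  have eq: "glue F q = glue G q" if "q \<in> topspace (mtop M)" "\<iota> q \<notin> core" for q
    using glue_out[OF F that] glue_out[OF G that] by simp
  show "glue F p = glue G p" using eq charts_topspace[OF b p(1)] p(2) .
  let ?Q = "{q \<in> fst b. glue G q \<in> fst d} \<inter> {p \<in> topspace (mtop M). \<iota> p \<notin> core}"
  have Q: "openin (mtop M) ?Q" using C1_maps_preimage_open[OF glue_C1[OF G] b d] away_open by blast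
  have o: "ropen (mdim M) (snd b ` ?Q)" by (rule charts_open_image[OF b Q]) auto
  have x: "snd b p \<in> snd b ` ?Q" using p charts_topspace[OF b p(1)] by blast
  have re: "local_rep b d (glue G) y = local_rep b d (glue F) y" if y: "y \<in> snd b ` ?Q" for y
  proof -
    obtain q where "q \<in> ?Q" "y = snd b q" using y by blast
    then show ?thesis using eq[of q] by (simp add: charts_local_rep[OF b])
  qed
  show "rep_deriv M b d (glue F) p v = rep_deriv M b d (glue G) p v"
    by (rule fderiv_ropen_cong[OF o x re C1_on_differentiable[OF C1_maps_rep[OF glue_C1[OF G] b d]]])
       (use p v dims in auto)
qed

text \<open>The maps \<open>glue (Fi i)\<close> and \<open>glue F\<close> differ over the compact set \<open>core\<close> only, and this meets finitely many of the
  chart domains that define a basic neighbourhood.  On each of the remaining compact sets continuous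
  convergence is enough.  A limit point of the source lies over the chart \<open>c\<close>, and then the coordinates
  apply, or off \<open>core\<close>, and then the maps agree near it.\<close>

lemma glue_tendsto:
  assumes Fi: "\<And>i. supported (Fi i)" and F: "supported F"
    and conv: "\<And>r x x0 u u0. strict_mono (r :: nat \<Rightarrow> nat) \<Longrightarrow> (\<And>i. x i \<in> Rn n) \<Longrightarrow> x0 \<in> Rn n \<Longrightarrow> x \<longlonglongrightarrow> x0 \<Longrightarrow>
      (\<And>i. u i \<in> Rn n) \<Longrightarrow> u0 \<in> Rn n \<Longrightarrow> u \<longlonglongrightarrow> u0 \<Longrightarrow>
      (\<lambda>i. Fi (r i) (x i)) \<longlonglongrightarrow> F x0 \<and> (\<lambda>i. fderiv n (Fi (r i)) (x i) (u i)) \<longlonglongrightarrow> fderiv n F x0 u0"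
    and S: "openin (strong_topology M N) S" "glue F \<in> S"
  shows "\<forall>\<^sub>F i in sequentially. glue (Fi i) \<in> S"
proof (rule strong_topology_tendsto[OF _ S])
  fix g' I b K d \<epsilon>
  assume data: "strong_data M N g' I b K d \<epsilon>" and mem: "glue F \<in> strong_nhd M N g' I b K d \<epsilon>"
  let ?J = "{i\<in>I. fst (b i) \<inter> {p \<in> topspace (mtop M). \<iota> p \<in> core} \<noteq> {}}"
  have g': "g' \<in> C1_maps M N" and D: "\<And>i. i \<in> I \<Longrightarrow> b i \<in> charts M \<and> compactin (mtop M) (K i) \<and> K i \<subseteq> fst (b i) \<and>
      d i \<in> charts N \<and> g' ` K i \<subseteq> fst (d i)"
    and lf: "\<forall>p\<in>topspace (mtop M). \<exists>W. openin (mtop M) W \<and> p \<in> W \<and> finite {i\<in>I. fst (b i) \<inter> W \<noteq> {}}"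
    using data by (simp_all add: strong_data_def)
  have cl: "C1_close M (b i) (K i) (d i) (\<epsilon> i) g' (glue F)" if "i \<in> I" for i
    using mem that by (simp add: strong_nhd_eq)
  have "finite ?J" by (rule compact_meets_finitely_many[OF \<iota>_compact[OF compactin_core] lf])
  moreover have "\<forall>\<^sub>F j in sequentially. C1_close M (b i) (K i) (d i) (\<epsilon> i) g' (glue (Fi j))" if "i \<in> ?J" for i
  proof -
    have i: "i \<in> I" using that by simp
    have bM: "b i \<in> charts M" and K: "compactin (mtop M) (K i)" "K i \<subseteq> fst (b i)" and dN: "d i \<in> charts N"
      and gd: "g' ` K i \<subseteq> fst (d i)" using D[OF i] by auto
    show ?thesis
    proof (rule eventually_C1_close[OF bM dN K g' gd cl[OF i]])
      fix r :: "nat \<Rightarrow> nat" and w w0 v v0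
      assume r: "strict_mono r" and w: "\<And>n. w n \<in> K i" "w0 \<in> K i"
        and lim: "(\<lambda>n. snd (b i) (w n)) \<longlonglongrightarrow> snd (b i) w0"
        and v: "\<And>j. v j \<in> Rn (mdim M)" "v0 \<in> Rn (mdim M)" "v \<longlonglongrightarrow> v0"
      have wb: "w n \<in> fst (b i)" "w0 \<in> fst (b i)" for n using w K(2) by auto
      have d0: "glue F w0 \<in> fst (d i)" by (rule C1_closeD(1)[OF cl[OF i] w(2)])
      have wlim: "limitin (mtop M) w w0 sequentially" by (rule limitin_chart[OF bM wb lim])
      let ?concl = "\<lambda>w v r. (\<forall>\<^sub>F n in sequentially. glue (Fi (r n)) (w n) \<in> fst (d i)) \<and>
        (\<lambda>n. local_rep (b i) (d i) (glue (Fi (r n))) (snd (b i) (w n))) \<longlonglongrightarrow> local_rep (b i) (d i) (glue F) (snd (b i) w0) \<and>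
        (\<lambda>n. rep_deriv M (b i) (d i) (glue (Fi (r n))) (w n) (v n))
          \<longlonglongrightarrow> rep_deriv M (b i) (d i) (glue F) w0 v0"
      show "?concl w v r"
      proof (cases "w0 \<in> fst (pullback c)")
        case True
        \<comment> \<open>from the index \<open>k\<close> on the sequence stays over the chart \<open>c\<close>\<close>
        obtain k where k: "\<And>j. k \<le> j \<Longrightarrow> w j \<in> fst (pullback c)"
          using chart_limitin(1)[OF pullback_charts[OF c] True wlim] by (auto simp: eventually_sequentially)
        have rk: "strict_mono (\<lambda>j. r (j + k))" using r by (simp add: strict_mono_def)
        have shifted: "?concl (\<lambda>j. w (j + k)) (\<lambda>j. v (j + k)) (\<lambda>j. r (j + k))"
          by (rule glue_converges[OF Fi F conv[OF rk] bM dN wb LIMSEQ_ignore_initial_segment[OF lim] d0 _ _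
                LIMSEQ_ignore_initial_segment[OF v(3)] k True])
             (use v dims in simp_all)
        show ?thesis
        proof (intro conjI)
          show "\<forall>\<^sub>F n in sequentially. glue (Fi (r n)) (w n) \<in> fst (d i)"
            by (rule eventually_sequentially_seg[of "\<lambda>n. glue (Fi (r n)) (w n) \<in> fst (d i)" k, THEN iffD1])
               (rule conjunct1[OF shifted])
          show "(\<lambda>n. local_rep (b i) (d i) (glue (Fi (r n))) (snd (b i) (w n)))
              \<longlonglongrightarrow> local_rep (b i) (d i) (glue F) (snd (b i) w0)"
            by (rule LIMSEQ_offset[where k=k]) (rule conjunct1[OF conjunct2[OF shifted]])
          show "(\<lambda>n. rep_deriv M (b i) (d i) (glue (Fi (r n))) (w n) (v n))
              \<longlonglongrightarrow> rep_deriv M (b i) (d i) (glue F) w0 v0"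
            by (rule LIMSEQ_offset[where k=k]) (rule conjunct2[OF conjunct2[OF shifted]])
        qed
      next
        case False
        then have "w0 \<in> {p \<in> topspace (mtop M). \<iota> p \<notin> core}"
          using charts_topspace[OF bM wb(2)] by (auto simp: mem_pullback core_def)
        then have away: "\<forall>\<^sub>F j in sequentially. w j \<in> {p \<in> topspace (mtop M). \<iota> p \<notin> core}"
          using wlim away_open unfolding limitin_def by blast
        let ?U = "{p \<in> fst (b i). glue F p \<in> fst (d i)}"
        have "\<forall>\<^sub>F j in sequentially. w j \<in> ?U"
          using wlim C1_maps_preimage_open[OF glue_C1[OF F] bM dN] wb(2) d0 unfolding limitin_def by blast
        with away have ev: "\<forall>\<^sub>F j in sequentially. w j \<in> ?U \<and> \<iota> (w j) \<notin> core" by eventually_elim simp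
        have rep: "C1_on (mdim M) (snd (b i) ` ?U) (local_rep (b i) (d i) (glue F))"
          by (rule C1_maps_rep[OF glue_C1[OF F] bM dN])
        have UR: "snd (b i) ` ?U \<subseteq> Rn (mdim M)" using charts_Rn[OF bM] by auto
        have xU: "\<forall>\<^sub>F j in sequentially. snd (b i) (w j) \<in> snd (b i) ` ?U" using ev by eventually_elim blast
        have x0U: "snd (b i) w0 \<in> snd (b i) ` ?U" using wb(2) d0 by blast
        have 1: "(\<lambda>j. local_rep (b i) (d i) (glue F) (snd (b i) (w j))) \<longlonglongrightarrow> local_rep (b i) (d i) (glue F) (snd (b i) w0)"
          by (rule continuous_on_tendsto_compose[OF C1_on_continuous_on[OF rep UR] lim x0U xU])
        have 2: "(\<lambda>j. rep_deriv M (b i) (d i) (glue F) (w j) (v j))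
            \<longlonglongrightarrow> rep_deriv M (b i) (d i) (glue F) w0 v0"
          by (rule tendsto_fderiv[OF rep xU x0U lim _ v(2,3)]) (simp add: v)
        have agree: "\<forall>\<^sub>F j in sequentially. glue (Fi (r j)) (w j) = glue F (w j) \<and>
            rep_deriv M (b i) (d i) (glue (Fi (r j))) (w j) (v j) =
            rep_deriv M (b i) (d i) (glue F) (w j) (v j)"
          using ev
        proof eventually_elim
          case (elim j)
          show ?case
            using glue_agree[OF Fi F bM dN, of "w j" "v j" "r j"] elim v(1)[of j] dims by simp
        qed
        have "\<forall>\<^sub>F j in sequentially. glue (Fi (r j)) (w j) \<in> fst (d i)"
          using agree ev by eventually_elim simp
        moreover have "\<forall>\<^sub>F j in sequentially. local_rep (b i) (d i) (glue F) (snd (b i) (w j)) =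
            local_rep (b i) (d i) (glue (Fi (r j))) (snd (b i) (w j))"
          using agree by eventually_elim (simp add: charts_local_rep[OF bM wb(1)])
        moreover have "\<forall>\<^sub>F j in sequentially. rep_deriv M (b i) (d i) (glue F) (w j) (v j) =
            rep_deriv M (b i) (d i) (glue (Fi (r j))) (w j) (v j)"
          using agree by eventually_elim simp
        ultimately show ?thesis
          by (intro conjI Lim_transform_eventually[OF 1] Lim_transform_eventually[OF 2])
      qed
    qed
  qed
  ultimately have "\<forall>\<^sub>F j in sequentially. \<forall>i\<in>?J. C1_close M (b i) (K i) (d i) (\<epsilon> i) g' (glue (Fi j))"
    by (intro eventually_ball_finite ballI)
  then show "\<forall>\<^sub>F j in sequentially. glue (Fi j) \<in> strong_nhd M N g' I b K d \<epsilon>"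
  proof eventually_elim
    case (elim j)
    have "C1_close M (b i) (K i) (d i) (\<epsilon> i) g' (glue (Fi j))" if i: "i \<in> I" for i
    proof (cases "i \<in> ?J")
      case True then show ?thesis using elim by blast
    next
      case False
      have bM: "b i \<in> charts M" and dN: "d i \<in> charts N" and K: "K i \<subseteq> fst (b i)" using D[OF i] by auto
      have out: "\<iota> p \<notin> core" "p \<in> topspace (mtop M)" if "p \<in> fst (b i)" for p
        using False i that charts_topspace[OF bM that] by auto
      show ?thesis
        by (rule C1_close_cong[OF bM dN K glue_C1[OF F] _ cl[OF i]])
           (simp add: glue_out[OF Fi] glue_out[OF F] out)
    qed
    then show ?case using glue_C1[OF Fi] by (simp add: strong_nhd_eq)
  qed
qed

end

section \<open>Openness implies regularity\<close>

text \<open>The linear algebra of a point where regularity fails.  The functional \<open>lam\<close> vanishes on \<open>A\<close>, and \<open>L i\<close> moves the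
  vectors of a basis of \<open>A\<close> to nearby vectors of \<open>W i\<close> and kills \<open>v\<close>.  Hence \<open>id + L i\<close> is injective, maps \<open>A\<close> onto \<open>W i\<close> and
  fixes \<open>v\<close>.  The map \<open>u \<mapsto> u + L i u - lam u *\<^sub>R v\<close> is the composition of the projection to the kernel of \<open>lam\<close> with \<open>id + L i\<close>;
  so its image and \<open>W i\<close> both lie in the image of the kernel, which does not contain \<open>v\<close>.\<close>

lemma frame_perturbation:
  assumes A: "subspace A" "A \<subseteq> Rn n" and v: "v \<in> Rn n" "v \<notin> A"
    and W: "\<And>i. subspace (W i)" "\<And>i. W i \<subseteq> Rn n" "grassmann_tendsto W A"
  shows "\<exists>lam L. bounded_linear lam \<and> lam v = 1 \<and> (\<forall>i. bounded_linear (L i)) \<and> (\<forall>i u. L i u \<in> Rn n) \<and>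
    (\<forall>u. (\<lambda>i. L i u) \<longlonglongrightarrow> 0) \<and>
    (\<forall>\<^sub>F i in sequentially. (\<forall>u\<in>Rn n. norm (L i u) \<le> norm u / 2) \<and>
       v \<notin> (\<lambda>u. u + L i u - lam u *\<^sub>R v) ` Rn n + W i)"
proof -
  obtain B where B: "finite B" "independent B" "B \<subseteq> A" "span B = A" "card B = dim A"
    using subspace_basis[OF A] .
  have vB: "v \<notin> B" using v B by blast
  have indep: "independent (insert v B)" using v(2) B by (intro independent_insertI) auto
  have "\<forall>b. \<exists>\<phi>. linear \<phi> \<and> (\<forall>x\<in>insert v B. \<phi> x = (if x = b then 1 else (0::real)))"
    by (rule allI, rule linear_independent_extend[OF indep])
  then obtain \<phi> where "\<forall>b. linear (\<phi> b) \<and> (\<forall>x\<in>insert v B. \<phi> b x = (if x = b then 1 else (0::real)))"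
    by (rule choice[THEN exE])
  then have \<phi>: "\<And>b. linear (\<phi> b)" "\<And>b x. x \<in> insert v B \<Longrightarrow> \<phi> b x = (if x = b then 1 else 0)" by blast+
  have "\<forall>b. \<exists>t. b \<in> B \<longrightarrow> (\<forall>i. t i \<in> W i) \<and> t \<longlonglongrightarrow> b"
  proof
    fix b
    show "\<exists>t. b \<in> B \<longrightarrow> (\<forall>i. t i \<in> W i) \<and> t \<longlonglongrightarrow> b"
      using grassmann_tendsto_approx[OF W(3,1) A(1), of b] B(3) by (cases "b \<in> B") auto
  qed
  then obtain t where "\<forall>b. b \<in> B \<longrightarrow> (\<forall>i. t b i \<in> W i) \<and> t b \<longlonglongrightarrow> b" by (rule choice[THEN exE])
  then have t: "\<And>b i. b \<in> B \<Longrightarrow> t b i \<in> W i" "\<And>b. b \<in> B \<Longrightarrow> t b \<longlonglongrightarrow> b" by blast+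
  have BR: "b \<in> Rn n" if "b \<in> B" for b using that B(3) A(2) by blast
  define \<psi> where "\<psi> b u = \<phi> b (proj n u)" for b u
  have \<psi>: "bounded_linear (\<psi> b)" for b
    unfolding \<psi>_def[abs_def] by (rule bounded_linear_proj_comp[OF \<phi>(1)])
  have \<psi>B: "\<psi> b x = (if x = b then 1 else 0)" if "x \<in> insert v B" for b x
    using that \<phi>(2)[OF that] v(1) BR by (auto simp: \<psi>_def proj_id)
  define L where "L i u = (\<Sum>b\<in>B. \<psi> b u *\<^sub>R (t b i - b))" for i u
  have L: "bounded_linear (L i)" for i
    unfolding L_def[abs_def] by (rule bounded_linear_sum, rule bounded_linear_scaleR_const, rule \<psi>)
  have LR: "L i u \<in> Rn n" for i u
    unfolding L_def using t(1) W(2) BR by (intro Rn_sum Rn_scale Rn_diff) blast+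
  have Lv: "L i v = 0" for i
  proof -
    have "\<psi> b v = 0" if "b \<in> B" for b using \<psi>B[of v b] vB that by auto
    then show ?thesis by (simp add: L_def)
  qed
  have LB: "b + L i b = t b i" if b: "b \<in> B" for b i
  proof -
    have "L i b = (\<Sum>b'\<in>B. if b = b' then t b' i - b' else 0)"
      unfolding L_def by (rule sum.cong[OF refl]) (use \<psi>B[of b] b in simp)
    also have "\<dots> = t b i - b" using b B(1) by simp
    finally show ?thesis by simp
  qed
  have L0: "(\<lambda>i. L i u) \<longlonglongrightarrow> 0" for u
  proof -
    have "(\<lambda>i. L i u) \<longlonglongrightarrow> (\<Sum>b\<in>B. \<psi> b u *\<^sub>R (b - b))"
      unfolding L_def by (intro tendsto_intros t(2)) auto
    then show ?thesis by simp
  qed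
  have small: "\<forall>\<^sub>F i in sequentially. \<forall>u\<in>Rn n. norm (L i u) \<le> norm u / 2"
  proof -
    have "\<exists>k. \<forall>u. norm (\<psi> b u) \<le> norm u * k" for b using bounded_linear.bounded[OF \<psi>] by blast
    then obtain k where k: "\<And>b u. norm (\<psi> b u) \<le> norm u * k b" by metis
    have "(\<lambda>i. \<Sum>b\<in>B. \<bar>k b\<bar> * norm (t b i - b)) \<longlonglongrightarrow> (\<Sum>b\<in>B. \<bar>k b\<bar> * norm (b - b))"
      by (intro tendsto_intros t(2)) auto
    then have "\<forall>\<^sub>F i in sequentially. (\<Sum>b\<in>B. \<bar>k b\<bar> * norm (t b i - b)) < 1/2"
      by (intro order_tendstoD(2)) auto
    then show ?thesis
    proof eventually_elim
      case (elim i)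
      show ?case
      proof
        fix u :: rseq
        have "norm (L i u) \<le> (\<Sum>b\<in>B. norm u * (\<bar>k b\<bar> * norm (t b i - b)))"
          unfolding L_def
        proof (rule norm_sum[THEN order_trans], rule sum_mono)
          fix b
          have "norm (\<psi> b u) \<le> norm u * \<bar>k b\<bar>"
            by (rule order_trans[OF k]) (intro mult_left_mono abs_ge_self norm_ge_zero)
          then have "norm (\<psi> b u) * norm (t b i - b) \<le> norm u * \<bar>k b\<bar> * norm (t b i - b)"
            by (rule mult_right_mono) simp
          then show "norm (\<psi> b u *\<^sub>R (t b i - b)) \<le> norm u * (\<bar>k b\<bar> * norm (t b i - b))"
            by (simp add: mult.assoc)
        qed
        also have "\<dots> = norm u * (\<Sum>b\<in>B. \<bar>k b\<bar> * norm (t b i - b))" by (simp add: sum_distrib_left)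
        also have "\<dots> \<le> norm u * (1/2)" using elim by (intro mult_left_mono) auto
        finally show "norm (L i u) \<le> norm u / 2" by simp
      qed
    qed
  qed
  have "\<forall>\<^sub>F i in sequentially. dim (W i) = dim A" using W(3) by (simp add: grassmann_tendsto_def)
  with small have "\<forall>\<^sub>F i in sequentially. (\<forall>u\<in>Rn n. norm (L i u) \<le> norm u / 2) \<and>
       v \<notin> (\<lambda>u. u + L i u - \<psi> v u *\<^sub>R v) ` Rn n + W i"
  proof eventually_elim
    case (elim i)
    let ?T = "\<lambda>u. u + L i u"
    have T: "linear ?T"
      by (intro bounded_linear.linear bounded_linear_add bounded_linear_ident L)
    have T0: "x = 0" if x: "x \<in> Rn n" "?T x = 0" for x
    proof -
      have "x = - L i x" using x(2) by (simp add: eq_neg_iff_add_eq_0)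
      then have "norm x = norm (L i x)" by (metis norm_minus_cancel)
      also have "\<dots> \<le> norm x / 2" using elim(1) x(1) by blast
      finally show ?thesis by simp
    qed
    have inj: "inj_on ?T (Rn n)"
      by (subst linear_injective_on_subspace_0[OF T subspace_Rn]) (use T0 in blast)
    have injA: "inj_on ?T (span B)" using inj_on_subset[OF inj] A(2) B(4) by simp
    have TB: "?T ` B = (\<lambda>b. t b i) ` B" using LB by (intro image_cong) auto
    have "span (?T ` B) = W i"
    proof (rule span_full_card[OF W(1,2)])
      show "?T ` B \<subseteq> W i" unfolding TB using t(1) by blast
      show "independent (?T ` B)" by (rule linear_independent_injective_image[OF T B(2) injA])
      show "card (?T ` B) = dim (W i)"
        using card_image[OF inj_on_subset[OF injA span_superset]] B(5) elim(2) by simp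
    qed
    then have TA: "?T ` A = W i" using linear_span_image[OF T, of B] B(4) by simp
    have \<psi>A: "\<psi> v s = 0" if "s \<in> A" for s
    proof -
      have "s \<in> span B" using that B(4) by simp
      then have "\<psi> v s = (\<lambda>_. 0) s"
        by (rule linear_eq_on[OF bounded_linear.linear[OF \<psi>] module_hom_zero]) (use \<psi>B vB in auto)
      then show ?thesis by simp
    qed
    have "v \<notin> (\<lambda>u. u + L i u - \<psi> v u *\<^sub>R v) ` Rn n + W i"
    proof
      assume "v \<in> (\<lambda>u. u + L i u - \<psi> v u *\<^sub>R v) ` Rn n + W i"
      then obtain u s where us: "u \<in> Rn n" "s \<in> A" "v = u + L i u - \<psi> v u *\<^sub>R v + ?T s"
        unfolding TA[symmetric] set_plus_def by auto
      have "?T (u - \<psi> v u *\<^sub>R v + s) = u - \<psi> v u *\<^sub>R v + s + (L i u - \<psi> v u *\<^sub>R L i v + L i s)"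
        by (simp add: linear_add[OF bounded_linear.linear[OF L]] linear_diff[OF bounded_linear.linear[OF L]]
            linear_cmul[OF bounded_linear.linear[OF L]])
      also have "\<dots> = v" using us(3) Lv by (simp add: algebra_simps)
      also have "\<dots> = ?T v" using Lv by simp
      finally have "u - \<psi> v u *\<^sub>R v + s = v"
        by (rule inj_onD[OF inj]) (use us A v in \<open>auto intro!: Rn_add Rn_diff Rn_scale\<close>)
      then have "\<psi> v v = \<psi> v (u - \<psi> v u *\<^sub>R v + s)" by simp
      also have "\<dots> = \<psi> v u - \<psi> v u * \<psi> v v + \<psi> v s"
        by (simp add: linear_add[OF bounded_linear.linear[OF \<psi>]] linear_diff[OF bounded_linear.linear[OF \<psi>]]
            linear_cmul[OF bounded_linear.linear[OF \<psi>]])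
      finally show False using \<psi>B[of v v] \<psi>A[OF us(2)] by simp
    qed
    then show ?case using elim(1) by blast
  qed
  then show ?thesis
    using \<psi>[of v] \<psi>B[of v v] L LR L0 by (intro exI[of _ "\<psi> v"] exI[of _ L]) simp
qed

lemma set_plus_full:
  "subspace L \<Longrightarrow> L \<subseteq> Rn n \<Longrightarrow> D = Rn n \<Longrightarrow> D + L = Rn n"
  by (auto simp: set_plus_def intro: Rn_add) (metis add_0_right subspace_0)

context diffeo
begin

text \<open>Suppose that the leaf of \<open>Y\<close> has a tangent vector \<open>v'\<close> at \<open>y\<close> outside \<open>\<tau>\<close>.  Pinch \<open>N\<close> at \<open>y\<close> along \<open>v'\<close>: the resulting map
  is a submersion except at \<open>y\<close>, where the direction \<open>v'\<close> that its differential misses is tangent to the leaf; so it is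
  transverse.  The perturbations that take \<open>y\<close> to \<open>x i\<close>, with the differentials from \<open>frame_perturbation\<close>, converge to
  it in the strong topology and fail to be transverse to the leaf of \<open>X\<close> through \<open>x i\<close>.\<close>

lemma open_imp_af_regular_at:
  assumes \<Sigma>: "prestratification N V \<Sigma>" and f: "stratified_map N P \<Sigma> f"
    and op: "openin (strong_topology M N) {g \<in> C1_maps M N. transverse M N P f \<Sigma> g}"
    and X: "X \<in> \<Sigma>" and Y: "Y \<in> \<Sigma>" "y \<in> Y"
  shows "af_regular_at N P f X Y y"
  unfolding af_regular_at_def
proof (intro allI impI subsetI)
  fix x \<tau> v'
  assume x\<tau>: "(\<forall>i. x i \<in> X) \<and> grassmann_bundle_tendsto N x (\<lambda>i. leaf_tangent N P f X (x i)) y \<tau>"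
    and v': "v' \<in> leaf_tangent N P f Y y"
  let ?n = "mdim N" and ?leaf = "leaf_tangent N P f"
  have fC: "f \<in> C1_maps N P" using f by (simp add: stratified_map_def)
  have S: "embedded_submanifold N S" if "S \<in> \<Sigma>" for S using \<Sigma> that by (simp add: prestratification_def)
  have xX: "x i \<in> X" for i using x\<tau> by blast
  have xlim: "limitin (mtop N) x y sequentially" and \<tau>: "subspace \<tau>" "\<tau> \<subseteq> tangent_space N y"
    using x\<tau> by (auto simp: grassmann_bundle_tendsto_def)
  obtain c where ca: "c \<in> charts_at N y"
    and gt: "grassmann_tendsto (\<lambda>i. (\<lambda>v. v c) ` ?leaf X (x i)) ((\<lambda>v. v c) ` \<tau>)"
    using x\<tau> unfolding grassmann_bundle_tendsto_def by blast
  have cN: "c \<in> charts N" "y \<in> fst c" using ca by (auto simp: charts_at_iff)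
  let ?ev = "\<lambda>v::'a tvec. v c"
  let ?A = "?ev ` \<tau>" and ?W = "\<lambda>i. ?ev ` ?leaf X (x i)"
  define v where "v = v' c"
  define z0 where "z0 = snd c y"
  have v'T: "v' \<in> tangent_space N y" by (rule subsetD[OF leaf_tangent_subset v'])
  have vR: "v \<in> Rn ?n" unfolding v_def by (rule tangent_space_Rn[OF v'T ca])
  have z0R: "z0 \<in> Rn ?n" unfolding z0_def by (rule charts_Rn[OF cN])
  have AR: "?A \<subseteq> Rn ?n" by (rule image_subsetI) (rule tangent_space_Rn[OF subsetD[OF \<tau>(2)] ca])
  have WR: "?W i \<subseteq> Rn ?n" for i
  proof (rule image_subsetI)
    fix u assume "u \<in> ?leaf X (x i)"
    then have "u \<in> tangent_space N (x i)" by (rule subsetD[OF leaf_tangent_subset])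
    then show "u c \<in> Rn ?n"
      using tangent_space_Rn[of u N "x i" c] tangent_space_outside[of u N "x i" c] Rn_0 by metis
  qed
  have Ws: "subspace (?W i)" for i
    by (rule subspace_eval_image[OF subspace_leaf_tangent[OF N fC S[OF X] xX]])
  show "v' \<in> \<tau>"
  proof (rule ccontr)
    assume "v' \<notin> \<tau>"
    have "v \<notin> ?A"
    proof
      assume "v \<in> ?A"
      then obtain u where "u \<in> \<tau>" "u c = v' c" by (auto simp: v_def)
      then have "u = v'" using tangent_space_eqI[OF _ v'T ca] \<tau>(2) by blast
      then show False using \<open>u \<in> \<tau>\<close> \<open>v' \<notin> \<tau>\<close> by simp
    qed
    from frame_perturbation[OF subspace_eval_image[OF \<tau>(1)] AR vR this Ws WR gt]
    obtain lam L where *: "bounded_linear lam \<and> lam v = 1 \<and> (\<forall>i. bounded_linear (L i)) \<and> (\<forall>i u. L i u \<in> Rn ?n) \<and>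
      (\<forall>u. (\<lambda>i. L i u) \<longlonglongrightarrow> 0) \<and>
      (\<forall>\<^sub>F i in sequentially. (\<forall>u\<in>Rn ?n. norm (L i u) \<le> norm u / 2) \<and>
         v \<notin> (\<lambda>u. u + L i u - lam u *\<^sub>R v) ` Rn ?n + ?W i)"
      by (elim exE)
    have lam: "bounded_linear lam" "lam v = 1" and L: "\<And>i. bounded_linear (L i)" "\<And>i u. L i u \<in> Rn ?n"
      and L0: "\<And>u. (\<lambda>i. L i u) \<longlonglongrightarrow> 0"
      and ev: "\<forall>\<^sub>F i in sequentially. (\<forall>u\<in>Rn ?n. norm (L i u) \<le> norm u / 2) \<and>
         v \<notin> (\<lambda>u. u + L i u - lam u *\<^sub>R v) ` Rn ?n + ?W i"
      using * by (elim conjE, simp)+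
    have "ropen ?n (snd c ` fst c)" by (rule charts_open_image[OF cN(1) charts_open[OF cN(1)] order_refl])
    moreover have "z0 \<in> snd c ` fst c" using cN(2) by (simp add: z0_def)
    ultimately obtain R where R: "R > 0" "Rn ?n \<inter> cball z0 R \<subseteq> snd c ` fst c"
      unfolding openin_contains_cball by (metis Int_commute)
    \<comment> \<open>chosen such that the bound \<open>4 * (sqrt \<rho> * (1 + norm v))\<close> for the size of the support is \<open>R\<close>\<close>
    define \<rho> where "\<rho> = (R / (4 * (1 + norm v)))\<^sup>2"
    have nv: "0 < 1 + norm v" using norm_ge_zero[of v] by linarith
    have \<rho>: "0 < \<rho>" using R(1) nv by (simp add: \<rho>_def)
    have "sqrt \<rho> = R / (4 * (1 + norm v))" using R(1) nv by (simp add: \<rho>_def)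
    then have R4: "R / 4 = sqrt \<rho> * (1 + norm v)" using nv by (simp add: field_simps)
    interpret pinch_map ?n z0 v lam \<rho>
      by (rule pinch_map.intro[OF z0R vR lam \<rho>])
    interpret chart_support M N \<iota> c z0 R
      by (rule chart_support.intro[OF diffeo_axioms chart_support_axioms.intro[OF cN(1) R(2)]])
    define a where "a i = snd c (x i) - z0" for i
    have alim: "a \<longlonglongrightarrow> 0"
      using tendsto_diff[OF chart_limitin(2)[OF cN xlim] tendsto_const[of z0]] by (simp add: a_def[abs_def] z0_def)
    have "\<forall>\<^sub>F i in sequentially. norm (a i) < R / 4"
      using order_tendstoD(2)[OF tendsto_norm[OF alim], of "R / 4"] R(1) by simp
    with ev chart_limitin(1)[OF cN xlim]
    have "\<forall>\<^sub>F i in sequentially. x i \<in> fst c \<and> norm (a i) \<le> R / 4 \<and> (\<forall>u\<in>Rn ?n. norm (L i u) \<le> norm u / 2) \<and>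
         v \<notin> (\<lambda>u. u + L i u - lam u *\<^sub>R v) ` Rn ?n + ?W i"
      by eventually_elim simp
    \<comment> \<open>the perturbations below start at the index \<open>k\<close>, so that all of them satisfy the bounds\<close>
    then obtain k where k: "\<And>i. k \<le> i \<Longrightarrow> x i \<in> fst c \<and> norm (a i) \<le> R / 4 \<and> (\<forall>u\<in>Rn ?n. norm (L i u) \<le> norm u / 2) \<and>
         v \<notin> (\<lambda>u. u + L i u - lam u *\<^sub>R v) ` Rn ?n + ?W i"
      unfolding eventually_sequentially by blast
    define B where "B i u = L i u - lam u *\<^sub>R v" for i u
    define B0 where "B0 u = - (lam u *\<^sub>R v)" for u
    have Bl: "bounded_linear (B i)" for i
      unfolding B_def[abs_def] by (intro bounded_linear_sub L bounded_linear_scaleR_const lam)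
    have B0l: "bounded_linear B0"
      unfolding B0_def[abs_def] by (intro bounded_linear_minus bounded_linear_scaleR_const lam)
    have aR: "a (i + k) \<in> Rn ?n" for i
      unfolding a_def using charts_Rn[OF cN(1)] k[of "i + k"] z0R by (intro Rn_diff) auto
    have BR: "B i u \<in> Rn ?n" "B0 u \<in> Rn ?n" for i u
      using L(2) vR Rn_diff[OF Rn_0 Rn_scale[OF vR]] by (auto simp: B_def B0_def intro: Rn_diff Rn_scale)
    define F where "F i = pinch (a (i + k)) (B (i + k))" for i
    have supp: "supported (pinch a' B')" if "bounded_linear B'" "a' \<in> Rn ?n" "\<And>u. B' u \<in> Rn ?n" "norm a' \<le> R / 4"
      "\<And>u. u \<in> Rn ?n \<Longrightarrow> norm (B' u + lam u *\<^sub>R v) \<le> norm u" for a' B'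
      unfolding supported_def
      using C1_on_pinch[OF that(1)] pinch_Rn[OF that(2,3)] pinch_support[OF R4 that(4,5)] by simp
    have FS: "supported (F i)" for i
      unfolding F_def
    proof (rule supp[OF Bl aR BR(1)])
      show "norm (a (i + k)) \<le> R / 4" using k[of "i + k"] by simp
      fix u assume "u \<in> Rn ?n"
      then have "norm (L (i + k) u) \<le> norm u / 2" using k[of "i + k"] by simp
      then show "norm (B (i + k) u + lam u *\<^sub>R v) \<le> norm u" by (simp add: B_def) (smt (verit) norm_ge_zero)
    qed
    have GS: "supported (pinch 0 B0)"
      by (rule supp[OF B0l Rn_0 BR(2)]) (use R in \<open>simp_all add: B0_def\<close>)
    obtain p0 where p0: "p0 \<in> topspace (mtop M)" "\<iota> p0 = y"
      using \<iota>_surj[OF charts_topspace[OF cN]] by blast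
    have p0c: "p0 \<in> fst (pullback c)" using p0 cN by (simp add: mem_pullback)
    have sp0: "snd (pullback c) p0 = z0" by (simp add: snd_pullback p0 z0_def)
    have leafs: "subspace (?leaf S q)" "(\<lambda>v. v d) ` ?leaf S q \<subseteq> Rn ?n" if "S \<in> \<Sigma>" "q \<in> S" "d \<in> charts N" "q \<in> fst d" for S q d
      using subspace_leaf_tangent[OF N fC S[OF that(1)] that(2)] leaf_tangent_subset tangent_space_Rn[of _ N q d] that(3,4)
      by (fastforce simp: charts_at_iff)+
    \<comment> \<open>every direction is in the image off the centre; at the centre the leaf supplies the missing direction \<open>v\<close>\<close>
    have "transverse M N P f \<Sigma> (glue (pinch 0 B0))"
      unfolding transverse_iff
    proof (intro ballI impI)
      fix p S assume p: "p \<in> topspace (mtop M)" and S': "S \<in> \<Sigma>" "glue (pinch 0 B0) p \<in> S"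
      show "transverse_at M N P f S (glue (pinch 0 B0)) p"
      proof (cases "\<iota> p \<in> fst c")
        case True
        then have pc: "p \<in> fst (pullback c)" using p by (simp add: mem_pullback)
        note gin = glue_in[OF GS p True]
        note lf = leafs[OF S' cN(1) gin(1)]
        let ?D = "rep_deriv M (pullback c) c (glue (pinch 0 B0)) p ` Rn (mdim M)"
        have xR: "snd (pullback c) p \<in> Rn ?n" using charts_Rn[OF pullback_charts[OF cN(1)] pc] dims by simp
        have D: "?D = pinch' 0 B0 (snd (pullback c) p) ` Rn ?n"
          unfolding dims
          by (rule image_cong[OF refl]) (simp add: glue_derivative_in[OF GS pc, unfolded dims] fderiv_pinch[OF B0l xR])
        have "?D + (\<lambda>v. v c) ` ?leaf S (glue (pinch 0 B0) p) = Rn ?n"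
        proof (cases "snd (pullback c) p = z0")
          case False
          have B0: "B0 = (\<lambda>u. - (lam u *\<^sub>R v))" by (simp add: B0_def fun_eq_iff)
          have "?D = Rn ?n" unfolding D unfolding B0 by (rule pinch'_onto[OF xR False])
          then show ?thesis by (rule set_plus_full[OF subspace_eval_image[OF lf(1)] lf(2)])
        next
          case True
          have D0: "?D = (\<lambda>u. u + B0 u) ` Rn ?n"
            unfolding D unfolding True
            by (rule image_cong[OF refl]) (rule pinch'_centre[OF bounded_linear.linear[OF B0l]])
          have "snd c (glue (pinch 0 B0) p) = z0"
            using gin(2) True pinch_centre[OF bounded_linear.linear[OF B0l], of 0] by (simp add: snd_pullback)
          then have gy: "glue (pinch 0 B0) p = y"
            using charts_cinv[OF cN(1) gin(1)] charts_cinv[OF cN] by (simp add: z0_def)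
          then have "S = Y" using S' Y \<Sigma> by (auto simp: prestratification_def disjoint_def)
          then have vl: "v \<in> (\<lambda>v. v c) ` ?leaf S (glue (pinch 0 B0) p)" using v' gy by (auto simp: v_def)
          show ?thesis
          proof
            show "?D + (\<lambda>v. v c) ` ?leaf S (glue (pinch 0 B0) p) \<subseteq> Rn ?n"
              unfolding D0 using lf(2) BR(2) by (auto simp: set_plus_def intro!: Rn_add)
            show "Rn ?n \<subseteq> ?D + (\<lambda>v. v c) ` ?leaf S (glue (pinch 0 B0) p)"
            proof
              fix u assume u: "u \<in> Rn ?n"
              have "u = (u + B0 u) + lam u *\<^sub>R v" by (simp add: B0_def)
              moreover have "u + B0 u \<in> ?D"
                unfolding D0 using u by (rule imageI)
              moreover have "lam u *\<^sub>R v \<in> (\<lambda>v. v c) ` ?leaf S (glue (pinch 0 B0) p)"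
                by (rule subspace_scale[OF subspace_eval_image[OF lf(1)] vl])
              ultimately show "u \<in> ?D + (\<lambda>v. v c) ` ?leaf S (glue (pinch 0 B0) p)"
                by (metis set_plus_intro)
            qed
          qed
        qed
        then show ?thesis
          by (rule transverse_at_chart_iff[OF M N glue_C1[OF GS] pullback_charts[OF cN(1)] pc cN(1) gin(1), THEN iffD2])
      next
        case False
        then have out: "\<iota> p \<notin> core" by (simp add: core_def)
        note gout = glue_out[OF GS p out]
        obtain d where d: "d \<in> charts N" "\<iota> p \<in> fst d" using charts_at_exists[OF N \<iota>_topspace[OF p]] .
        have pd: "p \<in> fst (pullback d)" using p d by (simp add: mem_pullback)
        have gd: "glue (pinch 0 B0) p \<in> fst d" using d gout by simp
        note lf = leafs[OF S' d(1) gd]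
        have "rep_deriv M (pullback d) d (glue (pinch 0 B0)) p ` Rn (mdim M) = (\<lambda>u. u) ` Rn ?n"
          unfolding dims by (rule image_cong[OF refl]) (rule glue_derivative_out[OF GS d(1) pd out, unfolded dims])
        then have "rep_deriv M (pullback d) d (glue (pinch 0 B0)) p ` Rn (mdim M) +
            (\<lambda>v. v d) ` ?leaf S (glue (pinch 0 B0) p) = Rn ?n"
          by (intro set_plus_full[OF subspace_eval_image[OF lf(1)] lf(2)]) simp
        then show ?thesis
          by (rule transverse_at_chart_iff[OF M N glue_C1[OF GS] pullback_charts[OF d(1)] pd d(1) gd, THEN iffD2])
      qed
    qed
    then have mem: "glue (pinch 0 B0) \<in> {g \<in> C1_maps M N. transverse M N P f \<Sigma> g}"
      using glue_C1[OF GS] by simp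
    have "\<forall>\<^sub>F i in sequentially. glue (F i) \<in> {g \<in> C1_maps M N. transverse M N P f \<Sigma> g}"
    proof (rule glue_tendsto[OF FS GS _ op mem])
      fix r :: "nat \<Rightarrow> nat" and w w0 u u0
      assume r: "strict_mono r" and w: "\<And>i. w i \<in> Rn ?n" "w0 \<in> Rn ?n" "w \<longlonglongrightarrow> w0"
        and u: "\<And>i. u i \<in> Rn ?n" "u0 \<in> Rn ?n" "u \<longlonglongrightarrow> u0"
      have rk: "strict_mono (\<lambda>i. r i + k)" using r by (simp add: strict_mono_def)
      have 1: "(\<lambda>i. a (r i + k)) \<longlonglongrightarrow> 0" using LIMSEQ_subseq_LIMSEQ[OF alim rk] by (simp add: o_def)
      have 2: "(\<lambda>i. B (r i + k) z) \<longlonglongrightarrow> B0 z" for z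
      proof -
        have "(\<lambda>i. L (r i + k) z) \<longlonglongrightarrow> 0" using LIMSEQ_subseq_LIMSEQ[OF L0 rk] by (simp add: o_def)
        from tendsto_diff[OF this tendsto_const[of "lam z *\<^sub>R v"]] show ?thesis by (simp add: B_def B0_def)
      qed
      note lim = pinch_tendsto[OF 1 bounded_linear.linear[OF Bl] bounded_linear.linear[OF B0l] 2 w u]
      show "(\<lambda>i. F (r i) (w i)) \<longlonglongrightarrow> pinch 0 B0 w0 \<and>
          (\<lambda>i. fderiv ?n (F (r i)) (w i) (u i)) \<longlonglongrightarrow> fderiv ?n (pinch 0 B0) w0 u0"
        using lim by (simp add: F_def fderiv_pinch Bl B0l w u)
    qed
    then obtain i where i: "transverse M N P f \<Sigma> (glue (F i))"
      using eventually_happens'[OF sequentially_bot] by blast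
    \<comment> \<open>a single transverse perturbation contradicts the choice of the differentials\<close>
    let ?j = "i + k"
    have iy: "\<iota> p0 \<in> fst c" using p0 cN by simp
    note gin = glue_in[OF FS p0(1) iy]
    have "snd c (glue (F i) p0) = snd c (x ?j)"
      using gin(2) pinch_centre[OF bounded_linear.linear[OF Bl]] by (simp add: F_def p0(2) z0_def[symmetric] a_def)
    moreover have "x ?j \<in> fst c" using k[of ?j] by simp
    ultimately have gx: "glue (F i) p0 = x ?j"
      using charts_cinv[OF cN(1) gin(1)] charts_cinv[OF cN(1)] by metis
    have "transverse_at M N P f X (glue (F i)) p0"
      using i p0(1) X xX gx unfolding transverse_iff by simp
    then have "rep_deriv M (pullback c) c (glue (F i)) p0 ` Rn (mdim M) +
        ?ev ` ?leaf X (glue (F i) p0) = Rn ?n"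
      by (rule transverse_at_chart_iff[OF M N glue_C1[OF FS] pullback_charts[OF cN(1)] p0c cN(1) gin(1), THEN iffD1])
    then have tr: "rep_deriv M (pullback c) c (glue (F i)) p0 ` Rn (mdim M) + ?W ?j = Rn ?n"
      by (simp only: gx)
    have "rep_deriv M (pullback c) c (glue (F i)) p0 ` Rn (mdim M) =
        (\<lambda>u. u + L ?j u - lam u *\<^sub>R v) ` Rn ?n"
      unfolding dims
    proof (rule image_cong[OF refl])
      fix u assume u: "u \<in> Rn ?n"
      have "fderiv ?n (local_rep (pullback c) c (glue (F i))) (snd (pullback c) p0) u = fderiv ?n (F i) z0 u"
        using glue_derivative_in[OF FS p0c u] by (simp add: dims sp0)
      also have "\<dots> = u + B ?j u"
        unfolding F_def fderiv_pinch[OF Bl z0R u] by (rule pinch'_centre[OF bounded_linear.linear[OF Bl]])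
      finally show "fderiv ?n (local_rep (pullback c) c (glue (F i))) (snd (pullback c) p0) u = u + L ?j u - lam u *\<^sub>R v"
        by (simp add: B_def)
    qed
    then show False using tr vR k[of ?j] by simp
  qed
qed

lemma open_imp_af_regular:
  assumes "prestratification N V \<Sigma>" "stratified_map N P \<Sigma> f"
    and "openin (strong_topology M N) {g \<in> C1_maps M N. transverse M N P f \<Sigma> g}"
  shows "af_regular N P f \<Sigma>"
  unfolding af_regular_def af_regular_pair_def
  using open_imp_af_regular_at[OF assms] by blast

end

section \<open>A copy of a manifold in a large type\<close>

text \<open>A point of a Hausdorff space is determined by the members of a base that contain it.\<close>

lemma manifold_lepoll_reals:
  assumes N: "c1_manifold N"
  shows "topspace (mtop N) \<lesssim> (UNIV :: real set)"
proof -
  let ?X = "mtop N"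
  obtain \<B> where B: "countable \<B>" "\<And>V. V \<in> \<B> \<Longrightarrow> openin ?X V"
    "\<And>U x. openin ?X U \<Longrightarrow> x \<in> U \<Longrightarrow> \<exists>V\<in>\<B>. x \<in> V \<and> V \<subseteq> U"
    using N unfolding c1_manifold_def second_countable_def by metis
  define e where "e x = to_nat_on \<B> ` {V\<in>\<B>. x \<in> V}" for x
  have "inj_on e (topspace ?X)"
  proof (rule inj_onI, rule ccontr)
    fix x y assume xy: "x \<in> topspace ?X" "y \<in> topspace ?X" "e x = e y" "x \<noteq> y"
    obtain U U' where U: "openin ?X U" "x \<in> U" "y \<in> U'" "disjnt U U'"
      using N xy unfolding c1_manifold_def Hausdorff_space_def by metis
    obtain V where V: "V \<in> \<B>" "x \<in> V" "V \<subseteq> U" using B(3)[OF U(1,2)] by blast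
    then have "V \<in> {V\<in>\<B>. x \<in> V}" by simp
    then have "to_nat_on \<B> V \<in> e x" unfolding e_def by (rule imageI)
    then have "to_nat_on \<B> V \<in> to_nat_on \<B> ` {V\<in>\<B>. y \<in> V}" unfolding xy(3) by (simp only: e_def)
    then obtain V' where V': "V' \<in> \<B>" "y \<in> V'" "to_nat_on \<B> V = to_nat_on \<B> V'" by auto
    have "V = V'" by (rule inj_onD[OF inj_on_to_nat_on[OF B(1)] V'(3) V(1) V'(1)])
    then have "y \<in> V" using V'(2) by simp
    then show False using V(3) U(3,4) by (auto simp: disjnt_def)
  qed
  then have "topspace ?X \<lesssim> (UNIV :: nat set set)" unfolding lepoll_def by blast
  then show ?thesis using nat_sets_eqpoll_reals lepoll_trans2 by blast
qed

text \<open>The topology and the atlas are transported along an injection of the points of \<open>N\<close> into the type.\<close>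

lemma manifold_copy:
  fixes N :: "'a c1mfd"
  assumes N: "c1_manifold N" and big: "contains_continuum TYPE('m)"
  shows "\<exists>(M :: 'm c1mfd) \<iota>. diffeo M N \<iota>"
proof -
  let ?X = "mtop N" and ?n = "mdim N"
  have "topspace ?X \<lesssim> (UNIV :: 'm set)"
    using manifold_lepoll_reals[OF N] big lepoll_trans unfolding contains_continuum_def by blast
  then obtain j :: "'a \<Rightarrow> 'm" where j: "inj_on j (topspace ?X)" unfolding lepoll_def by blast
  define \<iota> where "\<iota> = inv_into (topspace ?X) j"
  have \<iota>j: "\<iota> (j q) = q" if "q \<in> topspace ?X" for q using j that by (simp add: \<iota>_def)
  define Z where "Z = pullback_topology (j ` topspace ?X) \<iota> ?X"
  have tZ: "topspace Z = j ` topspace ?X"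
    unfolding Z_def topspace_pullback_topology using \<iota>j by auto
  have oZ: "openin Z {p \<in> topspace Z. \<iota> p \<in> U}" if "openin ?X U" for U
    unfolding Z_def openin_pullback_topology topspace_pullback_topology
    using that openin_subset[OF that] \<iota>j by (intro exI[of _ U]) auto
  have im: "\<iota> ` topspace Z = topspace ?X" unfolding tZ using \<iota>j by (force simp: image_iff)
  have inj: "inj_on \<iota> (topspace Z)" unfolding tZ using \<iota>j by (auto intro!: inj_onI)
  have homeo: "homeomorphic_map Z ?X \<iota>"
  proof (rule bijective_open_imp_homeomorphic_map[OF _ _ im inj])
    show "continuous_map Z ?X \<iota>" unfolding continuous_map_def using im oZ by blast
    show "open_map Z ?X \<iota>"
      unfolding open_map_def
    proof (intro allI impI)
      fix U assume "openin Z U"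
      then obtain W where W: "openin ?X W" "U = \<iota> -` W \<inter> j ` topspace ?X"
        by (auto simp: Z_def openin_pullback_topology)
      have "\<iota> ` U = W"
      proof
        show "\<iota> ` U \<subseteq> W" unfolding W(2) by blast
        show "W \<subseteq> \<iota> ` U"
        proof
          fix q assume q: "q \<in> W"
          then have "q \<in> topspace ?X" using openin_subset[OF W(1)] by blast
          then have "j q \<in> U" "q = \<iota> (j q)" using q \<iota>j by (auto simp: W(2))
          then show "q \<in> \<iota> ` U" by (rule rev_image_eqI)
        qed
      qed
      then show "openin ?X (\<iota> ` U)" using W(1) by simp
    qed
  qed
  define pullback where "pullback c = ({p \<in> topspace Z. \<iota> p \<in> fst c}, snd c \<circ> \<iota>)" for c :: "'a chart"
  define M :: "'m c1mfd" where "M = \<lparr>mtop = Z, mdim = ?n, matlas = pullback ` matlas N\<rparr>"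
  have img: "\<iota> ` {p \<in> topspace Z. \<iota> p \<in> A} = A" if that: "A \<subseteq> topspace ?X" for A
  proof
    show "A \<subseteq> \<iota> ` {p \<in> topspace Z. \<iota> p \<in> A}"
    proof
      fix q assume q: "q \<in> A"
      then have "q \<in> \<iota> ` topspace Z" using that im by blast
      then obtain p where "p \<in> topspace Z" "q = \<iota> p" by blast
      then show "q \<in> \<iota> ` {p \<in> topspace Z. \<iota> p \<in> A}" using q by simp
    qed
  qed blast
  have spb: "snd (pullback c) ` {p \<in> topspace Z. \<iota> p \<in> A} = snd c ` A" if "A \<subseteq> topspace ?X" for c A
    by (simp only: pullback_def snd_conv image_comp[symmetric] img[OF that])
  have chart: "is_chart Z ?n (pullback c)" if c: "is_chart ?X ?n c" for c
  proof -
    have cs: "fst c \<subseteq> topspace ?X" by (rule is_chart_topspace[OF c])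
    have "\<iota> ` (topspace Z \<inter> {p \<in> topspace Z. \<iota> p \<in> fst c}) = topspace ?X \<inter> fst c"
      using img[OF cs] cs by (simp add: Int_absorb1 Int_Collect inf.absorb2 Collect_conj_eq[symmetric])
    from homeomorphic_map_subtopologies[OF homeo this]
    have "homeomorphic_map (subtopology Z (fst (pullback c))) (subtopology ?X (fst c)) \<iota>" by (simp add: pullback_def)
    from homeomorphic_map_compose[OF this, of "top_of_set (snd c ` fst c)" "snd c"]
    have "homeomorphic_map (subtopology Z (fst (pullback c))) (top_of_set (snd c ` fst c)) (snd (pullback c))"
      using c by (simp add: is_chart_def pullback_def)
    moreover have "snd (pullback c) ` fst (pullback c) = snd c ` fst c" using spb[OF cs] by (simp add: pullback_def)
    moreover have "openin Z (fst (pullback c))" using oZ c by (simp add: pullback_def is_chart_def)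
    ultimately show ?thesis using c by (simp add: is_chart_def)
  qed
  have half: "C1_on ?n (snd (pullback c) ` (fst (pullback c) \<inter> fst (pullback d))) (snd (pullback d) \<circ> cinv (pullback c))"
    if c: "is_chart ?X ?n c" and d: "is_chart ?X ?n d" and C: "C1_on ?n (snd c ` (fst c \<inter> fst d)) (snd d \<circ> cinv c)" for c d
  proof -
    have A: "fst c \<inter> fst d \<subseteq> topspace ?X" using is_chart_topspace[OF c] by blast
    have "fst (pullback c) \<inter> fst (pullback d) = {p \<in> topspace Z. \<iota> p \<in> fst c \<inter> fst d}" by (auto simp: pullback_def)
    then have eq: "snd (pullback c) ` (fst (pullback c) \<inter> fst (pullback d)) = snd c ` (fst c \<inter> fst d)" using spb[OF A] by simp
    have o: "ropen ?n (snd c ` (fst c \<inter> fst d))"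
      by (rule is_chart_open_image[OF c]) (use c d in \<open>auto simp: is_chart_def\<close>)
    have "(snd d \<circ> cinv c) z = (snd (pullback d) \<circ> cinv (pullback c)) z" if z: "z \<in> snd c ` (fst c \<inter> fst d)" for z
    proof -
      have "z \<in> snd (pullback c) ` (fst (pullback c) \<inter> fst (pullback d))" using z eq by simp
      then obtain p where p: "p \<in> fst (pullback c)" "z = snd (pullback c) p" by blast
      then have "\<iota> p \<in> fst c" "z = snd c (\<iota> p)" by (simp_all add: pullback_def)
      then show ?thesis
        using is_chart_cinv[OF c, of "\<iota> p"] is_chart_cinv[OF chart[OF c] p(1)] p(2) by (simp add: pullback_def)
    qed
    then show ?thesis unfolding eq by (rule C1_on_cong[OF o _ C])
  qed
  have compat: "compatible ?n (pullback c) (pullback d)" if "is_chart ?X ?n c" "is_chart ?X ?n d" "compatible ?n c d" for c d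
    using half[OF that(1,2)] half[OF that(2,1)] that(3) unfolding compatible_def by (simp add: Int_commute)
  have atlas: "is_chart ?X ?n c" "compatible ?n c d" if "c \<in> matlas N" "d \<in> matlas N" for c d
    using N that by (auto simp: c1_manifold_def)
  have hs: "Z homeomorphic_space ?X" using homeo homeomorphic_map_imp_homeomorphic_space by blast
  have "c1_manifold M"
    unfolding c1_manifold_def M_def c1mfd.simps
  proof (intro conjI ballI)
    show "Hausdorff_space Z" using homeomorphic_Hausdorff_space[OF hs] N by (simp add: c1_manifold_def)
    show "second_countable Z" using homeomorphic_space_second_countability[OF hs] N by (simp add: c1_manifold_def)
    show "is_chart Z ?n c" if "c \<in> pullback ` matlas N" for c using that chart atlas(1) by blast
    show "compatible ?n c d" if "c \<in> pullback ` matlas N" "d \<in> pullback ` matlas N" for c d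
      using that compat atlas by blast
    have "(\<Union>c\<in>matlas N. fst c) = topspace ?X" using N by (simp add: c1_manifold_def)
    then have "\<exists>c\<in>matlas N. \<iota> p \<in> fst c" if "p \<in> topspace Z" for p using im that by blast
    then show "(\<Union>c\<in>pullback ` matlas N. fst c) = topspace Z" by (auto simp: pullback_def)
  qed
  moreover have "pullback c \<in> charts M" if c: "c \<in> charts N" for c
    unfolding charts_def M_def using c chart compat atlas(1) by (auto simp: charts_def)
  ultimately have "diffeo M N \<iota>"
    using N homeo by unfold_locales (simp_all add: M_def pullback_def)
  then show ?thesis by blast
qed

lemma diffeo_id:
  assumes N: "c1_manifold N" shows "diffeo N N (\<lambda>p. p)"
proof
  fix c assume c: "c \<in> charts N"
  have "{p \<in> topspace (mtop N). p \<in> fst c} = fst c" using charts_topspace[OF c] by blast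
  then show "({p \<in> topspace (mtop N). p \<in> fst c}, snd c \<circ> (\<lambda>p. p)) \<in> charts N" using c by (simp add: o_def)
qed (use N homeomorphic_map_id[of "mtop N" "mtop N"] in \<open>simp_all add: id_def\<close>)

section \<open>The characterisation of regularity\<close>

theorem theorem4p1:
  fixes N :: "'a c1mfd" and P :: "'b c1mfd"
    and V :: "'a set" and \<Sigma> :: "'a set set" and f :: "'a \<Rightarrow> 'b"
  assumes "c1_manifold N" and "c1_manifold P"
    and "closedin (mtop N) V"
    and "prestratification N V \<Sigma>"
    and "stratified_map N P \<Sigma> f"
    and "contains_continuum TYPE('m)"
  shows "(af_regular N P f \<Sigma> \<longleftrightarrow>
           (\<forall>M :: 'm c1mfd. c1_manifold M \<longrightarrow>
              openin (strong_topology M N) {g \<in> C1_maps M N. transverse M N P f \<Sigma> g})) \<and>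
         (af_regular N P f \<Sigma> \<longleftrightarrow>
              openin (strong_topology N N) {g \<in> C1_maps N N. transverse N N P f \<Sigma> g})"
proof (intro conjI iffI allI impI)
  fix M :: "'m c1mfd"
  assume "af_regular N P f \<Sigma>" "c1_manifold M"
  then show "openin (strong_topology M N) {g \<in> C1_maps M N. transverse M N P f \<Sigma> g}"
    using af_regular_imp_open[OF _ assms(1,3,4,5)] by simp
next
  assume all: "\<forall>M :: 'm c1mfd. c1_manifold M \<longrightarrow>
      openin (strong_topology M N) {g \<in> C1_maps M N. transverse M N P f \<Sigma> g}"
  obtain M :: "'m c1mfd" and \<iota> where M: "diffeo M N \<iota>"
    using manifold_copy[OF assms(1,6)] by (elim exE)
  show "af_regular N P f \<Sigma>"
    by (rule diffeo.open_imp_af_regular[OF M assms(4,5)]) (rule all[rule_format, OF diffeo.M[OF M]])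
next
  assume "af_regular N P f \<Sigma>"
  then show "openin (strong_topology N N) {g \<in> C1_maps N N. transverse N N P f \<Sigma> g}"
    by (rule af_regular_imp_open[OF assms(1,1,3,4,5)])
next
  assume "openin (strong_topology N N) {g \<in> C1_maps N N. transverse N N P f \<Sigma> g}"
  then show "af_regular N P f \<Sigma>"
    by (rule diffeo.open_imp_af_regular[OF diffeo_id[OF assms(1)] assms(4,5)])
qed

end
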